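(* Let $n>1$ take values in an infinite set of positive odd square-free integers such that each prime divisor of $n$ is congruent to $1$ modulo $4$ and such that $$\frac{\max\big(4^{\omega(n)}(\log n)^6,\;5^{\omega(n)}\big)}{\kappa(n)}\to0\quad\text{as } n\to\infty.$$ Let $X_n$ be the Jacobi sequence of length $n$. Then the coefficient sequence of each of the polynomials $N(X_n)^{n-s,2s+1}$ and $P(X_n)^{n-s,2s+1}$ is skew-symmetric for each nonnegative integer $s$, and for real $T>0$ and nonnegative integers $s$ that may depend on $n$ the following hold, as $n\to\infty$: (i) If $s/n\to T$, then $F(N(X_n)^{n-s,2s+1})\to g(\tfrac14-\tfrac{T}{2},T)$. (ii) If $s/(2n)\to T$, then $F(P(X_n)^{n-s,2s+1})\to g(\tfrac14-\tfrac{T}{2},T)$.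
   Context: $\omega(n)$ denotes the number of distinct prime divisors of $n$ and $\kappa(n)$ the smallest prime divisor of $n$. A binary sequence of length $t>1$ is an element $A=(a_0,\dots,a_{t-1})\in\{-1,1\}^t$. Its aperiodic autocorrelation at shift $u\in\{0,\dots,t-1\}$ is $c_u=\sum_{j=0}^{t-u-1}a_ja_{j+u}$, and its merit factor is $F(A)=\dfrac{t^2}{2\sum_{u=1}^{t-1}c_u^2}$. A $\pm1$ sequence $(a_0,a_1,\dots,a_{2s})$ of odd length $2s+1$ is skew-symmetric if $a_{s+j}=(-1)^ja_{s-j}$ for all $j\in\{1,2,\dots,s\}$. A binary sequence $(a_0,\dots,a_{n-1})$ is identified with the polynomial $A(z)=\sum_{j=0}^{n-1}a_jz^j$, of which it is called the coefficient sequence; $F(A)$ denotes the merit factor of the coefficient sequence. Extend $a_j$ to all $j\in\mathbb{Z}$ by $a_{j+n}=a_j$. For integers $r$ and $t\ge0$ define $A^{r,t}(z)=\sum_{j=0}^{t-1}a_{j+r}z^j$ (a sequence of length $t$). Define two polynomials of length $4n$: $$N(A)(z)=\sum_{j=0}^{4n-1}(-1)^{j(j-1)/2}a_jz^j,\qquad P(A)(z)=\sum_{j=0}^{4n-1}(-1)^{j(j-1)^2/2}a_jz^j.$$ In $N(A)^{r,t}$ and $P(A)^{r,t}$ the operation $(\cdot)^{r,t}$ is applied to the length-$4n$ sequences $N(A)$ and $P(A)$, extended with period $4n$. For $j\in\mathbb{Z}$ and $n$ a positive odd integer, $(j\mid n)$ is the Jacobi symbol, extending the Legendre symbol via $(j\mid1)=1$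 and $(j\mid n_1)(j\mid n_2)=(j\mid n_1n_2)$. For $n$ positive, odd and square-free, the Jacobi sequence of length $n$ is the coefficient sequence of $X_n(z)=\sum_{j=0}^{n-1}\big(j\,\big|\,\tfrac{n}{\gcd(j,n)}\big)z^j$, where $\gcd(0,n)=n$. The function $g:\mathbb{R}\times\mathbb{R}^+\to\mathbb{R}$ is defined by $$\frac{1}{g(R,T)}=1-\frac{4T}{3}+4\sum_{m\in\mathbb{N}}\max\Big(0,1-\frac{m}{T}\Big)^2+\sum_{m\in\mathbb{Z}}\max\Big(0,1-\Big|1+\frac{2R-m}{T}\Big|\Big)^2,$$ where $\mathbb{N}$ is the set of positive integers. *)

theory Defs
  imports
    "HOL-Analysis.Analysis"
    "HOL-Number_Theory.Number_Theory"
    "HOL-Computational_Algebra.Squarefree"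
begin

section \<open>Binary sequences\<close>

text \<open>
  A sequence \<open>(a_0, ..., a_{t-1})\<close> is a list of integers of length \<open>t\<close>. The coefficient sequence of
  a polynomial \<open>A\<close> is the library's \<^term>\<open>coeffs A\<close>, which stops at the leading coefficient. For a
  polynomial of length \<open>t\<close> with all coefficients in \<open>{-1, 1}\<close> this is the full list of its \<open>t\<close>
  coefficients.
\<close>

definition autocorr :: "int list \<Rightarrow> nat \<Rightarrow> int" where
  "autocorr a u = (\<Sum>j<length a - u. a ! j * a ! (j + u))"

definition merit_factor :: "int list \<Rightarrow> real" where
  "merit_factor a =
     (real (length a))\<^sup>2 / (2 * (\<Sum>u = 1..<length a. (real_of_int (autocorr a u))\<^sup>2))"

definition skew_symmetric :: "int list \<Rightarrow> bool" where
  "skew_symmetric a \<longleftrightarrow>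
     set a \<subseteq> {-1, 1} \<and>
     (\<exists>s. length a = 2 * s + 1 \<and> (\<forall>j\<in>{1..s}. a ! (s + j) = (-1) ^ j * a ! (s - j)))"


section \<open>Operations on polynomials with binary coefficient sequence\<close>

definition periodic_coeff :: "int poly \<Rightarrow> int \<Rightarrow> int" where
  "periodic_coeff A j = coeffs A ! nat (j mod int (length (coeffs A)))"

text \<open>The polynomial \<open>A^{r,t}\<close>; the shift \<open>r\<close> may be negative.\<close>

definition shift_poly :: "int poly \<Rightarrow> int \<Rightarrow> nat \<Rightarrow> int poly" where
  "shift_poly A r t = (\<Sum>j<t. Polynomial.monom (periodic_coeff A (int j + r)) j)"

definition N_poly :: "int poly \<Rightarrow> int poly" where
  "N_poly A =
     (\<Sum>j<4 * length (coeffs A).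
        Polynomial.monom ((-1) ^ (j * (j - 1) div 2) * periodic_coeff A (int j)) j)"

definition P_poly :: "int poly \<Rightarrow> int poly" where
  "P_poly A =
     (\<Sum>j<4 * length (coeffs A).
        Polynomial.monom ((-1) ^ (j * (j - 1)\<^sup>2 div 2) * periodic_coeff A (int j)) j)"


section \<open>Jacobi sequences\<close>

definition Jacobi :: "int \<Rightarrow> nat \<Rightarrow> int" where
  "Jacobi a n = (\<Prod>p\<in>#prime_factorization n. Legendre a (int p))"

definition jacobi_poly :: "nat \<Rightarrow> int poly" where
  "jacobi_poly n = (\<Sum>j<n. Polynomial.monom (Jacobi (int j) (n div gcd j n)) j)"

definition omega :: "nat \<Rightarrow> nat" where
  "omega n = card (prime_factors n)"

definition kappa :: "nat \<Rightarrow> nat" where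
  "kappa n = Min (prime_factors n)"


section \<open>The asymptotic merit factor\<close>

text \<open>The function \<open>g(R,T)\<close>. It is only used for \<open>T > 0\<close>,
  in which case both sums have finitely many nonzero terms.\<close>

definition merit_limit :: "real \<Rightarrow> real \<Rightarrow> real" where
  "merit_limit R T =
     1 / (1 - 4 * T / 3
          + 4 * (\<Sum>\<^sub>\<infinity>m\<in>{1::nat..}. (max 0 (1 - real m / T))\<^sup>2)
          + (\<Sum>\<^sub>\<infinity>m\<in>(UNIV :: int set). (max 0 (1 - \<bar>1 + (2 * R - real_of_int m) / T\<bar>))\<^sup>2))"

end

theory Submission
  imports Defs "HOL-Real_Asymp.Real_Asymp"
begin

text \<open>
Read around its centre, each of the two sequences is \<open>\<mu> j * x j\<close> for \<open>-s \<le> j \<le> s\<close>, where \<open>\<mu>\<close> is a sign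
pattern of period 4 and \<open>x j\<close> is the product over the primes \<open>p\<close> of \<open>n\<close> of the Legendre symbol
of \<open>j\<close> modulo \<open>p\<close>, with 1 in place of 0. As all \<open>p\<close> are 1 modulo 4, \<open>x\<close> is even, and skew-symmetry is
the identity \<open>\<mu> j = (-1)^j * \<mu> (- j)\<close>.

Let \<open>t = 2 * s + 1\<close> and let \<open>Q\<close> be the sum of the squares of all autocorrelations, at positive and
negative shifts, so that the merit factor is \<open>1 / (Q / t^2 - 1)\<close>. Then \<open>Q\<close> is a sum over the additive
quadruples \<open>i + j = k + l\<close> of the window. Insert the Fourier expansion of \<open>x\<close> modulo \<open>n\<close>. By the
evaluation of Gauss sums its normalised coefficients are products of \<open>\<plusminus> \<chi>\<^sub>p + p powr (-1/2)\<close>.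
Hence \<open>n^2 * Q\<close> becomes a sum, over quadruples of frequencies, of \<open>S a b c d * I a b c d\<close>. Here \<open>I\<close>
depends only on the window and on \<open>\<mu>\<close>, and is invariant under a common translation of the frequencies;
\<open>S\<close> is the average over all translations of the product of the four coefficients, and it
factors over the primes of \<open>n\<close> (\<open>quartic_corr_prod\<close>).

When the frequencies agree in pairs, \<open>S\<close> is close to 1. With \<open>S\<close> replaced by 1, these
quadruples add up to correlations of \<open>\<mu>\<close> at the multiples of \<open>n\<close> (\<open>matched_sum\<close>), whose limit is elementary
(\<open>main_term_limit\<close>) and gives the function \<open>g\<close>.

All other quadruples are negligible. Modulo a prime \<open>p\<close> the local average is \<open>O(p powr (-1/4))\<close>
unless the frequencies are paired modulo \<open>p\<close>. This rests on a bound \<open>O(p powr (3/4))\<close> for quartic character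
sums (\<open>quartic_sum_bound\<close>), which follows from the fourth moment of the character sums over all cubic
polynomials: affine substitutions make every single sum occur about \<open>p^3\<close> times among the \<open>p^4\<close> cubics.
Now divide the primes of \<open>n\<close> into those without a pairing and those with one of the
three pairings (\<open>quartic_corr_dichotomy\<close>). The product over one of the four classes is at least \<open>n powr (1/4)\<close>. If
it is the first class, then \<open>S\<close> is smaller than a constant to the power \<open>\<omega>(n)\<close> times
\<open>n powr (-1/16)\<close>. Otherwise the frequencies are paired modulo a large divisor \<open>D\<close> of \<open>n\<close>
without being equal in pairs, and the total weight of such quadruples
is smaller by a factor of about \<open>D\<close> (\<open>close_pairs\<close>), because two distinct frequencies at distance at least \<open>D / n\<close>
cannot both be close to the pole of the Dirichlet kernel.

The hypothesis on \<open>n\<close> gives \<open>5 ^ \<omega>(n) / \<kappa>(n) \<rightarrow> 0\<close>. It follows that \<open>\<omega>(n)^2 / \<kappa>(n)\<close> tends to 0, which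
makes \<open>S\<close> converge to 1 uniformly on the quadruples that agree in pairs, and that \<open>\<kappa>(n)\<close> tends to infinity,
so that a constant to the power \<open>\<omega>(n)\<close> is smaller than any fixed positive power of \<open>n\<close>.
\<close>

section \<open>Sums over residue classes\<close>

text \<open>
Stated through congruence, periodicity is preserved by every operation that respects congruences.
\<close>
definition periodic_mod :: "nat \<Rightarrow> (int \<Rightarrow> 'a) \<Rightarrow> bool" where
  "periodic_mod N f \<longleftrightarrow> (\<forall>i j. [i = j] (mod int N) \<longrightarrow> f i = f j)"

abbreviation residues_below :: "nat \<Rightarrow> int set" where
  "residues_below N \<equiv> {0..<int N}"

lemma periodic_modD: "periodic_mod N f \<Longrightarrow> [i = j] (mod int N) \<Longrightarrow> f i = f j"
  by (auto simp: periodic_mod_def)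

lemma periodic_mod_mod: "periodic_mod N f \<Longrightarrow> f (k mod int N) = f k"
  by (rule periodic_modD) (auto simp: cong_def)

text \<open>
A map that reflects congruence modulo \<open>N\<close> permutes the residue classes, and a periodic function sees nothing else.
\<close>
lemma sum_residues_reindex:
  fixes f :: "int \<Rightarrow> 'a::comm_monoid_add"
  assumes N: "N > 0" and per: "periodic_mod N f"
    and inj: "\<And>i j. [\<phi> i = \<phi> j] (mod int N) \<Longrightarrow> [i = j] (mod int N)"
  shows "(\<Sum>k\<in>residues_below N. f (\<phi> k)) = (\<Sum>k\<in>residues_below N. f k)"
proof -
  let ?g = "\<lambda>k. \<phi> k mod int N"
  have inj_g: "inj_on ?g (residues_below N)"
  proof (rule inj_onI)
    fix i j assume ij: "i \<in> residues_below N" "j \<in> residues_below N" "?g i = ?g j"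
    have "[i = j] (mod int N)" by (rule inj) (use ij in \<open>simp add: cong_def\<close>)
    thus "i = j" using cong_less_imp_eq_int[of i "int N" j] ij by simp
  qed
  have "?g ` residues_below N \<subseteq> residues_below N" using N by (auto intro: pos_mod_bound)
  from endo_inj_surj[OF _ this inj_g] have "?g ` residues_below N = residues_below N" by blast
  hence "bij_betw ?g (residues_below N) (residues_below N)"
    using inj_g by (simp add: bij_betw_def)
  hence "(\<Sum>k\<in>residues_below N. f (?g k)) = (\<Sum>k\<in>residues_below N. f k)"
    by (rule sum.reindex_bij_betw)
  thus ?thesis by (simp add: periodic_mod_mod[OF per])
qed

lemma sum_residues_shift:
  fixes f :: "int \<Rightarrow> 'a::comm_monoid_add"
  assumes "N > 0" "periodic_mod N f"
  shows "(\<Sum>k\<in>residues_below N. f (k + a)) = (\<Sum>k\<in>residues_below N. f k)"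
  using assms by (intro sum_residues_reindex) (simp_all add: cong_add_rcancel)

lemma sum_residues_mult:
  fixes f :: "int \<Rightarrow> 'a::comm_monoid_add"
  assumes "N > 0" "periodic_mod N f" "coprime c (int N)"
  shows "(\<Sum>k\<in>residues_below N. f (c * k)) = (\<Sum>k\<in>residues_below N. f k)"
  using assms by (intro sum_residues_reindex) (simp_all add: cong_mult_lcancel)

lemma sum_Times4:
  fixes f :: "_ \<Rightarrow> _ \<Rightarrow> _ \<Rightarrow> _ \<Rightarrow> 'a::comm_monoid_add"
  shows "(\<Sum>(a, b, c, d)\<in>A \<times> B \<times> C \<times> D. f a b c d) = (\<Sum>a\<in>A. \<Sum>b\<in>B. \<Sum>c\<in>C. \<Sum>d\<in>D. f a b c d)"
  by (simp only: sum.cartesian_product)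

lemma prod_sums4:
  fixes f g h k :: "_ \<Rightarrow> 'a::comm_semiring_1"
  shows "sum f A * sum g B * sum h C * sum k D = (\<Sum>(a, b, c, d)\<in>A \<times> B \<times> C \<times> D. f a * g b * h c * k d)"
  unfolding sum_Times4 by (simp only: sum_distrib_left[symmetric] sum_distrib_right[symmetric])

definition sum4 :: "'a set \<Rightarrow> ('a \<Rightarrow> 'a \<Rightarrow> 'a \<Rightarrow> 'a \<Rightarrow> 'b::comm_monoid_add) \<Rightarrow> 'b" where
  "sum4 A F = (\<Sum>a\<in>A. \<Sum>b\<in>A. \<Sum>c\<in>A. \<Sum>d\<in>A. F a b c d)"

lemma sum4_tuples: "sum4 A F = (\<Sum>(a, b, c, d)\<in>A \<times> A \<times> A \<times> A. F a b c d)"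
  by (simp only: sum4_def sum_Times4)

lemma sum4_cong:
  "(\<And>a b c d. a \<in> A \<Longrightarrow> b \<in> A \<Longrightarrow> c \<in> A \<Longrightarrow> d \<in> A \<Longrightarrow> F a b c d = G a b c d) \<Longrightarrow> sum4 A F = sum4 A G"
  unfolding sum4_def by (intro sum.cong refl) auto

lemma sum4_mono:
  fixes F G :: "_ \<Rightarrow> _ \<Rightarrow> _ \<Rightarrow> _ \<Rightarrow> 'b::ordered_comm_monoid_add"
  shows "(\<And>a b c d. a \<in> A \<Longrightarrow> b \<in> A \<Longrightarrow> c \<in> A \<Longrightarrow> d \<in> A \<Longrightarrow> F a b c d \<le> G a b c d) \<Longrightarrow> sum4 A F \<le> sum4 A G"
  unfolding sum4_def by (intro sum_mono) auto

lemma norm_sum4_le: "norm (sum4 A F) \<le> sum4 A (\<lambda>a b c d. norm (F a b c d :: 'b::real_normed_vector))"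
  unfolding sum4_tuples by (rule order.trans[OF norm_sum]) (simp add: case_prod_unfold)

lemma sum4_add: "sum4 A (\<lambda>a b c d. F a b c d + G a b c d) = sum4 A F + sum4 A G"
  by (simp only: sum4_def sum.distrib)

lemma sum4_diff: "sum4 A (\<lambda>a b c d. F a b c d - G a b c d) = sum4 A F - (sum4 A G :: 'b::ab_group_add)"
  by (simp only: sum4_def sum_subtractf)

lemma sum4_scale: "sum4 A (\<lambda>a b c d. x * F a b c d) = x * (sum4 A F :: 'b::semiring_0)"
  by (simp only: sum4_def sum_distrib_left)

lemma sum4_of_real: "of_real (sum4 A F) = sum4 A (\<lambda>a b c d. of_real (F a b c d))"
  by (simp only: sum4_def of_real_sum)

lemma sum4_sum_swap: "sum4 A (\<lambda>a b c d. \<Sum>m\<in>M. F m a b c d) = (\<Sum>m\<in>M. sum4 A (F m))"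
  unfolding sum4_tuples case_prod_unfold by (rule sum.swap)

lemma sum4_swap: "sum4 A (\<lambda>a b c d. sum4 B (F a b c d)) = sum4 B (\<lambda>a' b' c' d'. sum4 A (\<lambda>a b c d. F a b c d a' b' c' d'))"
  unfolding sum4_tuples case_prod_unfold by (rule sum.swap)

lemma sum4_prod:
  "sum4 A (\<lambda>a b c d. f a * g b * h c * k d) = sum f A * sum g A * sum h A * (sum k A :: 'b::comm_semiring_1)"
  unfolding sum4_tuples by (rule prod_sums4[symmetric])

lemma sum_delta_of_bool:
  assumes "finite R" "a \<in> R"
  shows "(\<Sum>x\<in>R. of_bool (a = x) * F x) = (F a :: 'b::semiring_1)"
proof -
  have "(\<Sum>x\<in>R. of_bool (a = x) * F x) = (\<Sum>x\<in>R. if a = x then F x else 0)"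
    by (intro sum.cong refl) auto
  thus ?thesis using assms by simp
qed

lemma sum4_shift:
  fixes F :: "int \<Rightarrow> int \<Rightarrow> int \<Rightarrow> int \<Rightarrow> 'b::comm_monoid_add"
  assumes N: "N > 0"
    and cong: "\<And>a b c d a' b' c' d'. [a = a'] (mod int N) \<Longrightarrow> [b = b'] (mod int N) \<Longrightarrow> [c = c'] (mod int N)
    \<Longrightarrow> [d = d'] (mod int N) \<Longrightarrow> F a b c d = F a' b' c' d'"
  shows "sum4 (residues_below N) (\<lambda>a b c d. F (a + s) (b + t) (c + u) (d + v)) = sum4 (residues_below N) F"
proof -
  let ?R = "residues_below N"
  note S = sum_residues_shift[unfolded periodic_mod_def]
  have "(\<Sum>d\<in>?R. F a b c (d + v)) = (\<Sum>d\<in>?R. F a b c d)" for a b c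
    by (intro S N allI impI cong cong_refl)
  moreover have "(\<Sum>c\<in>?R. \<Sum>d\<in>?R. F a b (c + u) d) = (\<Sum>c\<in>?R. \<Sum>d\<in>?R. F a b c d)" for a b
    by (intro S N allI impI sum.cong refl cong cong_refl)
  moreover have "(\<Sum>b\<in>?R. \<Sum>c\<in>?R. \<Sum>d\<in>?R. F a (b + t) c d) = (\<Sum>b\<in>?R. \<Sum>c\<in>?R. \<Sum>d\<in>?R. F a b c d)" for a
    by (intro S N allI impI sum.cong refl cong cong_refl)
  moreover have "(\<Sum>a\<in>?R. \<Sum>b\<in>?R. \<Sum>c\<in>?R. \<Sum>d\<in>?R. F (a + s) b c d) = (\<Sum>a\<in>?R. \<Sum>b\<in>?R. \<Sum>c\<in>?R. \<Sum>d\<in>?R. F a b c d)"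
    by (intro S N allI impI sum.cong refl cong cong_refl)
  ultimately show ?thesis by (simp only: sum4_def)
qed

section \<open>The quadratic character modulo a prime\<close>

text \<open>
The values are real because the symbol is combined with irrational Fourier coefficients.
\<close>
definition chi :: "nat \<Rightarrow> int \<Rightarrow> real" where
  "chi p k = real_of_int (Legendre k (int p))"

locale odd_prime =
  fixes p :: nat
  assumes prime_p: "prime p" and p_gt_2: "p > 2"
begin

lemma p_pos: "p > 0" using p_gt_2 by simp

lemma prime_int: "prime (int p)" using prime_p by simp

lemma chi_cong: "[i = j] (mod int p) \<Longrightarrow> chi p i = chi p j"
  by (auto simp: chi_def Legendre_def QuadRes_def cong_def)

lemma periodic_chi: "periodic_mod p (chi p)"
  using chi_cong by (auto simp: periodic_mod_def)

lemma chi_zero_iff: "chi p k = 0 \<longleftrightarrow> int p dvd k"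
  by (auto simp: chi_def Legendre_def cong_0_iff)

lemma chi_values: "chi p k \<in> {-1, 0, 1}"
  by (auto simp: chi_def Legendre_def)

lemma abs_chi_le: "\<bar>chi p k\<bar> \<le> 1"
  using chi_values[of k] by auto

lemma chi_square: "chi p k * chi p k = of_bool (\<not> int p dvd k)"
  using chi_values[of k] chi_zero_iff[of k] by auto

text \<open>
By Euler's criterion the two sides are congruent modulo \<open>p\<close>, and \<open>p > 2\<close> separates the numbers -1, 0 and 1.
\<close>
lemma chi_mult: "chi p (a * b) = chi p a * chi p b"
proof -
  have e: "[Legendre k (int p) = k ^ ((p - 1) div 2)] (mod int p)" for k
    using euler_criterion[of p k] prime_p p_gt_2 by simp
  have "[Legendre (a * b) (int p) = a ^ ((p - 1) div 2) * b ^ ((p - 1) div 2)] (mod int p)"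
    using e[of "a*b"] by (simp add: power_mult_distrib)
  also have "[a ^ ((p - 1) div 2) * b ^ ((p - 1) div 2) = Legendre a (int p) * Legendre b (int p)] (mod int p)"
    using e[of a] e[of b] by (meson cong_mult cong_sym)
  finally have c: "int p dvd Legendre (a * b) (int p) - Legendre a (int p) * Legendre b (int p)"
    by (simp add: cong_iff_dvd_diff)
  have v: "Legendre k (int p) \<in> {-1, 0, 1}" for k by (auto simp: Legendre_def)
  have bnd: "\<bar>Legendre (a * b) (int p) - Legendre a (int p) * Legendre b (int p)\<bar> < int p"
    using v[of "a*b"] v[of a] v[of b] p_gt_2 by auto
  have "Legendre (a * b) (int p) - Legendre a (int p) * Legendre b (int p) = 0"
    using dvd_imp_le_int[OF _ c] bnd by fastforce
  hence "Legendre (a * b) (int p) = Legendre a (int p) * Legendre b (int p)" by simp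
  thus ?thesis by (simp add: chi_def)
qed

lemma chi_one: "chi p 1 = 1"
proof -
  have "chi p 1 = chi p 1 * chi p 1" using chi_mult[of 1 1] by simp
  thus ?thesis using chi_zero_iff[of 1] p_gt_2 by auto
qed

text \<open>
Otherwise all \<open>p - 1\<close> nonzero classes would be roots of \<open>x ^ ((p - 1) div 2) = 1\<close>.
\<close>
lemma exists_nonresidue: "\<exists>z. chi p z = -1"
proof (rule ccontr)
  assume no: "\<not> (\<exists>z. chi p z = -1)"
  let ?h = "(p - 1) div 2"
  have hpos: "?h > 0" using p_gt_2 by simp
  have "{1..<p} \<subseteq> {x\<in>{..<p}. [x ^ ?h = 1] (mod p)}"
  proof
    fix x assume x: "x \<in> {1..<p}"
    hence "\<not> int p dvd int x" by (auto simp: nat_dvd_not_less)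
    hence "chi p (int x) = 1" using no chi_values[of "int x"] chi_zero_iff[of "int x"] by auto
    hence "Legendre (int x) (int p) = 1" by (simp add: chi_def)
    moreover have "[Legendre (int x) (int p) = int x ^ ?h] (mod int p)"
      using euler_criterion[of p "int x"] prime_p p_gt_2 by simp
    ultimately have "[int (x ^ ?h) = int 1] (mod int p)" by (simp add: cong_sym_eq)
    hence "[x ^ ?h = 1] (mod p)" using cong_int_iff by blast
    thus "x \<in> {x\<in>{..<p}. [x ^ ?h = 1] (mod p)}" using x by auto
  qed
  hence "card {1..<p} \<le> card {x\<in>{..<p}. [x ^ ?h = 1] (mod p)}" by (intro card_mono) auto
  also have "\<dots> \<le> ?h" by (rule roots_mod_prime_bound[OF prime_p hpos])
  finally show False using p_gt_2 by simp
qed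

lemma sum_chi: "(\<Sum>k\<in>residues_below p. chi p k) = 0"
proof -
  obtain z where z: "chi p z = -1" using exists_nonresidue by blast
  hence "coprime z (int p)"
    using chi_zero_iff[of z] prime_int prime_imp_coprime coprime_commute by (metis zero_neq_neg_one)
  hence "(\<Sum>k\<in>residues_below p. chi p (z * k)) = (\<Sum>k\<in>residues_below p. chi p k)"
    by (intro sum_residues_mult p_pos periodic_chi)
  thus ?thesis by (simp add: chi_mult z sum_negf)
qed

lemma coprime_iff: "coprime c (int p) \<longleftrightarrow> \<not> int p dvd c"
  using prime_int prime_imp_coprime coprime_commute
  by (metis coprime_absorb_left not_prime_unit)

lemma sum_chi_affine:
  assumes "\<not> int p dvd c"
  shows "(\<Sum>k\<in>residues_below p. chi p (a + c * k)) = 0"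
proof -
  have "(\<Sum>k\<in>residues_below p. chi p (a + c * k)) = (\<Sum>k\<in>residues_below p. chi p k)"
    using assms coprime_iff[of c]
    by (intro sum_residues_reindex p_pos periodic_chi) (simp_all add: cong_add_lcancel cong_mult_lcancel)
  thus ?thesis by (simp add: sum_chi)
qed

lemma inverse_mod:
  assumes "\<not> int p dvd c"
  obtains d where "[c * d = 1] (mod int p)"
  using assms coprime_iff[of c] cong_solve_coprime_int by blast

text \<open>
Inversion permutes the nonzero residues. The function \<open>iv\<close> is an arbitrary choice of inverses on all integers
prime to \<open>p\<close>, so that it need not take values below \<open>p\<close>.
\<close>
lemma bij_inverse_mod:
  assumes per: "periodic_mod p f"
  shows "\<exists>iv. (\<forall>k. \<not> int p dvd k \<longrightarrow> [k * iv k = 1] (mod int p)) \<and>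
    (\<Sum>k\<in>{1..<int p}. f (iv k)) = (\<Sum>k\<in>{1..<int p}. (f k :: real))"
proof -
  define iv where "iv k = (SOME d. [k * d = 1] (mod int p))" for k
  have iv: "[k * iv k = 1] (mod int p)" if "\<not> int p dvd k" for k
    unfolding iv_def using inverse_mod[OF that] by (metis (mono_tags, lifting) someI_ex)
  have nd: "\<not> int p dvd k" if "k \<in> {1..<int p}" for k
    using that zdvd_not_zless by auto
  let ?g = "\<lambda>k. iv k mod int p"
  have inj_g: "inj_on ?g {1..<int p}"
  proof (rule inj_onI)
    fix i j assume ij: "i \<in> {1..<int p}" "j \<in> {1..<int p}" "?g i = ?g j"
    hence c: "[iv i = iv j] (mod int p)" by (simp add: cong_def)
    have "[i = i * (j * iv j)] (mod int p)"
      using cong_sym[OF cong_scalar_left[OF iv[OF nd[OF ij(2)]], of i]] by simp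
    also have "[i * (j * iv j) = i * (j * iv i)] (mod int p)"
      by (intro cong_scalar_left cong_sym[OF c])
    also have "i * (j * iv i) = j * (i * iv i)" by (simp add: mult_ac)
    also have "[j * (i * iv i) = j] (mod int p)"
      using cong_scalar_left[OF iv[OF nd[OF ij(1)]], of j] by simp
    finally show "i = j" using cong_less_imp_eq_int[of i "int p" j] ij by simp
  qed
  have sub: "?g ` {1..<int p} \<subseteq> {1..<int p}"
    proof safe
      fix k assume k: "k \<in> {1..<int p}"
      have "\<not> int p dvd iv k"
      proof
        assume "int p dvd iv k"
        hence "int p dvd k * iv k" by simp
        hence "int p dvd 1" using cong_dvd_iff[OF iv[OF nd[OF k]]] by simp
        thus False using p_gt_2 by simp
      qed
      hence "iv k mod int p \<noteq> 0" by (simp add: dvd_eq_mod_eq_0)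
      moreover have "iv k mod int p \<ge> 0" "iv k mod int p < int p" using p_pos by simp_all
      ultimately show "?g k \<in> {1..<int p}" by auto
    qed
  from endo_inj_surj[OF _ sub inj_g] have "?g ` {1..<int p} = {1..<int p}" by blast
  hence "bij_betw ?g {1..<int p} {1..<int p}"
    using inj_g by (simp add: bij_betw_def)
  hence "(\<Sum>k\<in>{1..<int p}. f (?g k)) = (\<Sum>k\<in>{1..<int p}. f k)"
    by (rule sum.reindex_bij_betw)
  hence "(\<Sum>k\<in>{1..<int p}. f (iv k)) = (\<Sum>k\<in>{1..<int p}. f k)"
    by (simp add: periodic_mod_mod[OF per])
  with iv show ?thesis by (intro exI[of _ iv]) simp
qed

end

section \<open>Quartic character sums\<close>

context odd_prime
begin

lemma chi_add_inverse:
  assumes "[k * k' = 1] (mod int p)"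
  shows "chi p (k + b) = chi p k * chi p (1 + b * k')"
proof -
  have "[k * (1 + b * k') = k + b * (k * k')] (mod int p)"
    by (simp add: algebra_simps)
  also have "[k + b * (k * k') = k + b] (mod int p)"
    using cong_scalar_left[OF assms, of b] by (simp add: cong_add_lcancel)
  finally show ?thesis using chi_cong chi_mult by metis
qed

lemma sum_residues_split0:
  "(\<Sum>k\<in>residues_below p. f k) = f 0 + (\<Sum>k\<in>{1..<int p}. (f k :: real))"
proof -
  have "residues_below p = insert 0 {1..<int p}" using p_gt_2 by auto
  thus ?thesis by simp
qed

lemma chi_prod_periodic:
  "periodic_mod p (\<lambda>m. chi p (a1 + b1 * m) * chi p (a2 + b2 * m) * chi p (a3 + b3 * m))"
  unfolding periodic_mod_def
proof safe
  fix i j assume c: "[i = j] (mod int p)"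
  have "chi p (a + b * i) = chi p (a + b * j)" for a b
    by (intro chi_cong cong_add cong_mult cong_refl c)
  thus "chi p (a1 + b1 * i) * chi p (a2 + b2 * i) * chi p (a3 + b3 * i) =
        chi p (a1 + b1 * j) * chi p (a2 + b2 * j) * chi p (a3 + b3 * j)" by presburger
qed

text \<open>
Take out the square of \<open>k\<close> and substitute the inverse of \<open>k\<close>. This leaves the sum of a linear form over the
nonzero residues, which is minus the term at the missing residue 0.
\<close>
lemma sum_chi2:
  assumes "\<not> [a = b] (mod int p)"
  shows "(\<Sum>k\<in>residues_below p. chi p (k + a) * chi p (k + b)) = -1"
proof -
  define c where "c = b - a"
  have c: "\<not> int p dvd c"
    using assms by (simp add: c_def cong_iff_dvd_diff dvd_diff_commute)
  have per: "periodic_mod p (\<lambda>k. chi p k * chi p (k + c))"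
    unfolding periodic_mod_def using chi_cong cong_add_rcancel by metis
  have "(\<Sum>k\<in>residues_below p. chi p (k + a) * chi p (k + b))
      = (\<Sum>k\<in>residues_below p. chi p (k + a) * chi p ((k + a) + c))" by (simp add: c_def)
  also have "\<dots> = (\<Sum>k\<in>residues_below p. chi p k * chi p (k + c))"
    using sum_residues_shift[OF p_pos per] by simp
  also have "\<dots> = (\<Sum>k\<in>{1..<int p}. chi p k * chi p (k + c))"
    using chi_zero_iff[of 0] by (simp add: sum_residues_split0)
  also have "\<dots> = -1"
  proof -
    obtain iv where iv: "\<And>k. \<not> int p dvd k \<Longrightarrow> [k * iv k = 1] (mod int p)"
      and re: "(\<Sum>k\<in>{1..<int p}. chi p (1 + c * iv k) * chi p (1 + 0 * iv k) * chi p (1 + 0 * iv k))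
        = (\<Sum>k\<in>{1..<int p}. chi p (1 + c * k) * chi p (1 + 0 * k) * chi p (1 + 0 * k))"
      using bij_inverse_mod[OF chi_prod_periodic[of 1 c 1 0 1 0]] by blast
    have "(\<Sum>k\<in>{1..<int p}. chi p k * chi p (k + c)) = (\<Sum>k\<in>{1..<int p}. chi p (1 + c * iv k))"
    proof (rule sum.cong)
      fix k assume k: "k \<in> {1..<int p}"
      hence nd: "\<not> int p dvd k" using zdvd_not_zless by auto
      show "chi p k * chi p (k + c) = chi p (1 + c * iv k)"
        using chi_add_inverse[OF iv[OF nd], of c] chi_square[of k] nd
        by (simp flip: mult.assoc)
    qed simp
    also have "\<dots> = (\<Sum>k\<in>{1..<int p}. chi p (1 + c * k))" using re by (simp add: chi_one)
    also have "\<dots> = -1"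
      using sum_chi_affine[OF c, of 1] sum_residues_split0[of "\<lambda>k. chi p (1 + c * k)"] by (simp add: chi_one)
    finally show ?thesis .
  qed
  finally show ?thesis .
qed

definition cubic :: "int \<times> int \<times> int \<times> int \<Rightarrow> int \<Rightarrow> int" where
  "cubic = (\<lambda>(c0, c1, c2, c3) x. c0 + c1 * x + c2 * x ^ 2 + c3 * x ^ 3)"

abbreviation tuples :: "(int \<times> int \<times> int \<times> int) set" where
  "tuples \<equiv> residues_below p \<times> residues_below p \<times> residues_below p \<times> residues_below p"

lemma sum_tuples_shift:
  fixes f :: "int \<Rightarrow> int \<Rightarrow> int \<Rightarrow> int \<Rightarrow> real"
  assumes "\<And>a b c d a' b' c' d'. [a = a'] (mod int p) \<Longrightarrow> [b = b'] (mod int p) \<Longrightarrow> [c = c'] (mod int p)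
    \<Longrightarrow> [d = d'] (mod int p) \<Longrightarrow> f a b c d = f a' b' c' d'"
  shows "(\<Sum>(a, b, c, d)\<in>tuples. f (a + s) (b + t) (c + u) (d + v)) = (\<Sum>(a, b, c, d)\<in>tuples. f a b c d)"
  unfolding sum4_tuples[symmetric] by (rule sum4_shift[OF p_pos]) (rule assms)

text \<open>
Adding multiples of \<open>(x - x2) * (x - x3) * (x - x4)\<close> permutes the cubics. It preserves the values at \<open>x2\<close>, \<open>x3\<close>
and \<open>x4\<close> and makes the value at \<open>x1\<close> run through all residues, where the character sums to 0.
\<close>
lemma cubic_chi_orthogonal:
  assumes "\<not> int p dvd x1 - x2" "\<not> int p dvd x1 - x3" "\<not> int p dvd x1 - x4"
  shows "(\<Sum>c\<in>tuples. chi p (cubic c x1) * chi p (cubic c x2) * chi p (cubic c x3) * chi p (cubic c x4)) = 0"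
    (is "?V = 0")
proof -
  define h where "h = (x1 - x2) * (x1 - x3) * (x1 - x4)"
  have h: "\<not> int p dvd h" using assms prime_int by (auto simp: h_def prime_dvd_mult_iff)
  define W where "W c = chi p (cubic c x1) * chi p (cubic c x2) * chi p (cubic c x3) * chi p (cubic c x4)" for c
  define W' where "W' c = chi p (cubic c x2) * chi p (cubic c x3) * chi p (cubic c x4)" for c
  have cong: "W (a, b, c, d) = W (a', b', c', d')"
    if "[a = a'] (mod int p)" "[b = b'] (mod int p)" "[c = c'] (mod int p)" "[d = d'] (mod int p)" for a b c d a' b' c' d'
  proof -
    have "chi p (cubic (a, b, c, d) x) = chi p (cubic (a', b', c', d') x)" for x
      unfolding cubic_def prod.case using that by (intro chi_cong cong_add cong_mult) auto
    thus ?thesis unfolding W_def by presburger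
  qed
  have s: "?V = (\<Sum>c\<in>tuples. chi p (cubic c x1 + h * s) * W' c)" for s
  proof -
    \<comment> \<open>the coefficients of \<open>s * (x - x2) * (x - x3) * (x - x4)\<close>\<close>
    let ?s = "- s * x2 * x3 * x4" and ?t = "s * (x2 * x3 + x2 * x4 + x3 * x4)" and ?u = "- s * (x2 + x3 + x4)"
    have ev: "cubic (a + ?s, b + ?t, c + ?u, d + s) x = cubic (a, b, c, d) x + (x - x2) * (x - x3) * (x - x4) * s" for a b c d x
      by (simp add: cubic_def power2_eq_square power3_eq_cube algebra_simps)
    have "?V = (\<Sum>(a, b, c, d)\<in>tuples. W (a, b, c, d))"
      by (simp add: W_def case_prod_unfold)
    also have "\<dots> = (\<Sum>(a, b, c, d)\<in>tuples. W (a + ?s, b + ?t, c + ?u, d + s))"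
      by (rule sum_tuples_shift[symmetric, where f = "\<lambda>a b c d. W (a, b, c, d)"]) (rule cong)
    also have "\<dots> = (\<Sum>(a, b, c, d)\<in>tuples. chi p (cubic (a, b, c, d) x1 + h * s) * W' (a, b, c, d))"
      unfolding W_def W'_def ev h_def by (simp add: mult_ac)
    finally show ?thesis by (simp add: case_prod_unfold)
  qed
  have "real p * ?V = (\<Sum>s\<in>residues_below p. ?V)" by simp
  also have "\<dots> = (\<Sum>s\<in>residues_below p. \<Sum>c\<in>tuples. chi p (cubic c x1 + h * s) * W' c)"
    by (rule sum.cong[OF refl]) (rule s)
  also have "\<dots> = (\<Sum>c\<in>tuples. \<Sum>s\<in>residues_below p. chi p (cubic c x1 + h * s) * W' c)"
    by (rule sum.swap)
  also have "\<dots> = (\<Sum>c\<in>tuples. (\<Sum>s\<in>residues_below p. chi p (cubic c x1 + h * s)) * W' c)"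
    by (simp only: sum_distrib_right)
  also have "\<dots> = 0" by (simp add: sum_chi_affine[OF h])
  finally show ?thesis using p_pos by simp
qed

text \<open>
In the expanded fourth power, a quadruple of arguments contributes only if none of them
differs from the other three, that is, if they agree in pairs. There are at most \<open>3 * p^2\<close> such quadruples.
\<close>
lemma cubic_fourth_moment:
  "(\<Sum>c\<in>tuples. (\<Sum>x\<in>residues_below p. chi p (cubic c x)) ^ 4) \<le> 3 * real p ^ 6"
proof -
  define V where "V = (\<lambda>(x1, x2, x3, x4). \<Sum>c\<in>tuples. chi p (cubic c x1) * chi p (cubic c x2) * chi p (cubic c x3) * chi p (cubic c x4))"
  let ?R = "residues_below p"
  define P where "P = (\<lambda>(a, b). (a, a, b, b)) ` (?R \<times> ?R) \<union> (\<lambda>(a, b). (a, b, a, b)) ` (?R \<times> ?R)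
     \<union> (\<lambda>(a, b). (a, b, b, a)) ` (?R \<times> ?R)"
  have cardP: "card P \<le> 3 * p ^ 2"
  proof -
    have c: "card (f ` (?R \<times> ?R)) \<le> p ^ 2" for f :: "int \<times> int \<Rightarrow> int \<times> int \<times> int \<times> int"
      using card_image_le[of "?R \<times> ?R" f] by (simp add: card_cartesian_product power2_eq_square)
    show ?thesis unfolding P_def
      by (rule order.trans[OF card_Un_le], rule order.trans[OF add_mono[OF card_Un_le c]])
         (use c[of "\<lambda>(a, b). (a, a, b, b)"] c[of "\<lambda>(a, b). (a, b, a, b)"] in linarith)
  qed
  have PsubT: "P \<subseteq> tuples" by (auto simp: P_def)
  have Vbound: "\<bar>V x\<bar> \<le> real p ^ 4" for x
  proof -
    obtain x1 x2 x3 x4 where x: "x = (x1, x2, x3, x4)" by (metis prod_cases4)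
    have "\<bar>V x\<bar> \<le> (\<Sum>c\<in>tuples. 1)"
      unfolding V_def x prod.case
      by (intro order.trans[OF sum_abs] sum_mono) (auto simp: abs_mult intro!: mult_le_one abs_chi_le)
    also have "\<dots> = real p ^ 4" by (simp add: card_cartesian_product power4_eq_xxxx)
    finally show ?thesis .
  qed
  have V0: "V x = 0" if "x \<in> tuples - P" for x
  proof -
    obtain x1 x2 x3 x4 where x: "x = (x1, x2, x3, x4)" by (metis prod_cases4)
    have mem: "x1 \<in> ?R" "x2 \<in> ?R" "x3 \<in> ?R" "x4 \<in> ?R" using that x by auto
    have nd: "\<not> int p dvd a - b" if "a \<in> ?R" "b \<in> ?R" "a \<noteq> b" for a b
      using cong_less_imp_eq_int[of a "int p" b] that by (auto simp: cong_iff_dvd_diff)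
    have np: "\<not> (x1 = x2 \<and> x3 = x4)" "\<not> (x1 = x3 \<and> x2 = x4)" "\<not> (x1 = x4 \<and> x2 = x3)"
      using that mem by (auto simp: x P_def)
    consider "x1 \<noteq> x2" "x1 \<noteq> x3" "x1 \<noteq> x4" | "x2 \<noteq> x1" "x2 \<noteq> x3" "x2 \<noteq> x4"
      | "x3 \<noteq> x1" "x3 \<noteq> x2" "x3 \<noteq> x4" | "x4 \<noteq> x1" "x4 \<noteq> x2" "x4 \<noteq> x3" using np by metis
    thus ?thesis
    proof cases
      case 1 thus ?thesis using cubic_chi_orthogonal[of x1 x2 x3 x4] nd mem by (simp add: V_def x)
    next
      case 2 thus ?thesis using cubic_chi_orthogonal[of x2 x1 x3 x4] nd mem by (simp add: V_def x mult_ac)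
    next
      case 3 thus ?thesis using cubic_chi_orthogonal[of x3 x1 x2 x4] nd mem by (simp add: V_def x mult_ac)
    next
      case 4 thus ?thesis using cubic_chi_orthogonal[of x4 x1 x2 x3] nd mem by (simp add: V_def x mult_ac)
    qed
  qed
  have "(\<Sum>c\<in>tuples. (\<Sum>x\<in>?R. chi p (cubic c x)) ^ 4) = (\<Sum>c\<in>tuples. \<Sum>(x1, x2, x3, x4)\<in>tuples.
      chi p (cubic c x1) * chi p (cubic c x2) * chi p (cubic c x3) * chi p (cubic c x4))"
    by (simp only: power4_eq_xxxx prod_sums4)
  also have "\<dots> = (\<Sum>x\<in>tuples. V x)"
    by (subst sum.swap) (simp add: V_def case_prod_unfold)
  also have "\<dots> = (\<Sum>x\<in>P. V x)"
    using PsubT V0 by (intro sum.mono_neutral_right) auto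
  also have "\<dots> \<le> (\<Sum>x\<in>P. real p ^ 4)"
    by (intro sum_mono) (use Vbound abs_le_D1 in blast)
  also have "\<dots> = real (card P) * real p ^ 4" by simp
  also have "\<dots> \<le> real (3 * p ^ 2) * real p ^ 4"
    using cardP by (intro mult_right_mono) (simp_all del: of_nat_mult)
  also have "\<dots> = 3 * real p ^ 6" by (simp flip: power_add)
  finally show ?thesis .
qed

text \<open>
The coefficients of \<open>c * (x - (r + s * b1)) * (x - (r + s * b2)) * (x - (r + s * b3))\<close>, reduced modulo \<open>p\<close> except for the
leading coefficient, which is taken from \<open>1..<p\<close> below.
\<close>
definition family_coeffs :: "int \<Rightarrow> int \<Rightarrow> int \<Rightarrow> int \<times> int \<times> int \<Rightarrow> int \<times> int \<times> int \<times> int" where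
  "family_coeffs b1 b2 b3 = (\<lambda>(r, s, c).
     ((- (c * ((r + s * b1) * (r + s * b2) * (r + s * b3)))) mod int p,
      (c * ((r + s * b1) * (r + s * b2) + (r + s * b1) * (r + s * b3) + (r + s * b2) * (r + s * b3))) mod int p,
      (- (c * ((r + s * b1) + (r + s * b2) + (r + s * b3)))) mod int p,
      c))"

lemma cubic_family_coeffs:
  "[cubic (family_coeffs b1 b2 b3 (r, s, c)) x
    = c * ((x - (r + s * b1)) * (x - (r + s * b2)) * (x - (r + s * b3)))] (mod int p)"
proof -
  have m: "[a mod int p = a] (mod int p)" for a by (simp add: cong_def)
  have "[cubic (family_coeffs b1 b2 b3 (r, s, c)) x
    = - (c * ((r + s * b1) * (r + s * b2) * (r + s * b3)))
      + (c * ((r + s * b1) * (r + s * b2) + (r + s * b1) * (r + s * b3) + (r + s * b2) * (r + s * b3))) * x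
      + (- (c * ((r + s * b1) + (r + s * b2) + (r + s * b3)))) * x ^ 2 + c * x ^ 3] (mod int p)"
    unfolding cubic_def family_coeffs_def prod.case by (intro cong_add cong_mult m cong_refl)
  also have "- (c * ((r + s * b1) * (r + s * b2) * (r + s * b3)))
      + (c * ((r + s * b1) * (r + s * b2) + (r + s * b1) * (r + s * b3) + (r + s * b2) * (r + s * b3))) * x
      + (- (c * ((r + s * b1) + (r + s * b2) + (r + s * b3)))) * x ^ 2 + c * x ^ 3
      = c * ((x - (r + s * b1)) * (x - (r + s * b2)) * (x - (r + s * b3)))"
    by (simp add: power2_eq_square power3_eq_cube algebra_simps)
  finally show ?thesis .
qed

text \<open>
The substitution \<open>x = r + s * m\<close> takes the factor \<open>c * s^3\<close> out of the cubic, and its character is a sign.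
\<close>
lemma sum_chi_cubic_family:
  assumes "\<not> int p dvd s" "\<not> int p dvd c"
  shows "(\<Sum>x\<in>residues_below p. chi p (cubic (family_coeffs b1 b2 b3 (r, s, c)) x)) ^ 4
    = (\<Sum>m\<in>residues_below p. chi p (m - b1) * chi p (m - b2) * chi p (m - b3)) ^ 4"
proof -
  define g where "g = (\<lambda>x. chi p (cubic (family_coeffs b1 b2 b3 (r, s, c)) x))"
  have per: "periodic_mod p g"
    unfolding periodic_mod_def g_def
  proof (intro allI impI chi_cong)
    fix i j assume "[i = j] (mod int p)"
    thus "[cubic (family_coeffs b1 b2 b3 (r, s, c)) i = cubic (family_coeffs b1 b2 b3 (r, s, c)) j] (mod int p)"
      unfolding cubic_def case_prod_unfold by (intro cong_add cong_mult cong_pow cong_refl)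
  qed
  have "(\<Sum>x\<in>residues_below p. g x) = (\<Sum>m\<in>residues_below p. g (r + s * m))"
    using assms coprime_iff[of s]
    by (intro sum_residues_reindex[symmetric] p_pos per)
       (simp_all add: cong_add_lcancel cong_mult_lcancel)
  also have "\<dots> = (\<Sum>m\<in>residues_below p. chi p c * chi p s ^ 3 * (chi p (m - b1) * chi p (m - b2) * chi p (m - b3)))"
  proof (rule sum.cong[OF refl])
    fix m
    have "g (r + s * m) = chi p (c * ((r + s * m - (r + s * b1)) * (r + s * m - (r + s * b2)) * (r + s * m - (r + s * b3))))"
      unfolding g_def by (rule chi_cong) (rule cubic_family_coeffs)
    also have "c * ((r + s * m - (r + s * b1)) * (r + s * m - (r + s * b2)) * (r + s * m - (r + s * b3)))
      = c * (s * (m - b1) * (s * (m - b2)) * (s * (m - b3)))" by (simp add: algebra_simps)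
    also have "chi p \<dots> = chi p c * chi p s ^ 3 * (chi p (m - b1) * chi p (m - b2) * chi p (m - b3))"
      by (simp add: chi_mult power3_eq_cube)
    finally show "g (r + s * m) = \<dots>" .
  qed
  also have "\<dots> = chi p c * chi p s ^ 3 * (\<Sum>m\<in>residues_below p. chi p (m - b1) * chi p (m - b2) * chi p (m - b3))"
    by (simp add: sum_distrib_left)
  finally have "(\<Sum>x\<in>residues_below p. g x) ^ 4
     = (chi p c) ^ 4 * (chi p s ^ 3) ^ 4 * (\<Sum>m\<in>residues_below p. chi p (m - b1) * chi p (m - b2) * chi p (m - b3)) ^ 4"
    by (simp add: power_mult_distrib)
  moreover have "chi p c ^ 4 = 1" "(chi p s ^ 3) ^ 4 = 1"
    using chi_values[of c] chi_values[of s] chi_zero_iff[of c] chi_zero_iff[of s] assms by auto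
  ultimately show ?thesis by (simp add: g_def)
qed

text \<open>
The roots \<open>r + s * b1\<close> and \<open>r + s * b2\<close> determine \<open>r\<close> and \<open>s\<close>, and \<open>c\<close> is the leading coefficient. Either root
is one of the three roots of a fixed member of the fibre, which leaves \<open>3 * 3\<close> choices.
\<close>
lemma card_family_fibre:
  assumes "\<not> int p dvd b1 - b2"
  shows "card {g \<in> residues_below p \<times> {1..<int p} \<times> {1..<int p}. family_coeffs b1 b2 b3 g = c} \<le> 9"
    (is "card ?F \<le> 9")
proof (cases "?F = {}")
  case True thus ?thesis by (metis card.empty le0)
next
  case False
  have nd: "\<not> int p dvd k" if "k \<in> {1..<int p}" for k
    using that zdvd_not_zless by auto
  obtain r0 s0 c0 where g0: "(r0, s0, c0) \<in> ?F" using False by auto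
  define A where "A = {(r0 + s0 * b1) mod int p, (r0 + s0 * b2) mod int p, (r0 + s0 * b3) mod int p}"
  define h where "h = (\<lambda>(r, s, c :: int). ((r + s * b1) mod int p, (r + s * b2) mod int p))"
  have root: "x mod int p \<in> A"
    if g: "(r, s, d) \<in> ?F" and x: "x = r + s * b1 \<or> x = r + s * b2" for r s d x
  proof -
    have eq: "family_coeffs b1 b2 b3 (r, s, d) = family_coeffs b1 b2 b3 (r0, s0, c0)" using g g0 by simp
    have "[0 = d * ((x - (r + s * b1)) * (x - (r + s * b2)) * (x - (r + s * b3)))] (mod int p)"
      using x by auto
    also have "[d * ((x - (r + s * b1)) * (x - (r + s * b2)) * (x - (r + s * b3)))
       = cubic (family_coeffs b1 b2 b3 (r, s, d)) x] (mod int p)"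
      by (rule cong_sym) (rule cubic_family_coeffs)
    also have "[cubic (family_coeffs b1 b2 b3 (r, s, d)) x
       = c0 * ((x - (r0 + s0 * b1)) * (x - (r0 + s0 * b2)) * (x - (r0 + s0 * b3)))] (mod int p)"
      unfolding eq by (rule cubic_family_coeffs)
    finally have "int p dvd c0 * ((x - (r0 + s0 * b1)) * (x - (r0 + s0 * b2)) * (x - (r0 + s0 * b3)))"
      by (simp only: cong_0_iff cong_sym_eq[of 0])
    moreover have "\<not> int p dvd c0" using nd g0 by auto
    ultimately have "int p dvd x - (r0 + s0 * b1) \<or> int p dvd x - (r0 + s0 * b2) \<or> int p dvd x - (r0 + s0 * b3)"
      using prime_int by (simp add: prime_dvd_mult_iff)
    thus ?thesis unfolding A_def by (auto simp: mod_eq_dvd_iff)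
  qed
  have "h ` ?F \<subseteq> A \<times> A"
    using root by (auto simp: h_def)
  moreover have "inj_on h ?F"
  proof (rule inj_onI)
    fix g g' assume g: "g \<in> ?F" "g' \<in> ?F" "h g = h g'"
    obtain r s d where gg: "g = (r, s, d)" by (metis prod_cases3)
    obtain r' s' d' where gg': "g' = (r', s', d')" by (metis prod_cases3)
    have "d = d'" using g by (auto simp: gg gg' family_coeffs_def)
    have c1: "[r + s * b1 = r' + s' * b1] (mod int p)" and c2: "[r + s * b2 = r' + s' * b2] (mod int p)"
      using g(3) by (auto simp: gg gg' h_def cong_def)
    have "[(r + s * b1) - (r + s * b2) = (r' + s' * b1) - (r' + s' * b2)] (mod int p)"
      by (rule cong_diff[OF c1 c2])
    hence "[s * (b1 - b2) = s' * (b1 - b2)] (mod int p)" by (simp add: algebra_simps)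
    hence "[s = s'] (mod int p)" using assms coprime_iff by (simp add: cong_mult_rcancel)
    hence s: "s = s'" using cong_less_imp_eq_int[of s "int p" s'] g by (auto simp: gg gg')
    with c1 have "[r = r'] (mod int p)" by (simp add: cong_add_rcancel)
    hence "r = r'" using cong_less_imp_eq_int[of r "int p" r'] g by (auto simp: gg gg')
    with s \<open>d = d'\<close> show "g = g'" by (simp add: gg gg')
  qed
  moreover have finA: "finite A" by (simp add: A_def)
  ultimately have "card ?F \<le> card (A \<times> A)" by (intro card_inj_on_le) auto
  also have "\<dots> = card A * card A" by (rule card_cartesian_product)
  also have "\<dots> \<le> 3 * 3"
    by (intro mult_le_mono) (auto simp: A_def card_insert_if)
  finally show ?thesis by simp
qed

text \<open>
Let \<open>T\<close> be the sum. All \<open>p * (p - 1)^2\<close> members of the family share the value \<open>T^4\<close>, and each cubic occurs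
at most 9 times, so that \<open>p * (p - 1)^2 * T^4 \<le> 9 * (3 * p^6)\<close>. Finally \<open>(p / (p - 1))^2 \<le> 9 / 4\<close>.
\<close>
lemma cubic_sum_fourth_power:
  assumes "\<not> int p dvd b1 - b2"
  shows "(\<Sum>m\<in>residues_below p. chi p (m - b1) * chi p (m - b2) * chi p (m - b3)) ^ 4 \<le> 81 * real p ^ 3"
    (is "?T ^ 4 \<le> _")
proof -
  let ?G = "residues_below p \<times> {1..<int p} \<times> {1..<int p}"
  define F where "F c = (\<Sum>x\<in>residues_below p. chi p (cubic c x)) ^ 4" for c
  have F0: "F c \<ge> 0" for c by (simp add: F_def)
  have nd: "\<not> int p dvd k" if "k \<in> {1..<int p}" for k
    using that zdvd_not_zless by auto
  have sub: "family_coeffs b1 b2 b3 ` ?G \<subseteq> tuples"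
    using p_pos by (auto simp: family_coeffs_def)
  have "real p * (real p - 1) ^ 2 * ?T ^ 4 = (\<Sum>g\<in>?G. ?T ^ 4)"
    using p_pos by (simp add: card_cartesian_product power2_eq_square of_nat_diff)
  also have "\<dots> = (\<Sum>g\<in>?G. F (family_coeffs b1 b2 b3 g))"
  proof (rule sum.cong[OF refl])
    fix g assume g: "g \<in> ?G"
    obtain r s d where gg: "g = (r, s, d)" by (metis prod_cases3)
    show "?T ^ 4 = F (family_coeffs b1 b2 b3 g)"
      unfolding gg F_def by (rule sum_chi_cubic_family[symmetric]) (use g nd in \<open>auto simp: gg\<close>)
  qed
  also have "\<dots> = (\<Sum>c\<in>tuples. \<Sum>g\<in>{g \<in> ?G. family_coeffs b1 b2 b3 g = c}. F (family_coeffs b1 b2 b3 g))"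
    by (rule sum.group[symmetric]) (use sub in auto)
  also have "\<dots> = (\<Sum>c\<in>tuples. real (card {g \<in> ?G. family_coeffs b1 b2 b3 g = c}) * F c)"
    by (intro sum.cong refl) simp
  also have "\<dots> \<le> (\<Sum>c\<in>tuples. 9 * F c)"
    using card_family_fibre[OF assms, of b3] F0
    by (intro sum_mono mult_right_mono) (simp_all del: mem_Sigma_iff)
  also have "\<dots> = 9 * (\<Sum>c\<in>tuples. F c)" by (simp add: sum_distrib_left)
  also have "\<dots> \<le> 9 * (3 * real p ^ 6)"
    using cubic_fourth_moment unfolding F_def by simp
  finally have le: "real p * (real p - 1) ^ 2 * ?T ^ 4 \<le> 27 * real p ^ 6" by simp
  have "3 * (real p - 1) \<ge> 2 * real p" using p_gt_2 by simp
  hence "(2 * real p) ^ 2 \<le> (3 * (real p - 1)) ^ 2" by (intro power_mono) auto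
  hence "4 * real p ^ 2 \<le> 9 * (real p - 1) ^ 2"
    by (simp only: power_mult_distrib) simp
  hence "(4 * real p ^ 2) * (real p * ?T ^ 4) \<le> (9 * (real p - 1) ^ 2) * (real p * ?T ^ 4)"
    by (intro mult_right_mono) auto
  also have "\<dots> \<le> 9 * (27 * real p ^ 6)" using le by (simp add: mult_ac)
  finally have "real p ^ 3 * (4 * ?T ^ 4) \<le> real p ^ 3 * (243 * real p ^ 3)"
    by (simp add: power2_eq_square power3_eq_cube power_numeral_reduce mult_ac)
  hence "4 * ?T ^ 4 \<le> 243 * real p ^ 3" using p_pos by (subst (asm) mult_le_cancel_left_pos) auto
  thus ?thesis using zero_le_power[of "real p" 3] by linarith
qed

lemma cubic_sum_bound:
  assumes "\<not> int p dvd b1 - b2"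
  shows "\<bar>\<Sum>m\<in>residues_below p. chi p (m - b1) * chi p (m - b2) * chi p (m - b3)\<bar> \<le> 3 * real p powr (3/4)"
proof -
  let ?T = "\<Sum>m\<in>residues_below p. chi p (m - b1) * chi p (m - b2) * chi p (m - b3)"
  have "(3 * real p powr (3/4)) ^ 4 = 81 * (real p powr (3/4)) ^ 4" by (simp add: power_mult_distrib)
  also have "(real p powr (3/4)) ^ 4 = real p powr (real 4 * (3/4))"
    using powr_power[of "real p" "3/4" 4] p_pos by simp
  also have "\<dots> = real p ^ 3" using p_pos by simp
  finally have "\<bar>?T\<bar> ^ 4 \<le> (3 * real p powr (3/4)) ^ 4"
    using cubic_sum_fourth_power[OF assms] by simp
  thus ?thesis by (subst (asm) power_mono_iff) auto
qed

text \<open>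
Translate \<open>a\<close> to 0 and substitute the inverse of \<open>k\<close>. Since \<open>k^4\<close> is a square, the quartic turns into a
product of three linear forms with constant term 1, which are proportional to \<open>m - \<beta>\<close> for three residues \<open>\<beta>\<close>.
\<close>
lemma quartic_sum_bound:
  assumes ab: "\<not> [a = b] (mod int p)" and ac: "\<not> [a = c] (mod int p)" and ad: "\<not> [a = d] (mod int p)"
    and bc: "\<not> [b = c] (mod int p)"
  shows "\<bar>\<Sum>k\<in>residues_below p. chi p (k + a) * chi p (k + b) * chi p (k + c) * chi p (k + d)\<bar>
    \<le> 4 * real p powr (3/4)"
proof -
  define b' c' d' where "b' = b - a" and "c' = c - a" and "d' = d - a"
  have nd: "\<not> int p dvd b'" "\<not> int p dvd c'" "\<not> int p dvd d'" "\<not> int p dvd b' - c'"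
    using ab ac ad bc by (simp_all add: b'_def c'_def d'_def cong_iff_dvd_diff dvd_diff_commute)
  define f where "f k = chi p k * chi p (k + b') * chi p (k + c') * chi p (k + d')" for k
  have perf: "periodic_mod p f"
    unfolding periodic_mod_def f_def
  proof (intro allI impI)
    fix i j assume c: "[i = j] (mod int p)"
    have "chi p (i + t) = chi p (j + t)" for t by (intro chi_cong cong_add c cong_refl)
    from this[of 0] this[of b'] this[of c'] this[of d']
    show "chi p i * chi p (i + b') * chi p (i + c') * chi p (i + d') =
       chi p j * chi p (j + b') * chi p (j + c') * chi p (j + d')" by simp
  qed
  let ?g = "\<lambda>m. chi p (1 + b' * m) * chi p (1 + c' * m) * chi p (1 + d' * m)"
  have "(\<Sum>k\<in>residues_below p. chi p (k + a) * chi p (k + b) * chi p (k + c) * chi p (k + d))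
     = (\<Sum>k\<in>residues_below p. f (k + a))" by (simp add: f_def b'_def c'_def d'_def)
  also have "\<dots> = (\<Sum>k\<in>residues_below p. f k)" by (rule sum_residues_shift[OF p_pos perf])
  also have "\<dots> = (\<Sum>k\<in>{1..<int p}. f k)"
    using chi_zero_iff[of 0] by (simp add: sum_residues_split0 f_def)
  also have "\<dots> = (\<Sum>m\<in>{1..<int p}. ?g m)"
  proof -
    obtain iv where iv: "\<And>k. \<not> int p dvd k \<Longrightarrow> [k * iv k = 1] (mod int p)"
      and re: "(\<Sum>k\<in>{1..<int p}. ?g (iv k)) = (\<Sum>k\<in>{1..<int p}. ?g k)"
      using bij_inverse_mod[OF chi_prod_periodic[of 1 b' 1 c' 1 d']] by blast
    have "f k = ?g (iv k)" if k: "k \<in> {1..<int p}" for k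
    proof -
      have ndk: "\<not> int p dvd k" using k zdvd_not_zless by auto
      have "f k = (chi p k * chi p k) * (chi p k * chi p k) * ?g (iv k)"
        unfolding f_def chi_add_inverse[OF iv[OF ndk]] by (simp only: mult_ac)
      thus ?thesis using chi_square[of k] ndk by simp
    qed
    thus ?thesis using re by simp
  qed
  also have "\<dots> = (\<Sum>m\<in>residues_below p. ?g m) - 1"
    by (simp add: sum_residues_split0 chi_one)
  finally have eq: "(\<Sum>k\<in>residues_below p. chi p (k + a) * chi p (k + b) * chi p (k + c) * chi p (k + d))
     = (\<Sum>m\<in>residues_below p. ?g m) - 1" .
  obtain \<beta> \<gamma> \<delta> where iv: "[b' * \<beta> = 1] (mod int p)" "[c' * \<gamma> = 1] (mod int p)" "[d' * \<delta> = 1] (mod int p)"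
    using inverse_mod nd by metis
  have lin: "chi p (1 + t * m) = chi p t * chi p (m - (- \<tau>))" if "[t * \<tau> = 1] (mod int p)" for t \<tau> m
  proof -
    have "[1 + t * m = t * \<tau> + t * m] (mod int p)"
      by (intro cong_add cong_refl cong_sym[OF that])
    hence "chi p (1 + t * m) = chi p (t * \<tau> + t * m)" by (rule chi_cong)
    also have "t * \<tau> + t * m = t * (m - (- \<tau>))" by (simp add: algebra_simps)
    finally show ?thesis by (simp only: chi_mult)
  qed
  have dist: "\<not> int p dvd - \<beta> - (- \<gamma>)"
  proof
    assume "int p dvd - \<beta> - (- \<gamma>)"
    hence bg: "[\<gamma> = \<beta>] (mod int p)" by (simp add: cong_iff_dvd_diff)
    have "[b' = b' * (c' * \<gamma>)] (mod int p)"
      using cong_sym[OF cong_scalar_left[OF iv(2), of b']] by simp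
    also have "[b' * (c' * \<gamma>) = b' * (c' * \<beta>)] (mod int p)" by (intro cong_scalar_left bg)
    also have "b' * (c' * \<beta>) = c' * (b' * \<beta>)" by simp
    also have "[c' * (b' * \<beta>) = c'] (mod int p)" using cong_scalar_left[OF iv(1), of c'] by simp
    finally show False using nd by (simp add: cong_iff_dvd_diff)
  qed
  have "(\<Sum>m\<in>residues_below p. ?g m) = chi p b' * chi p c' * chi p d' *
     (\<Sum>m\<in>residues_below p. chi p (m - (- \<beta>)) * chi p (m - (- \<gamma>)) * chi p (m - (- \<delta>)))"
    unfolding lin[OF iv(1)] lin[OF iv(2)] lin[OF iv(3)] sum_distrib_left
    by (intro sum.cong refl) (simp only: mult_ac)
  hence "\<bar>\<Sum>m\<in>residues_below p. ?g m\<bar> \<le> 1 * (3 * real p powr (3/4))"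
    unfolding abs_mult
    using cubic_sum_bound[OF dist, of "- \<delta>"] by (simp only: abs_mult, intro mult_mono mult_le_one abs_chi_le) auto
  moreover have "1 \<le> real p powr (3/4)" using p_pos by (intro ge_one_powr_ge_zero) auto
  ultimately show ?thesis unfolding eq by linarith
qed

end

section \<open>Local averages of products of four Fourier coefficients\<close>

text \<open>
The three ways to pair up four frequencies are instances of this relation with permuted arguments.
\<close>
definition paired :: "nat \<Rightarrow> int \<Rightarrow> int \<Rightarrow> int \<Rightarrow> int \<Rightarrow> bool" where
  "paired D a b c d \<longleftrightarrow> [a = b] (mod int D) \<and> [c = d] (mod int D)"

text \<open>
For a prime \<open>p\<close> that is 1 modulo 4 these are the Fourier coefficients, divided by \<open>sqrt p\<close>, of the sequence
\<open>chi p j + of_bool (int p dvd j)\<close>. The sign \<open>\<epsilon>\<close> is that of a Gauss sum.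
\<close>
definition local_dft :: "nat \<Rightarrow> real \<Rightarrow> int \<Rightarrow> real" where
  "local_dft p \<epsilon> k = \<epsilon> * chi p k + 1 / sqrt (real p)"

definition local_quartic :: "nat \<Rightarrow> real \<Rightarrow> int \<Rightarrow> int \<Rightarrow> int \<Rightarrow> int \<Rightarrow> real" where
  "local_quartic p \<epsilon> a b c d = (\<Sum>k\<in>residues_below p.
     local_dft p \<epsilon> (k + a) * local_dft p \<epsilon> (k + b) * local_dft p \<epsilon> (k + c) * local_dft p \<epsilon> (k + d)) / real p"

lemma perturbed_product_bound:
  fixes t :: real
  assumes "\<bar>a\<bar> \<le> 1" "\<bar>b\<bar> \<le> 1" "\<bar>c\<bar> \<le> 1" "\<bar>d\<bar> \<le> 1" "0 \<le> t" "t \<le> 1"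
  shows "\<bar>(a + t) * (b + t) * (c + t) * (d + t) - a * b * c * d\<bar> \<le> 15 * t"
proof -
  have tt: "t * t \<le> t" using assms mult_left_le[of t t] by simp
  have two: "\<bar>(x + t) * (y + t) - x * y\<bar> \<le> 3 * t" if "\<bar>x\<bar> \<le> 1" "\<bar>y\<bar> \<le> 1" for x y
  proof -
    have "(x + t) * (y + t) - x * y = x * t + y * t + t * t" by (simp add: algebra_simps)
    also have "\<bar>\<dots>\<bar> \<le> \<bar>x * t\<bar> + \<bar>y * t\<bar> + \<bar>t * t\<bar>" by linarith
    also have "\<dots> \<le> t + t + t"
      using that assms tt by (intro add_mono) (auto simp: abs_mult mult_left_le_one_le)
    finally show ?thesis by simp
  qed
  define u v where "u = (a + t) * (b + t) - a * b" and "v = (c + t) * (d + t) - c * d"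
  have u: "\<bar>u\<bar> \<le> 3 * t" and v: "\<bar>v\<bar> \<le> 3 * t" using two assms by (auto simp: u_def v_def)
  have "(a + t) * (b + t) * (c + t) * (d + t) - a * b * c * d = a * b * v + u * (c * d) + u * v"
    by (simp add: u_def v_def algebra_simps)
  also have "\<bar>\<dots>\<bar> \<le> \<bar>a * b\<bar> * \<bar>v\<bar> + \<bar>u\<bar> * \<bar>c * d\<bar> + \<bar>u\<bar> * \<bar>v\<bar>" unfolding abs_mult[symmetric] by linarith
  also have "\<dots> \<le> 1 * (3 * t) + (3 * t) * 1 + (3 * t) * (3 * 1)"
    using u v assms
    by (intro add_mono mult_mono) (auto simp: abs_mult intro!: mult_le_one)
  finally show ?thesis by simp
qed

context odd_prime
begin

lemma sum_residues_dvd_shift: "(\<Sum>k\<in>residues_below p. of_bool (int p dvd k + a)) = (1 :: real)"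
proof -
  have per: "periodic_mod p (\<lambda>k. of_bool (int p dvd k) :: real)"
    unfolding periodic_mod_def using cong_dvd_iff[of _ _ "int p"] by auto
  have "(\<Sum>k\<in>residues_below p. of_bool (int p dvd k + a) :: real) = (\<Sum>k\<in>residues_below p. of_bool (int p dvd k))"
    by (rule sum_residues_shift[OF p_pos per])
  also have "\<dots> = (\<Sum>k\<in>residues_below p. if k = 0 then 1 else 0)"
    by (intro sum.cong refl) (auto dest: zdvd_imp_le)
  also have "\<dots> = 1" using p_pos by simp
  finally show ?thesis .
qed

text \<open>
Either two of the other three residues differ, and the bound for quartic sums applies, or they all agree, and
the cube of the character reduces the sum to a quadratic one.
\<close>
lemma quartic_sum_singleton:
  assumes ab: "\<not> [a = b] (mod int p)" and ac: "\<not> [a = c] (mod int p)" and ad: "\<not> [a = d] (mod int p)"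
  shows "\<bar>\<Sum>k\<in>residues_below p. chi p (k + a) * chi p (k + b) * chi p (k + c) * chi p (k + d)\<bar>
    \<le> 4 * real p powr (3/4)"
proof (cases "[b = c] (mod int p)")
  case False
  thus ?thesis using quartic_sum_bound[OF ab ac ad] by simp
next
  case bc: True
  show ?thesis
  proof (cases "[c = d] (mod int p)")
    case False
    thus ?thesis using quartic_sum_bound[OF ac ad ab] by (simp add: mult_ac)
  next
    case cd: True
    have "chi p (k + a) * chi p (k + b) * chi p (k + c) * chi p (k + d) = chi p (k + a) * chi p (k + b)" for k
    proof -
      have "[k + b = k + c] (mod int p)" "[k + c = k + d] (mod int p)"
        using bc cd by (simp_all add: cong_add_lcancel)
      hence "chi p (k + c) = chi p (k + b)" "chi p (k + d) = chi p (k + b)"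
        using chi_cong by metis+
      thus ?thesis using chi_values[of "k + b"] by auto
    qed
    hence "(\<Sum>k\<in>residues_below p. chi p (k + a) * chi p (k + b) * chi p (k + c) * chi p (k + d)) = -1"
      by (simp only: sum_chi2[OF ab])
    moreover have "1 \<le> real p powr (3/4)" using p_pos by (intro ge_one_powr_ge_zero) auto
    ultimately show ?thesis by linarith
  qed
qed

text \<open>
Four residues that do not agree in pairs contain one that differs from the other three.
\<close>
lemma quartic_sum_unpaired:
  assumes "\<not> paired p a c b d" "\<not> paired p a d b c" "\<not> paired p a b c d"
  shows "\<bar>\<Sum>k\<in>residues_below p. chi p (k + a) * chi p (k + b) * chi p (k + c) * chi p (k + d)\<bar>
    \<le> 4 * real p powr (3/4)"
proof -
  \<comment> \<open>Residues turn congruences into equations.\<close>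
  define r where "r x = x mod int p" for x
  have r: "[x = y] (mod int p) \<longleftrightarrow> r x = r y" for x y by (simp add: cong_def r_def)
  have "(r a \<noteq> r b \<and> r a \<noteq> r c \<and> r a \<noteq> r d) \<or> (r b \<noteq> r a \<and> r b \<noteq> r c \<and> r b \<noteq> r d)
      \<or> (r c \<noteq> r a \<and> r c \<noteq> r b \<and> r c \<noteq> r d) \<or> (r d \<noteq> r a \<and> r d \<noteq> r b \<and> r d \<noteq> r c)"
    using assms unfolding paired_def r by metis
  thus ?thesis
  proof (elim disjE conjE)
    assume "r a \<noteq> r b" "r a \<noteq> r c" "r a \<noteq> r d"
    thus ?thesis using quartic_sum_singleton[of a b c d] by (simp add: r)
  next
    assume "r b \<noteq> r a" "r b \<noteq> r c" "r b \<noteq> r d"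
    thus ?thesis using quartic_sum_singleton[of b a c d] by (simp add: r mult_ac)
  next
    assume "r c \<noteq> r a" "r c \<noteq> r b" "r c \<noteq> r d"
    thus ?thesis using quartic_sum_singleton[of c a b d] by (simp add: r mult_ac)
  next
    assume "r d \<noteq> r a" "r d \<noteq> r b" "r d \<noteq> r c"
    thus ?thesis using quartic_sum_singleton[of d a b c] by (simp add: r mult_ac)
  qed
qed

lemma quartic_sum_squares:
  "\<bar>(\<Sum>k\<in>residues_below p. (chi p (k + a) * chi p (k + b)) ^ 2) - real p\<bar> \<le> 2"
proof -
  have sq: "(chi p (k + a) * chi p (k + b)) ^ 2 = of_bool (\<not> int p dvd k + a) * of_bool (\<not> int p dvd k + b)" for k
    using chi_square[of "k + a"] chi_square[of "k + b"] by (simp add: power2_eq_square mult_ac)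
  have "(\<Sum>k\<in>residues_below p. (chi p (k + a) * chi p (k + b)) ^ 2) \<le> (\<Sum>k\<in>residues_below p. 1)"
    unfolding sq by (intro sum_mono) auto
  moreover have "(\<Sum>k\<in>residues_below p. (chi p (k + a) * chi p (k + b)) ^ 2)
     \<ge> (\<Sum>k\<in>residues_below p. 1 - of_bool (int p dvd k + a) - of_bool (int p dvd k + b))"
    unfolding sq by (intro sum_mono) auto
  ultimately show ?thesis by (simp add: sum_subtractf sum_residues_dvd_shift)
qed

text \<open>
The summand \<open>1 / sqrt p\<close> of each coefficient changes a product of four numbers in the unit interval by at most
\<open>15 / sqrt p\<close>, and \<open>\<epsilon>\<close> cancels in a product of four.
\<close>
lemma local_quartic_approx:
  assumes "\<epsilon> \<in> {-1, 1}"
  shows "\<bar>local_quartic p \<epsilon> a b c d -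
    (\<Sum>k\<in>residues_below p. chi p (k + a) * chi p (k + b) * chi p (k + c) * chi p (k + d)) / real p\<bar> \<le> 15 / sqrt (real p)"
proof -
  let ?t = "1 / sqrt (real p)"
  have "\<bar>(\<Sum>k\<in>residues_below p.
     local_dft p \<epsilon> (k + a) * local_dft p \<epsilon> (k + b) * local_dft p \<epsilon> (k + c) * local_dft p \<epsilon> (k + d)) -
    (\<Sum>k\<in>residues_below p. chi p (k + a) * chi p (k + b) * chi p (k + c) * chi p (k + d))\<bar>
    \<le> (\<Sum>k\<in>residues_below p. 15 * ?t)"
    unfolding sum_subtractf[symmetric]
  proof (rule order.trans[OF sum_abs], rule sum_mono)
    fix k
    have e: "\<bar>\<epsilon> * chi p x\<bar> \<le> 1" for x using assms abs_chi_le[of x] by (auto simp: abs_mult)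
    have "\<bar>(\<epsilon> * chi p (k + a) + ?t) * (\<epsilon> * chi p (k + b) + ?t) * (\<epsilon> * chi p (k + c) + ?t) * (\<epsilon> * chi p (k + d) + ?t)
      - (\<epsilon> * chi p (k + a)) * (\<epsilon> * chi p (k + b)) * (\<epsilon> * chi p (k + c)) * (\<epsilon> * chi p (k + d))\<bar> \<le> 15 * ?t"
      by (intro perturbed_product_bound e) (use p_pos in auto)
    moreover have "(\<epsilon> * chi p (k + a)) * (\<epsilon> * chi p (k + b)) * (\<epsilon> * chi p (k + c)) * (\<epsilon> * chi p (k + d))
       = chi p (k + a) * chi p (k + b) * chi p (k + c) * chi p (k + d)" using assms by auto
    ultimately show "\<bar>local_dft p \<epsilon> (k + a) * local_dft p \<epsilon> (k + b) * local_dft p \<epsilon> (k + c) * local_dft p \<epsilon> (k + d)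
       - chi p (k + a) * chi p (k + b) * chi p (k + c) * chi p (k + d)\<bar> \<le> 15 * ?t"
      by (simp only: local_dft_def)
  qed
  also have "\<dots> = real p * (15 * ?t)" by simp
  finally show ?thesis
    using p_pos unfolding local_quartic_def diff_divide_distrib[symmetric] abs_divide by (simp add: divide_simps mult_ac)
qed

lemma local_quartic_paired:
  assumes "\<epsilon> \<in> {-1, 1}" "paired p a c b d \<or> paired p a d b c \<or> paired p a b c d"
  shows "\<bar>local_quartic p \<epsilon> a b c d - 1\<bar> \<le> 17 / sqrt (real p)"
proof -
  let ?X = "\<Sum>k\<in>residues_below p. chi p (k + a) * chi p (k + b) * chi p (k + c) * chi p (k + d)"
  have e: "chi p (k + x) = chi p (k + y)" if "[x = y] (mod int p)" for x y k
    using that by (intro chi_cong cong_add cong_refl)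
  have "\<exists>x y. ?X = (\<Sum>k\<in>residues_below p. (chi p (k + x) * chi p (k + y)) ^ 2)"
    using assms(2) unfolding paired_def
  proof (elim disjE conjE)
    assume "[a = c] (mod int p)" "[b = d] (mod int p)"
    thus ?thesis using e by (intro exI[of _ c] exI[of _ d] sum.cong refl) (simp add: power2_eq_square mult_ac)
  next
    assume "[a = d] (mod int p)" "[b = c] (mod int p)"
    thus ?thesis using e by (intro exI[of _ d] exI[of _ c] sum.cong refl) (simp add: power2_eq_square mult_ac)
  next
    assume "[a = b] (mod int p)" "[c = d] (mod int p)"
    thus ?thesis using e by (intro exI[of _ b] exI[of _ d] sum.cong refl) (simp add: power2_eq_square mult_ac)
  qed
  hence "\<bar>?X - real p\<bar> \<le> 2" using quartic_sum_squares by metis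
  hence "\<bar>(?X - real p) / real p\<bar> \<le> 2 / real p" unfolding abs_divide by (simp add: divide_right_mono)
  hence "\<bar>?X / real p - 1\<bar> \<le> 2 / real p" using p_pos by (simp add: diff_divide_distrib)
  also have "2 / real p \<le> 2 / sqrt (real p)"
    using p_pos real_sqrt_le_mono[of 1 "real p"] by (intro divide_left_mono) (auto simp: real_le_lsqrt power2_eq_square)
  finally show ?thesis using local_quartic_approx[OF assms(1), of a b c d] by (simp add: abs_le_iff)
qed

lemma sqrt_ge_powr: "1 / sqrt (real p) \<le> real p powr (-1/4)"
proof -
  have "1 / sqrt (real p) = real p powr (-1/2)"
    using p_pos by (simp add: powr_half_sqrt[symmetric] powr_minus_divide)
  also have "\<dots> \<le> real p powr (-1/4)" using p_pos by (intro powr_mono) auto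
  finally show ?thesis .
qed

lemma local_quartic_unpaired:
  assumes "\<epsilon> \<in> {-1, 1}" "\<not> paired p a c b d" "\<not> paired p a d b c" "\<not> paired p a b c d"
  shows "\<bar>local_quartic p \<epsilon> a b c d\<bar> \<le> 19 * real p powr (-1/4)"
proof -
  let ?X = "\<Sum>k\<in>residues_below p. chi p (k + a) * chi p (k + b) * chi p (k + c) * chi p (k + d)"
  have "\<bar>?X / real p\<bar> \<le> 4 * real p powr (3/4) / real p"
    unfolding abs_divide using quartic_sum_unpaired[OF assms(2-4)] by (simp add: divide_right_mono)
  also have "4 * real p powr (3/4) / real p = 4 * real p powr (-1/4)"
    using p_pos powr_diff[of "real p" "3/4" 1] by simp
  finally have "\<bar>?X / real p\<bar> \<le> 4 * real p powr (-1/4)" .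
  moreover have "15 / sqrt (real p) \<le> 15 * real p powr (-1/4)" using sqrt_ge_powr by simp
  ultimately show ?thesis using local_quartic_approx[OF assms(1), of a b c d]
    abs_triangle_ineq[of "local_quartic p \<epsilon> a b c d - ?X / real p" "?X / real p"] by simp
qed

end

section \<open>Additive characters and Gauss sums\<close>

definition ee :: "real \<Rightarrow> complex" where "ee x = cis (2 * pi * x)"

lemma ee_add: "ee (x + y) = ee x * ee y"
  by (simp add: ee_def cis_mult ring_distribs)

lemma ee_0 [simp]: "ee 0 = 1" by (simp add: ee_def)

lemma norm_ee [simp]: "norm (ee x) = 1" by (simp add: ee_def)

lemma cnj_ee: "cnj (ee x) = ee (- x)" by (simp add: ee_def cis_cnj)

lemma ee_of_int [simp]: "ee (of_int k) = 1"
  unfolding ee_def using cis_multiple_2pi[of "of_int k"] by simp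

lemma ee_eq_1_iff: "ee x = 1 \<longleftrightarrow> x \<in> \<int>"
proof
  assume "ee x = 1"
  hence "cos (2 * pi * x) = 1" by (simp add: ee_def complex_eq_iff)
  then obtain k where "2 * pi * x = of_int k * 2 * pi" by (auto simp: cos_one_2pi_int)
  hence "x = of_int k" by simp
  thus "x \<in> \<int>" by simp
qed (auto elim: Ints_cases)

lemma ee_sum: "finite A \<Longrightarrow> ee (\<Sum>x\<in>A. f x) = (\<Prod>x\<in>A. ee (f x))"
  by (induction A rule: finite_induct) (auto simp: ee_add)

lemma ee_cong:
  assumes "[a = b] (mod int N)" "N > 0"
  shows "ee (of_int a / of_nat N) = ee (of_int b / of_nat N)"
proof -
  obtain m where "a = b + int N * m" using cong_sym[OF assms(1)] by (auto simp: cong_iff_lin)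
  hence "(of_int a / of_nat N :: real) = of_int b / of_nat N + of_int m" using assms by (simp add: field_simps)
  thus ?thesis by (simp add: ee_add)
qed

lemma periodic_ee: "N > 0 \<Longrightarrow> periodic_mod N (\<lambda>k. ee (of_int (a * k) / of_nat N))"
  unfolding periodic_mod_def by (intro allI impI ee_cong cong_scalar_left)

text \<open>
If \<open>N\<close> does not divide \<open>a\<close>, the translation of \<open>k\<close> by 1 multiplies the sum by a number different from 1.
\<close>
lemma sum_ee:
  assumes "N > 0"
  shows "(\<Sum>k\<in>residues_below N. ee (of_int (a * k) / of_nat N)) = (if int N dvd a then of_nat N else 0)"
proof (cases "int N dvd a")
  case True
  then obtain m where a: "a = int N * m" by blast
  have "ee (of_int (a * k) / of_nat N) = 1" for k
  proof -
    have "(of_int (a * k) / of_nat N :: real) = of_int (m * k)" using assms by (simp add: a)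
    thus ?thesis by (simp only: ee_of_int)
  qed
  thus ?thesis using True by simp
next
  case False
  let ?S = "\<Sum>k\<in>residues_below N. ee (of_int (a * k) / of_nat N)"
  have "?S = (\<Sum>k\<in>residues_below N. ee (of_int (a * (k + 1)) / of_nat N))"
    by (rule sum_residues_shift[OF assms periodic_ee[OF assms], symmetric])
  also have "\<dots> = (\<Sum>k\<in>residues_below N. ee (of_int a / of_nat N) * ee (of_int (a * k) / of_nat N))"
    by (intro sum.cong refl) (simp add: ee_add[symmetric] field_simps)
  also have "\<dots> = ee (of_int a / of_nat N) * ?S" by (rule sum_distrib_left[symmetric])
  finally have "?S = ee (of_int a / of_nat N) * ?S" .
  moreover have "ee (of_int a / of_nat N) \<noteq> 1"
  proof
    assume "ee (of_int a / of_nat N) = 1"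
    then obtain m where "(of_int a / of_nat N :: real) = of_int m" by (auto simp: ee_eq_1_iff elim: Ints_cases)
    hence "(of_int a :: real) = of_int (int N * m)" using assms by (simp add: field_simps)
    hence "a = int N * m" by (simp only: of_int_eq_iff)
    thus False using False by simp
  qed
  ultimately show ?thesis using False by auto
qed

context odd_prime
begin

lemma chi_minus_1:
  assumes "[p = 1] (mod 4)"
  shows "chi p (-1) = 1"
proof -
  have "4 dvd p - 1" using assms p_gt_2 by (simp add: cong_altdef_nat cong_sym_eq)
  hence "even ((p - 1) div 2)" by (auto elim!: dvdE)
  hence "[Legendre (-1) (int p) = 1] (mod int p)"
    using euler_criterion[of p "-1"] prime_p p_gt_2 by simp
  hence "int p dvd Legendre (-1) (int p) - 1" by (simp add: cong_iff_dvd_diff)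
  moreover have "Legendre (-1) (int p) \<in> {-1, 0, 1}" by (auto simp: Legendre_def)
  ultimately have "Legendre (-1) (int p) = 1" using p_gt_2 zdvd_imp_le[of "int p" 2] zdvd_imp_le[of "int p" 1] by auto
  thus ?thesis by (simp add: chi_def)
qed

text \<open>
If \<open>p\<close> does not divide \<open>j\<close>, substitute \<open>j * k\<close> for \<open>k\<close>; otherwise both sides vanish.
\<close>
lemma gauss_sum_twist:
  assumes c: "\<not> int p dvd c"
  shows "(\<Sum>k\<in>residues_below p. of_real (chi p k) * ee (of_int (j * c * k) / of_nat p))
    = of_real (chi p j) * (\<Sum>k\<in>residues_below p. of_real (chi p k) * ee (of_int (c * k) / of_nat p))"
proof (cases "int p dvd j")
  case True
  then obtain m where j: "j = int p * m" by blast
  have "ee (of_int (j * c * k) / of_nat p) = 1" for k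
  proof -
    have "(of_int (j * c * k) / of_nat p :: real) = of_int (m * c * k)" using p_pos by (simp add: j)
    thus ?thesis by (simp only: ee_of_int)
  qed
  moreover have "(\<Sum>k\<in>residues_below p. complex_of_real (chi p k)) = 0"
    by (simp only: of_real_sum[symmetric] sum_chi of_real_0)
  ultimately show ?thesis using True chi_zero_iff[of j] by simp
next
  case False
  define f where "f k = complex_of_real (chi p k) * ee (of_int (c * k) / of_nat p)" for k
  have per: "periodic_mod p f"
    unfolding periodic_mod_def f_def
  proof (intro allI impI)
    fix i i' assume i: "[i = i'] (mod int p)"
    show "complex_of_real (chi p i) * ee (of_int (c * i) / of_nat p) = complex_of_real (chi p i') * ee (of_int (c * i') / of_nat p)"
      using chi_cong[OF i] periodic_modD[OF periodic_ee[OF p_pos] i, of c] by simp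
  qed
  have "(\<Sum>k\<in>residues_below p. f k) = (\<Sum>k\<in>residues_below p. f (j * k))"
    by (rule sum_residues_mult[symmetric, OF p_pos per]) (use False coprime_iff in simp)
  also have "\<dots> = of_real (chi p j) * (\<Sum>k\<in>residues_below p. of_real (chi p k) * ee (of_int (j * c * k) / of_nat p))"
    unfolding sum_distrib_left f_def by (intro sum.cong refl) (simp add: chi_mult mult_ac)
  finally have "of_real (chi p j) * (\<Sum>k\<in>residues_below p. f k) =
     of_real (chi p j * chi p j) * (\<Sum>k\<in>residues_below p. of_real (chi p k) * ee (of_int (j * c * k) / of_nat p))"
    by (simp add: mult_ac)
  thus ?thesis using chi_square[of j] False by (simp add: f_def)
qed

text \<open>
Let \<open>G\<close> be the sum for \<open>j = 1\<close>. Multiply the twisted sums by \<open>ee (c * j / p)\<close> and sum over \<open>j\<close>: the left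
side becomes \<open>G * G\<close>, and orthogonality leaves only \<open>k = -1\<close> on the other side. So \<open>G * G = p * chi p (-1) = p\<close>,
and \<open>G\<close> is real.
\<close>
lemma gauss_sum:
  assumes c: "\<not> int p dvd c" and p4: "[p = 1] (mod 4)"
  obtains \<epsilon> :: real where "\<epsilon> \<in> {-1, 1}"
    and "\<And>j. (\<Sum>k\<in>residues_below p. of_real (chi p k) * ee (of_int (j * c * k) / of_nat p))
      = of_real (\<epsilon> * sqrt (real p) * chi p j)"
proof -
  define G where "G = (\<Sum>k\<in>residues_below p. of_real (chi p k) * ee (of_int (c * k) / of_nat p))"
  have "G * G = (\<Sum>j\<in>residues_below p. of_real (chi p j) * G * ee (of_int (c * j) / of_nat p))"
    unfolding G_def sum_distrib_right by (intro sum.cong refl) (simp add: mult_ac)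
  also have "\<dots> = (\<Sum>j\<in>residues_below p. (\<Sum>k\<in>residues_below p. of_real (chi p k) * ee (of_int (j * c * k) / of_nat p)) * ee (of_int (c * j) / of_nat p))"
    unfolding gauss_sum_twist[OF c] G_def by simp
  also have "\<dots> = (\<Sum>k\<in>residues_below p. \<Sum>j\<in>residues_below p. of_real (chi p k) * ee (of_int ((c * (k + 1)) * j) / of_nat p))"
    unfolding sum_distrib_right
    by (subst sum.swap) (intro sum.cong refl, simp add: mult.assoc ee_add[symmetric] add_divide_distrib[symmetric] algebra_simps)
  also have "\<dots> = (\<Sum>k\<in>residues_below p. if k = int p - 1 then of_real (chi p k) * of_nat p else 0)"
  proof (intro sum.cong refl)
    fix k assume k: "k \<in> residues_below p"
    have "int p dvd c * (k + 1) \<longleftrightarrow> int p dvd k + 1" using c prime_int by (simp add: prime_dvd_mult_iff)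
    also have "\<dots> \<longleftrightarrow> k = int p - 1" using k by (auto dest: zdvd_imp_le)
    finally show "(\<Sum>j\<in>residues_below p. of_real (chi p k) * ee (of_int ((c * (k + 1)) * j) / of_nat p))
       = (if k = int p - 1 then of_real (chi p k) * of_nat p else 0)"
      unfolding sum_distrib_left[symmetric] sum_ee[OF p_pos] by simp
  qed
  also have "\<dots> = of_real (chi p (int p - 1)) * of_nat p" using p_pos by simp
  also have "chi p (int p - 1) = chi p (-1)" by (rule chi_cong) (simp add: cong_iff_dvd_diff)
  finally have "G * G = of_real (sqrt (real p)) * of_real (sqrt (real p))"
    unfolding chi_minus_1[OF p4] by (simp flip: of_real_mult)
  hence "G = of_real (sqrt (real p)) \<or> G = - of_real (sqrt (real p))"
    by (simp only: square_eq_iff)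
  then obtain \<epsilon> :: real where e: "\<epsilon> \<in> {-1, 1}" "G = of_real (\<epsilon> * sqrt (real p))"
    by (elim disjE) (force intro: that)+
  show ?thesis
    by (rule that[OF e(1)]) (simp only: gauss_sum_twist[OF c] G_def[symmetric] e(2), simp)
qed

end

section \<open>Chinese remaindering\<close>

lemma sum_residues_coprime:
  fixes f g :: "int \<Rightarrow> 'a::comm_semiring_1"
  assumes "M > 0" "N > 0" "coprime M N" "periodic_mod M f" "periodic_mod N g"
  shows "(\<Sum>k\<in>residues_below (M * N). f k * g k) = (\<Sum>k\<in>residues_below M. f k) * (\<Sum>k\<in>residues_below N. g k)"
proof -
  define h where "h k = (k mod int M, k mod int N)" for k
  have inj: "inj_on h (residues_below (M * N))"
  proof (rule inj_onI)
    fix i j assume ij: "i \<in> residues_below (M * N)" "j \<in> residues_below (M * N)" "h i = h j"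
    have "[i = j] (mod int M * int N)"
      using ij(3) assms(3) by (intro coprime_cong_mult) (auto simp: h_def cong_def)
    thus "i = j" using cong_less_imp_eq_int[of i "int M * int N" j] ij by simp
  qed
  have sub: "h ` residues_below (M * N) \<subseteq> residues_below M \<times> residues_below N"
    using assms by (auto simp: h_def)
  have "card (h ` residues_below (M * N)) = card (residues_below M \<times> residues_below N)"
    using card_image[OF inj] by (simp add: card_cartesian_product nat_mult_distrib)
  hence "h ` residues_below (M * N) = residues_below M \<times> residues_below N"
    using sub by (intro card_subset_eq) auto
  hence bij: "bij_betw h (residues_below (M * N)) (residues_below M \<times> residues_below N)"
    using inj by (simp add: bij_betw_def)
  have "(\<Sum>k\<in>residues_below M. f k) * (\<Sum>k\<in>residues_below N. g k)
     = (\<Sum>x\<in>residues_below M \<times> residues_below N. f (fst x) * g (snd x))"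
    by (simp add: sum_product sum.cartesian_product case_prod_unfold)
  also have "\<dots> = (\<Sum>k\<in>residues_below (M * N). f (fst (h k)) * g (snd (h k)))"
    by (rule sum.reindex_bij_betw[OF bij, symmetric])
  also have "\<dots> = (\<Sum>k\<in>residues_below (M * N). f k * g k)"
    by (simp only: h_def fst_conv snd_conv periodic_mod_mod[OF assms(4)] periodic_mod_mod[OF assms(5)])
  finally show ?thesis by simp
qed

lemma prod_primes_pos: "(\<And>p. p \<in> A \<Longrightarrow> prime p) \<Longrightarrow> (\<Prod>p\<in>A. p) > (0::nat)"
  by (rule prod_pos) (auto intro: prime_gt_0_nat)

lemma coprime_prod_primes:
  assumes "finite A" "\<And>q. q \<in> A \<Longrightarrow> prime q" "prime p" "p \<notin> A"
  shows "coprime p (\<Prod>A :: nat)"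
  using assms by (intro prod_coprime_right) (metis primes_coprime)

lemma periodic_mod_dvd: "periodic_mod M f \<Longrightarrow> M dvd N \<Longrightarrow> periodic_mod N f"
  unfolding periodic_mod_def using cong_dvd_modulus by (metis int_dvd_int_iff)

lemma periodic_mod_prod:
  assumes "finite A" "\<And>p. p \<in> A \<Longrightarrow> periodic_mod p (f p)"
  shows "periodic_mod (\<Prod>A) (\<lambda>k. \<Prod>p\<in>A. f p k)"
  unfolding periodic_mod_def
proof (intro allI impI prod.cong refl)
  fix i j p assume "[i = j] (mod int (\<Prod>A))" "p \<in> A"
  thus "f p i = f p j"
    using periodic_modD[OF periodic_mod_dvd[OF assms(2)[of p]]] dvd_prodI[OF assms(1), of p "\<lambda>x. x"] by metis
qed

lemma sum_residues_prod:
  fixes f :: "nat \<Rightarrow> int \<Rightarrow> 'a::comm_semiring_1"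
  assumes "finite A" "\<And>p. p \<in> A \<Longrightarrow> prime p" "\<And>p. p \<in> A \<Longrightarrow> periodic_mod p (f p)"
  shows "(\<Sum>k\<in>residues_below (\<Prod>A). \<Prod>p\<in>A. f p k) = (\<Prod>p\<in>A. \<Sum>k\<in>residues_below p. f p k)"
  using assms
proof (induction A rule: finite_induct)
  case empty
  have "residues_below 1 = {0}" by auto
  thus ?case by simp
next
  case (insert p A)
  have "(\<Sum>k\<in>residues_below (p * \<Prod>A). f p k * (\<Prod>p\<in>A. f p k))
     = (\<Sum>k\<in>residues_below p. f p k) * (\<Sum>k\<in>residues_below (\<Prod>A). \<Prod>p\<in>A. f p k)"
    using insert by (intro sum_residues_coprime periodic_mod_prod coprime_prod_primes prod_primes_pos) (auto intro: prime_gt_0_nat)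
  thus ?case using insert by simp
qed

text \<open>
These integers split the additive characters modulo \<open>\<Prod>A\<close> into additive characters modulo the primes in \<open>A\<close>.
\<close>
lemma partial_fractions:
  assumes "finite A" "A \<noteq> {}" "\<And>p. p \<in> A \<Longrightarrow> prime (p :: nat)"
  shows "\<exists>c :: nat \<Rightarrow> int. (\<Sum>p\<in>A. of_int (c p) / of_nat p :: real) = 1 / of_nat (\<Prod>A) \<and> (\<forall>p\<in>A. \<not> int p dvd c p)"
  using assms
proof (induction A rule: finite_ne_induct)
  case (singleton q)
  thus ?case by (intro exI[of _ "\<lambda>_. 1"]) auto
next
  case (insert q A)
  let ?n = "\<Prod>A"
  have q: "prime q" and qA: "q \<notin> A" using insert by auto
  have pos: "?n > 0" using insert by (intro prod_primes_pos) auto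
  obtain c :: "nat \<Rightarrow> int" where c: "(\<Sum>p\<in>A. of_int (c p) / of_nat p :: real) = 1 / of_nat ?n" "\<forall>p\<in>A. \<not> int p dvd c p"
    using insert.IH insert.prems by blast
    have cop: "coprime (int ?n) (int q)"
      using coprime_prod_primes[of A q] insert q qA by (simp only: coprime_int_iff coprime_commute[of ?n]) blast
    then obtain u v where uv: "u * int ?n + v * int q = 1"
      using bezout_int[of "int ?n" "int q"] by auto
    define d where "d p = (if p = q then u else v * c p)" for p
    have "(\<Sum>p\<in>A. of_int (d p) / of_nat p :: real) = of_int v * (\<Sum>p\<in>A. of_int (c p) / of_nat p)"
      unfolding sum_distrib_left using qA by (intro sum.cong refl) (auto simp: d_def)
    also have "\<dots> = of_int v / of_nat ?n" using c by simp
    finally have "(\<Sum>p\<in>insert q A. of_int (d p) / of_nat p :: real) = of_int u / of_nat q + of_int v / of_nat ?n"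
      using insert by (simp add: d_def)
    also have "\<dots> = of_int (u * int ?n + v * int q) / (of_nat q * of_nat ?n)"
      using pos prime_gt_0_nat[OF q] by (simp add: field_simps del: of_nat_prod)
    also have "\<dots> = 1 / of_nat (\<Prod>(insert q A))" unfolding uv using insert by simp
    finally have 1: "(\<Sum>p\<in>insert q A. of_int (d p) / of_nat p :: real) = 1 / of_nat (\<Prod>(insert q A))" .
    have 2: "\<not> int p dvd d p" if p: "p \<in> insert q A" for p
    proof
      assume dvd: "int p dvd d p"
      have pp: "prime (int p)" using p insert by auto
      show False
      proof (cases "p = q")
        case True
        hence "int p dvd u * int ?n + v * int q" using dvd by (auto simp: d_def)
        thus False unfolding uv using pp not_prime_unit by blast
      next
        case False
        hence "int p dvd v" using dvd p c pp by (auto simp: d_def prime_dvd_mult_iff)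
        moreover have "int p dvd int ?n"
          using False p dvd_prodI[OF insert(1), of p "\<lambda>x. x"] by (simp only: int_dvd_int_iff) simp
        ultimately have "int p dvd u * int ?n + v * int q" by (metis dvd_add dvd_mult dvd_mult2)
        thus False unfolding uv using pp not_prime_unit by blast
      qed
    qed
    show ?case using 1 2 by (intro exI[of _ d]) auto
qed

section \<open>Fourier analysis of the Jacobi sequence\<close>

context odd_prime
begin

lemma periodic_local_dft: "periodic_mod p (local_dft p \<epsilon>)"
  unfolding periodic_mod_def local_dft_def using chi_cong by metis

text \<open>
The multiple \<open>\<epsilon> * chi p\<close> is transformed into \<open>sqrt p * chi p\<close> by the Gauss sum, and the constant \<open>1 / sqrt p\<close> into the
indicator of the multiples of \<open>p\<close>.
\<close>
lemma local_inversion: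
  assumes c: "\<not> int p dvd c" and p4: "[p = 1] (mod 4)"
  shows "\<exists>\<epsilon>::real. \<epsilon> \<in> {-1, 1} \<and> (\<forall>j. of_real (chi p j + of_bool (int p dvd j))
    = of_real (1 / sqrt (real p)) * (\<Sum>k\<in>residues_below p. of_real (local_dft p \<epsilon> k) * ee (of_int (j * c * k) / of_nat p)))"
proof -
  obtain \<epsilon> :: real where e: "\<epsilon> \<in> {-1, 1}"
    and g: "\<And>j. (\<Sum>k\<in>residues_below p. of_real (chi p k) * ee (of_int (j * c * k) / of_nat p))
      = of_real (\<epsilon> * sqrt (real p) * chi p j)"
    using gauss_sum[OF c p4] by blast
  have "of_real (1 / sqrt (real p)) * (\<Sum>k\<in>residues_below p. of_real (local_dft p \<epsilon> k) * ee (of_int (j * c * k) / of_nat p))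
     = (of_real (chi p j + of_bool (int p dvd j)) :: complex)" for j
  proof -
    have "(\<Sum>k\<in>residues_below p. of_real (local_dft p \<epsilon> k) * ee (of_int (j * c * k) / of_nat p))
      = of_real \<epsilon> * (\<Sum>k\<in>residues_below p. of_real (chi p k) * ee (of_int (j * c * k) / of_nat p))
        + of_real (1 / sqrt (real p)) * (\<Sum>k\<in>residues_below p. ee (of_int (j * c * k) / of_nat p))"
      unfolding local_dft_def sum_distrib_left sum.distrib[symmetric]
      by (intro sum.cong refl) (simp add: algebra_simps)
    also have "\<dots> = of_real (\<epsilon> * (\<epsilon> * sqrt (real p) * chi p j) + 1 / sqrt (real p) * (if int p dvd j then real p else 0))"
      unfolding g sum_ee[OF p_pos] using c prime_int by (simp add: prime_dvd_mult_iff)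
    also have "\<epsilon> * (\<epsilon> * sqrt (real p) * chi p j) + 1 / sqrt (real p) * (if int p dvd j then real p else 0)
       = sqrt (real p) * (chi p j + of_bool (int p dvd j))"
      using e p_pos by (auto simp: field_simps)
    finally have eq: "(\<Sum>k\<in>residues_below p. of_real (local_dft p \<epsilon> k) * ee (of_int (j * c * k) / of_nat p))
       = of_real (sqrt (real p) * (chi p j + of_bool (int p dvd j)))" .
    show ?thesis unfolding eq of_real_mult[symmetric] using p_pos by simp
  qed
  thus ?thesis using e by (intro exI[of _ \<epsilon>]) simp
qed

end

text \<open>
For squarefree \<open>n\<close> this is the Jacobi sequence: a prime that divides \<open>j\<close> is missing from \<open>n / gcd j n\<close>, and its
factor is 1.
\<close>
definition jacobi_coeff :: "nat \<Rightarrow> int \<Rightarrow> real" where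
  "jacobi_coeff n j = (\<Prod>p\<in>prime_factors n. chi p j + of_bool (int p dvd j))"

definition jacobi_dft :: "nat \<Rightarrow> (nat \<Rightarrow> real) \<Rightarrow> int \<Rightarrow> real" where
  "jacobi_dft n \<epsilon> k = (\<Prod>p\<in>prime_factors n. local_dft p (\<epsilon> p) k)"

definition quartic_corr :: "nat \<Rightarrow> (nat \<Rightarrow> real) \<Rightarrow> int \<Rightarrow> int \<Rightarrow> int \<Rightarrow> int \<Rightarrow> real" where
  "quartic_corr n \<epsilon> a b c d = (\<Sum>h\<in>residues_below n.
     jacobi_dft n \<epsilon> (h + a) * jacobi_dft n \<epsilon> (h + b) * jacobi_dft n \<epsilon> (h + c) * jacobi_dft n \<epsilon> (h + d)) / real n"

lemma abs_prod_minus_one: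
  fixes x e :: "'a \<Rightarrow> real"
  assumes "finite A" "\<And>i. i \<in> A \<Longrightarrow> \<bar>x i - 1\<bar> \<le> e i"
  shows "\<bar>(\<Prod>i\<in>A. x i) - 1\<bar> \<le> (\<Prod>i\<in>A. 1 + e i) - 1"
  using assms
proof (induction A rule: finite_induct)
  case (insert i A)
  have ei: "\<bar>x i - 1\<bar> \<le> e i" using insert by simp
  have "x i * (\<Prod>i\<in>A. x i) - 1 = x i * ((\<Prod>i\<in>A. x i) - 1) + (x i - 1)" by (simp add: algebra_simps)
  also have "\<bar>\<dots>\<bar> \<le> \<bar>x i\<bar> * \<bar>(\<Prod>i\<in>A. x i) - 1\<bar> + \<bar>x i - 1\<bar>" by (metis abs_mult abs_triangle_ineq)
  also have "\<dots> \<le> (1 + e i) * ((\<Prod>i\<in>A. 1 + e i) - 1) + e i"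
  proof (intro add_mono mult_mono)
    show "\<bar>x i\<bar> \<le> 1 + e i" "0 \<le> 1 + e i" using ei by linarith+
    show "\<bar>(\<Prod>i\<in>A. x i) - 1\<bar> \<le> (\<Prod>i\<in>A. 1 + e i) - 1" using insert by simp
  qed (use ei in auto)
  finally show ?case using insert by (simp add: algebra_simps)
qed simp

lemma sqrt_prod: "finite A \<Longrightarrow> sqrt (\<Prod>i\<in>A. f i) = (\<Prod>i\<in>A. sqrt (f i))"
  by (induction A rule: finite_induct) (auto simp: real_sqrt_mult)

lemma primes_prod_dvd:
  assumes "finite B" "\<And>p. p \<in> B \<Longrightarrow> prime p" "\<And>p. p \<in> B \<Longrightarrow> int p dvd a"
  shows "int (\<Prod>B) dvd a"
  using assms
proof (induction B rule: finite_induct)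
  case (insert p B)
  have "coprime p (\<Prod>B)" using insert by (intro coprime_prod_primes) auto
  hence "coprime (int p) (int (\<Prod>B))" by (simp only: coprime_int_iff)
  thus ?case using insert by (simp add: divides_mult)
qed simp

lemma paired_prod:
  assumes "finite B" "\<And>p. p \<in> B \<Longrightarrow> prime p" "\<And>p. p \<in> B \<Longrightarrow> paired p a b c d"
  shows "paired (\<Prod>B) a b c d"
  using primes_prod_dvd[OF assms(1,2), of "a - b"] primes_prod_dvd[OF assms(1,2), of "c - d"] assms(3)
  by (simp only: paired_def cong_iff_dvd_diff)

locale jacobi_modulus =
  fixes n :: nat
  assumes n_gt_1: "n > 1" and squarefree_n: "squarefree n" and odd_n: "odd n"
    and primes_1_mod_4: "\<And>p. prime p \<Longrightarrow> p dvd n \<Longrightarrow> [p = 1] (mod 4)"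
begin

abbreviation "P \<equiv> prime_factors n"

lemma n_pos: "n > 0" using n_gt_1 by simp

lemma P_prime: "p \<in> P \<Longrightarrow> prime p" by (rule in_prime_factors_imp_prime)
lemma P_dvd: "p \<in> P \<Longrightarrow> p dvd n" by (rule in_prime_factors_imp_dvd)

lemma P_odd_prime: "p \<in> P \<Longrightarrow> odd_prime p"
proof
  assume p: "p \<in> P"
  show "prime p" by (rule P_prime[OF p])
  have "odd p" using P_dvd[OF p] odd_n by (meson dvd_trans)
  thus "p > 2" using prime_ge_2_nat[OF P_prime[OF p]] by (cases "p = 2") auto
qed

lemma prod_P: "\<Prod>P = n"
proof -
  have "n = (\<Prod>p\<in>P. p ^ multiplicity p n)" using n_pos by (intro prime_factorization_nat)
  also have "\<dots> = \<Prod>P"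
    using squarefree_n n_pos by (intro prod.cong refl) (simp add: squarefree_factorial_semiring')
  finally show ?thesis by simp
qed

lemma P_nonempty: "P \<noteq> {}"
  using prod_P n_gt_1 by auto

lemma periodic_jacobi_dft: "periodic_mod n (jacobi_dft n \<epsilon>)"
proof -
  have "periodic_mod (\<Prod>P) (\<lambda>k. \<Prod>p\<in>P. local_dft p (\<epsilon> p) k)"
    by (rule periodic_mod_prod) (auto intro: odd_prime.periodic_local_dft P_odd_prime)
  thus ?thesis by (simp add: prod_P jacobi_dft_def[abs_def])
qed

text \<open>
Multiply the local inversion formulas; the Chinese remainder theorem turns the product of sums modulo the primes into one sum
modulo \<open>n\<close>.
\<close>
lemma jacobi_coeff_inversion:
  obtains \<epsilon> :: "nat \<Rightarrow> real" where "\<And>p. p \<in> P \<Longrightarrow> \<epsilon> p \<in> {-1, 1}"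
    and "\<And>j. of_real (jacobi_coeff n j) = of_real (1 / sqrt (real n)) *
      (\<Sum>k\<in>residues_below n. of_real (jacobi_dft n \<epsilon> k) * ee (of_int (j * k) / of_nat n))"
proof -
  obtain c :: "nat \<Rightarrow> int" where c: "(\<Sum>p\<in>P. of_int (c p) / of_nat p :: real) = 1 / of_nat n"
    and cp: "\<And>p. p \<in> P \<Longrightarrow> \<not> int p dvd c p"
    using partial_fractions[OF _ P_nonempty P_prime] unfolding prod_P by auto
  have "\<forall>p\<in>P. \<exists>\<epsilon>::real. \<epsilon> \<in> {-1, 1} \<and> (\<forall>j. of_real (chi p j + of_bool (int p dvd j))
    = of_real (1 / sqrt (real p)) * (\<Sum>k\<in>residues_below p. of_real (local_dft p \<epsilon> k) * ee (of_int (j * c p * k) / of_nat p)))"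
    using odd_prime.local_inversion[OF P_odd_prime cp primes_1_mod_4[OF P_prime P_dvd]] by blast
  from bchoice[OF this] obtain \<epsilon> :: "nat \<Rightarrow> real" where \<epsilon>: "\<forall>p\<in>P. \<epsilon> p \<in> {-1, 1} \<and> (\<forall>j. of_real (chi p j + of_bool (int p dvd j))
    = of_real (1 / sqrt (real p)) * (\<Sum>k\<in>residues_below p. of_real (local_dft p (\<epsilon> p) k) * ee (of_int (j * c p * k) / of_nat p)))"
    by blast
  hence e: "\<And>p. p \<in> P \<Longrightarrow> \<epsilon> p \<in> {-1, 1}" by blast
  have inv: "of_real (chi p j + of_bool (int p dvd j))
    = of_real (1 / sqrt (real p)) * (\<Sum>k\<in>residues_below p. of_real (local_dft p (\<epsilon> p) k) * ee (of_int (j * c p * k) / of_nat p))"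
    if "p \<in> P" for p j using \<epsilon> that by blast
  have "of_real (jacobi_coeff n j) = of_real (1 / sqrt (real n)) *
      (\<Sum>k\<in>residues_below n. of_real (jacobi_dft n \<epsilon> k) * ee (of_int (j * k) / of_nat n))" for j
  proof -
    define f where "f p k = of_real (local_dft p (\<epsilon> p) k) * ee (of_int (j * c p * k) / of_nat p)" for p k
    have perf: "periodic_mod p (f p)" if "p \<in> P" for p
      unfolding periodic_mod_def f_def
    proof (intro allI impI)
      fix i i' assume i: "[i = i'] (mod int p)"
      have p0: "p > 0" using P_prime[OF that] prime_gt_0_nat by blast
      show "of_real (local_dft p (\<epsilon> p) i) * ee (of_int (j * c p * i) / of_nat p)
        = of_real (local_dft p (\<epsilon> p) i') * ee (of_int (j * c p * i') / of_nat p)"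
        using periodic_modD[OF odd_prime.periodic_local_dft[OF P_odd_prime[OF that]] i, of "\<epsilon> p"]
          periodic_modD[OF periodic_ee[OF p0] i, of "j * c p"] by simp
    qed
    have fprod: "(\<Prod>p\<in>P. f p k) = of_real (jacobi_dft n \<epsilon> k) * ee (of_int (j * k) / of_nat n)" for k
    proof -
      have "(\<Sum>p\<in>P. of_int (j * c p * k) / of_nat p :: real) = of_int (j * k) * (\<Sum>p\<in>P. of_int (c p) / of_nat p)"
        unfolding sum_distrib_left by (intro sum.cong refl) simp
      also have "\<dots> = of_int (j * k) / of_nat n" by (simp add: c)
      finally have "ee (of_int (j * k) / of_nat n) = (\<Prod>p\<in>P. ee (of_int (j * c p * k) / of_nat p))"
        by (metis ee_sum finite_set_mset)
      thus ?thesis by (simp add: f_def prod.distrib jacobi_dft_def)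
    qed
    have "of_real (jacobi_coeff n j) = (\<Prod>p\<in>P. complex_of_real (chi p j + of_bool (int p dvd j)))"
      by (simp only: jacobi_coeff_def of_real_prod)
    also have "\<dots> = (\<Prod>p\<in>P. of_real (1 / sqrt (real p)) * (\<Sum>k\<in>residues_below p. f p k))"
      by (intro prod.cong refl) (simp only: inv f_def)
    also have "\<dots> = of_real (\<Prod>p\<in>P. 1 / sqrt (real p)) * (\<Prod>p\<in>P. \<Sum>k\<in>residues_below p. f p k)"
      by (simp only: prod.distrib of_real_prod)
    also have "(\<Prod>p\<in>P. \<Sum>k\<in>residues_below p. f p k) = (\<Sum>k\<in>residues_below n. \<Prod>p\<in>P. f p k)"
      using sum_residues_prod[of P f, OF finite_set_mset P_prime perf] unfolding prod_P by simp
    also have "(\<Prod>p\<in>P. 1 / sqrt (real p)) = 1 / sqrt (real n)"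
    proof -
      have "sqrt (real n) = (\<Prod>p\<in>P. sqrt (real p))"
        by (subst prod_P[symmetric]) (simp add: sqrt_prod)
      thus ?thesis by (simp add: prod_dividef)
    qed
    finally show ?thesis by (simp only: fprod)
  qed
  with e show ?thesis by (rule that)
qed

lemma quartic_corr_prod: "quartic_corr n \<epsilon> a b c d = (\<Prod>p\<in>P. local_quartic p (\<epsilon> p) a b c d)"
proof -
  define f where "f p h = local_dft p (\<epsilon> p) (h + a) * local_dft p (\<epsilon> p) (h + b) * local_dft p (\<epsilon> p) (h + c) * local_dft p (\<epsilon> p) (h + d)" for p h
  have perf: "periodic_mod p (f p)" if "p \<in> P" for p
    unfolding periodic_mod_def f_def
  proof (intro allI impI)
    fix i j assume "[i = j] (mod int p)"
    hence "local_dft p (\<epsilon> p) (i + t) = local_dft p (\<epsilon> p) (j + t)" for t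
      by (intro periodic_modD[OF odd_prime.periodic_local_dft[OF P_odd_prime[OF that]]] cong_add cong_refl)
    thus "local_dft p (\<epsilon> p) (i + a) * local_dft p (\<epsilon> p) (i + b) * local_dft p (\<epsilon> p) (i + c) * local_dft p (\<epsilon> p) (i + d)
      = local_dft p (\<epsilon> p) (j + a) * local_dft p (\<epsilon> p) (j + b) * local_dft p (\<epsilon> p) (j + c) * local_dft p (\<epsilon> p) (j + d)"
      by presburger
  qed
  have "(\<Sum>h\<in>residues_below n. \<Prod>p\<in>P. f p h) = (\<Prod>p\<in>P. \<Sum>h\<in>residues_below p. f p h)"
    using sum_residues_prod[of P f, OF finite_set_mset P_prime perf] unfolding prod_P by simp
  moreover have "real n = (\<Prod>p\<in>P. real p)" by (subst prod_P[symmetric]) simp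
  ultimately show ?thesis
    by (simp add: quartic_corr_def local_quartic_def jacobi_dft_def f_def prod.distrib prod_dividef)
qed

lemma quartic_corr_paired:
  assumes e: "\<And>p. p \<in> P \<Longrightarrow> \<epsilon> p \<in> {-1, 1}"
    and "paired n a c b d \<or> paired n a d b c \<or> paired n a b c d"
  shows "\<bar>quartic_corr n \<epsilon> a b c d - 1\<bar> \<le> (\<Prod>p\<in>P. 1 + 17 / sqrt (real p)) - 1"
  unfolding quartic_corr_prod
proof (rule abs_prod_minus_one)
  fix p assume p: "p \<in> P"
  have "paired p x y z w" if "paired n x y z w" for x y z w
    using that P_dvd[OF p] unfolding paired_def by (meson cong_dvd_modulus int_dvd_int_iff)
  hence "paired p a c b d \<or> paired p a d b c \<or> paired p a b c d" using assms(2) by blast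
  thus "\<bar>local_quartic p (\<epsilon> p) a b c d - 1\<bar> \<le> 17 / sqrt (real p)"
    by (rule odd_prime.local_quartic_paired[OF P_odd_prime[OF p] e[OF p]])
qed simp

text \<open>
A prime of \<open>E\<close> contributes at most \<open>19 * p powr (-1/4)\<close>, and any other prime at most \<open>1 + 17 / sqrt p \<le> 19\<close>.
\<close>
lemma quartic_corr_bound:
  fixes a b c d :: int
  assumes e: "\<And>p. p \<in> P \<Longrightarrow> \<epsilon> p \<in> {-1, 1}"
  defines "E \<equiv> {p \<in> P. \<not> (paired p a c b d \<or> paired p a d b c \<or> paired p a b c d)}"
  shows "\<bar>quartic_corr n \<epsilon> a b c d\<bar> \<le> 19 ^ card P * real (\<Prod>E) powr (-1/4)"
proof -
  have EP: "E \<subseteq> P" by (auto simp: E_def)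
  have "\<bar>quartic_corr n \<epsilon> a b c d\<bar> = (\<Prod>p\<in>P. \<bar>local_quartic p (\<epsilon> p) a b c d\<bar>)"
    by (simp add: quartic_corr_prod abs_prod)
  also have "\<dots> \<le> (\<Prod>p\<in>P. 19 * (if p \<in> E then real p powr (-1/4) else 1))"
  proof (intro prod_mono conjI abs_ge_zero)
    fix p assume p: "p \<in> P"
    interpret odd_prime p by (rule P_odd_prime[OF p])
    show "\<bar>local_quartic p (\<epsilon> p) a b c d\<bar> \<le> 19 * (if p \<in> E then real p powr (-1/4) else 1)"
    proof (cases "p \<in> E")
      case True
      thus ?thesis using local_quartic_unpaired[OF e[OF p], of a c b d] by (simp add: E_def)
    next
      case False
      hence "\<bar>local_quartic p (\<epsilon> p) a b c d - 1\<bar> \<le> 17 / sqrt (real p)"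
        using p by (intro local_quartic_paired e) (auto simp: E_def)
      also have "\<dots> \<le> 17 / 1" using p_pos by (intro divide_left_mono) auto
      finally show ?thesis using False by simp
    qed
  qed
  also have "\<dots> = 19 ^ card P * (\<Prod>p\<in>P. if p \<in> E then real p powr (-1/4) else 1)"
    by (simp add: prod.distrib)
  also have "(\<Prod>p\<in>P. if p \<in> E then real p powr (-1/4) else 1) = (\<Prod>p\<in>E. real p powr (-1/4))"
    using EP by (intro prod.mono_neutral_cong_right) auto
  also have "\<dots> = real (\<Prod>E) powr (-1/4)"
    by (simp add: prod_powr_distrib)
  finally show ?thesis .
qed

text \<open>
Divide the primes of \<open>n\<close> into the unpaired ones and three classes of paired ones. Since \<open>n\<close> is the product over
all four classes, one of them has a product of at least \<open>n powr (1/4)\<close>. For the unpaired primes this gives a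
small average; for a pairing it is the divisor \<open>D\<close>.
\<close>
lemma quartic_corr_dichotomy:
  assumes e: "\<And>p. p \<in> P \<Longrightarrow> \<epsilon> p \<in> {-1, 1}"
  shows "\<bar>quartic_corr n \<epsilon> a b c d\<bar> \<le> 19 ^ card P * real n powr (-1/16) \<or>
    \<bar>quartic_corr n \<epsilon> a b c d\<bar> \<le> 19 ^ card P \<and>
    (\<exists>D \<in> Prod ` Pow P. real n powr (1/4) \<le> real D \<and> (paired D a c b d \<or> paired D a d b c \<or> paired D a b c d))"
proof -
  define A1 where "A1 = {p \<in> P. paired p a c b d}"
  define A2 where "A2 = {p \<in> P. paired p a d b c} - A1"
  define A3 where "A3 = {p \<in> P. paired p a b c d} - A1 - A2"
  define E where "E = {p \<in> P. \<not> (paired p a c b d \<or> paired p a d b c \<or> paired p a b c d)}"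
  have sub: "A1 \<subseteq> P" "A2 \<subseteq> P" "A3 \<subseteq> P" "E \<subseteq> P" by (auto simp: A1_def A2_def A3_def E_def)
  hence fin: "finite A1" "finite A2" "finite A3" "finite E" using finite_set_mset finite_subset by metis+
  have pos: "\<Prod>B > 0" if "B \<subseteq> P" for B using that P_prime by (intro prod_primes_pos) auto
  have P: "P = E \<union> (A1 \<union> (A2 \<union> A3))" by (auto simp: A1_def A2_def A3_def E_def)
  have "n = \<Prod>P" by (simp add: prod_P)
  also have "\<dots> = \<Prod>E * (\<Prod>A1 * (\<Prod>A2 * \<Prod>A3))"
  proof -
    have "E \<inter> (A1 \<union> (A2 \<union> A3)) = {}" "A1 \<inter> (A2 \<union> A3) = {}" "A2 \<inter> A3 = {}"
      by (auto simp: A1_def A2_def A3_def E_def)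
    thus ?thesis unfolding P using fin by (simp add: prod.union_disjoint)
  qed
  finally have n_eq: "real n = real (\<Prod>E) * (real (\<Prod>A1) * (real (\<Prod>A2) * real (\<Prod>A3)))"
    by (metis of_nat_mult)
  let ?r = "real n powr (1/4)"
  have r4: "?r * (?r * (?r * ?r)) = real n" using n_pos by (simp flip: powr_add)
  have bound: "\<bar>quartic_corr n \<epsilon> a b c d\<bar> \<le> 19 ^ card P * real (\<Prod>E) powr (-1/4)"
    unfolding E_def by (rule quartic_corr_bound[OF e])
  have "real (\<Prod>E) \<ge> 1" using pos[OF sub(4)] by linarith
  hence "real (\<Prod>E) powr (-1/4) \<le> 1" using powr_mono[of "-1/4" 0 "real (\<Prod>E)"] by simp
  hence "19 ^ card P * real (\<Prod>E) powr (-1/4) \<le> 19 ^ card P * 1" by (intro mult_left_mono) auto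
  with bound have bound1: "\<bar>quartic_corr n \<epsilon> a b c d\<bar> \<le> 19 ^ card P" by linarith
  consider "?r \<le> real (\<Prod>E)" | "?r \<le> real (\<Prod>A1)" | "?r \<le> real (\<Prod>A2)" | "?r \<le> real (\<Prod>A3)"
  proof -
    have False if "real (\<Prod>E) < ?r" "real (\<Prod>A1) < ?r" "real (\<Prod>A2) < ?r" "real (\<Prod>A3) < ?r"
    proof -
      have "real (\<Prod>E) * (real (\<Prod>A1) * (real (\<Prod>A2) * real (\<Prod>A3))) < ?r * (?r * (?r * ?r))"
        using that pos sub n_pos by (intro mult_strict_mono mult_pos_pos) (auto simp del: of_nat_prod)
      thus False using n_eq r4 by simp
    qed
    thus ?thesis using that by force
  qed
  thus ?thesis
  proof cases
    case 1
    have "real (\<Prod>E) powr (-1/4) \<le> ?r powr (-1/4)"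
      using 1 n_pos by (intro powr_mono2') auto
    also have "\<dots> = real n powr (-1/16)" by (simp add: powr_powr)
    finally have "19 ^ card P * real (\<Prod>E) powr (-1/4) \<le> 19 ^ card P * real n powr (-1/16)"
      by (intro mult_left_mono) auto
    with bound show ?thesis by linarith
  next
    case 2
    moreover have "paired (\<Prod>A1) a c b d" using sub fin P_prime by (intro paired_prod) (auto simp: A1_def)
    ultimately show ?thesis using bound1 sub(1) by blast
  next
    case 3
    moreover have "paired (\<Prod>A2) a d b c" using sub fin P_prime by (intro paired_prod) (auto simp: A2_def)
    ultimately show ?thesis using bound1 sub(2) by blast
  next
    case 4
    moreover have "paired (\<Prod>A3) a b c d" using sub fin P_prime by (intro paired_prod) (auto simp: A3_def)
    ultimately show ?thesis using bound1 sub(3) by blast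
  qed
qed

end

section \<open>Kernels with a repulsion property\<close>

text \<open>
The chord has length \<open>2 * sin (pi * x)\<close>, and \<open>sin y \<ge> y / 2\<close> for \<open>0 \<le> y \<le> pi / 2\<close> by Taylor's formula.
\<close>
lemma norm_one_minus_ee:
  assumes "0 \<le> x" "x \<le> 1/2"
  shows "3 * x \<le> norm (1 - ee x)"
proof -
  have sin_lower: "y / 2 \<le> sin y" if y: "0 \<le> y" "y \<le> pi / 2" for y :: real
  proof -
    have "\<bar>sin y - (\<Sum>m<3. sin_coeff m * y ^ m)\<bar> \<le> inverse (fact 3) * \<bar>y\<bar> ^ 3"
      by (rule Maclaurin_sin_bound)
    hence "\<bar>sin y - y\<bar> \<le> y ^ 3 / 6"
      using y by (simp add: sin_coeff_def lessThan_nat_numeral fact_numeral)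
    hence "y - y ^ 3 / 6 \<le> sin y" using abs_le_D2[of "sin y - y" "y ^ 3 / 6"] by linarith
    moreover have "y ^ 3 \<le> 3 * y"
    proof -
      have "y \<le> 17/10" using y pi_approx by simp
      hence "y * y \<le> 17/10 * (17/10)" using y by (intro mult_mono) auto
      hence "y * y \<le> 3" by simp
      hence "(y * y) * y \<le> 3 * y" using y by (intro mult_right_mono) auto
      thus ?thesis by (simp add: power3_eq_cube)
    qed
    ultimately show ?thesis by linarith
  qed
  have eq: "1 - ee x = - (2 * \<i> * of_real (sin (pi * x))) * cis (pi * x)"
  proof -
    have "cos (2 * pi * x) = 1 - 2 * sin (pi * x) ^ 2" "sin (2 * pi * x) = 2 * sin (pi * x) * cos (pi * x)"
      using cos_double_sin[of "pi * x"] sin_double[of "pi * x"] by (simp_all add: mult.assoc)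
    thus ?thesis by (simp add: ee_def complex_eq_iff power2_eq_square)
  qed
  have "norm (1 - ee x) = 2 * \<bar>sin (pi * x)\<bar>" unfolding eq by (simp add: norm_mult)
  moreover have "pi * x / 2 \<le> sin (pi * x)"
    using assms pi_gt_zero by (intro sin_lower) (auto simp: field_simps)
  moreover have "3 * x \<le> pi * x" using assms pi_approx by (intro mult_right_mono) auto
  ultimately show ?thesis by linarith
qed

lemma norm_one_minus_ee_uminus: "norm (1 - ee (- x)) = norm (1 - ee x)"
  using complex_mod_cnj[of "1 - ee x"] by (simp add: cnj_ee)

lemma norm_one_minus_ee_fraction:
  assumes "0 < h" "h < int N"
  shows "1 / norm (1 - ee (of_int h / of_nat N)) \<le> of_nat N / 3 * (1 / of_int h + 1 / of_int (int N - h))"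
proof -
  have N: "N > 0" using assms by auto
  have main: "1 / norm (1 - ee (of_int h / of_nat N)) \<le> of_nat N / 3 * (1 / of_int h)" if "0 < h" "2 * h \<le> int N" for h
  proof -
    have "3 * (of_int h / of_nat N) \<le> norm (1 - ee (of_int h / of_nat N))"
      using that N by (intro norm_one_minus_ee) (auto simp: field_simps)
    moreover have "3 * (of_int h / of_nat N :: real) > 0" using that N by simp
    ultimately have "1 / norm (1 - ee (of_int h / of_nat N)) \<le> 1 / (3 * (of_int h / of_nat N))"
      by (intro divide_left_mono mult_pos_pos) auto
    thus ?thesis by simp
  qed
  show ?thesis
  proof (cases "2 * h \<le> int N")
    case True
    have "1 / norm (1 - ee (of_int h / of_nat N)) \<le> of_nat N / 3 * (1 / of_int h)" using main assms True by simp
    also have "\<dots> \<le> of_nat N / 3 * (1 / of_int h + 1 / of_int (int N - h))"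
      using assms by (intro mult_left_mono) auto
    finally show ?thesis .
  next
    case False
    have "ee (of_int h / of_nat N) = ee (of_int (- (int N - h)) / of_nat N)"
      by (rule ee_cong) (use N in \<open>auto simp: cong_iff_dvd_diff\<close>)
    also have "of_int (- (int N - h)) / of_nat N = - (of_int (int N - h) / of_nat N :: real)"
      by (simp only: of_int_minus minus_divide_left)
    finally have "norm (1 - ee (of_int h / of_nat N)) = norm (1 - ee (of_int (int N - h) / of_nat N))"
      by (simp only: norm_one_minus_ee_uminus)
    hence "1 / norm (1 - ee (of_int h / of_nat N)) \<le> of_nat N / 3 * (1 / of_int (int N - h))"
      using main[of "int N - h"] assms False by simp
    also have "\<dots> \<le> of_nat N / 3 * (1 / of_int h + 1 / of_int (int N - h))"
      using assms by (intro mult_left_mono) auto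
    finally show ?thesis .
  qed
qed

lemma harm_le: "n > 0 \<Longrightarrow> harm n \<le> 1 + ln (real n)"
  using decseqD[OF decseq_harm_diff_ln, of 0 "n - 1"] by (cases n) (auto simp: harm_expand)

text \<open>
The term \<open>h = 0\<close> is 0 because of \<open>1 / 0 = 0\<close>. The sum is thus a sum over nonzero distances, and a dilation of \<open>h\<close>
may run over all residues.
\<close>
definition kernel_sum :: "nat \<Rightarrow> real" where
  "kernel_sum N = (\<Sum>h\<in>residues_below N. 1 / norm (1 - ee (of_int h / of_nat N)))"

text \<open>
Compare with harmonic sums from both ends of the period.
\<close>
lemma kernel_sum_le:
  assumes "N > 0"
  shows "kernel_sum N \<le> of_nat N * (1 + ln (of_nat N))"
proof -
  have R: "residues_below N = insert 0 (int ` {1..<N})"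
  proof safe
    fix x assume x: "x \<in> residues_below N" "x \<notin> int ` {1..<N}"
    hence "x = int (nat x)" "nat x < N" by auto
    thus "x = 0" using x by (cases "nat x = 0") (auto simp: image_iff Bex_def)
  qed (use assms in auto)
  have "kernel_sum N = (\<Sum>h\<in>int ` {1..<N}. 1 / norm (1 - ee (of_int h / of_nat N)))"
    unfolding kernel_sum_def R by (subst sum.insert) auto
  also have "\<dots> = (\<Sum>h\<in>{1..<N}. 1 / norm (1 - ee (of_int (int h) / of_nat N)))"
    by (subst sum.reindex) auto
  also have "\<dots> \<le> (\<Sum>h\<in>{1..<N}. of_nat N / 3 * (1 / of_int (int h) + 1 / of_int (int N - int h)))"
    by (intro sum_mono norm_one_minus_ee_fraction) auto
  also have "\<dots> = of_nat N / 3 * ((\<Sum>h\<in>{1..<N}. 1 / of_nat h) + (\<Sum>h\<in>{1..<N}. 1 / of_nat (N - h)))"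
    unfolding sum_distrib_left[symmetric] sum.distrib by (simp add: of_nat_diff)
  also have "(\<Sum>h\<in>{1..<N}. 1 / of_nat (N - h)) = (\<Sum>h\<in>{1..<N}. 1 / of_nat h :: real)"
    by (rule sum.reindex_bij_witness[of _ "\<lambda>h. N - h" "\<lambda>h. N - h"]) auto
  also have "(\<Sum>h\<in>{1..<N}. 1 / of_nat h :: real) = harm (N - 1)"
    using assms by (cases N) (simp_all add: harm_def inverse_eq_divide atLeastLessThanSuc_atLeastAtMost)
  also have "of_nat N / 3 * (harm (N - 1) + harm (N - 1)) \<le> of_nat N * (1 + ln (of_nat N :: real))"
  proof -
    define H :: real where "H = harm (N - 1)"
    have "H \<le> (harm N :: real)" unfolding H_def by (intro harm_mono) auto
    also have "\<dots> \<le> 1 + ln (real N)" by (rule harm_le[OF assms])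
    finally have "H \<le> 1 + ln (real N)" .
    moreover have "0 \<le> ln (real N)" using assms by simp
    ultimately have "1 / 3 * (H + H) \<le> 1 + ln (real N)" by simp
    hence "of_nat N * (1 / 3 * (H + H)) \<le> of_nat N * (1 + ln (real N))"
      by (intro mult_left_mono) auto
    thus ?thesis by (simp add: H_def)
  qed
  finally show ?thesis .
qed

lemma kernel_sum_dilate:
  assumes "N > 0" "coprime c (int N)"
  shows "(\<Sum>h\<in>residues_below N. 1 / norm (1 - ee (of_int (c * h) / of_nat N))) = kernel_sum N"
proof -
  have "periodic_mod N (\<lambda>h. 1 / norm (1 - ee (of_int h / of_nat N)))"
    unfolding periodic_mod_def using ee_cong assms(1) by metis
  thus ?thesis unfolding kernel_sum_def using sum_residues_mult[OF assms(1) _ assms(2)] by blast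
qed

text \<open>
The values \<open>w k\<close> stand for \<open>|D (\<theta> + k / n)|\<close>, where \<open>D\<close> is the trigonometric polynomial of a sign pattern of
period 4 on a window of length \<open>t\<close>. The last assumption says that two distinct frequencies cannot both be
close to the pole of such a kernel; the factor 4 comes from the period of the signs.
\<close>
locale kernel =
  fixes n :: nat and t :: real and w :: "int \<Rightarrow> real"
  assumes odd_n: "odd n"
    and w_nonneg: "\<And>k. 0 \<le> w k" and w_le: "\<And>k. w k \<le> t"
    and w_repel: "\<And>k k'. w k * w k' * norm (1 - ee (of_int (4 * (k' - k)) / of_nat n)) \<le> 8 * (w k + w k')"
begin

lemma n_pos: "n > 0" using odd_n by (cases n) auto

lemma coprime_4: "coprime 4 (int N)" if "N dvd n" for N
proof -
  have "odd N" using that odd_n by (meson dvd_trans)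
  hence "coprime (2 ^ 2) N" by (subst coprime_power_left_iff) simp
  hence "coprime (int 4) (int N)" by (subst coprime_int_iff) simp
  thus ?thesis by simp
qed

definition W :: real where "W = (\<Sum>k\<in>residues_below n. w k)"

text \<open>
As \<open>n\<close> is odd, it divides \<open>4 * (k' - k)\<close> only if it divides \<open>k' - k\<close>.
\<close>
lemma distance_pos:
  assumes "k \<in> residues_below n" "k' \<in> residues_below n" "k \<noteq> k'"
  shows "norm (1 - ee (of_int (4 * (k' - k)) / of_nat n)) > 0"
proof -
  have "ee (of_int (4 * (k' - k)) / of_nat n) \<noteq> 1"
  proof
    assume "ee (of_int (4 * (k' - k)) / of_nat n) = 1"
    then obtain m where "(of_int (4 * (k' - k)) / of_nat n :: real) = of_int m"
      by (auto simp: ee_eq_1_iff elim: Ints_cases)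
    hence "(of_int (4 * (k' - k)) :: real) = of_int (m * int n)" using n_pos by (simp add: field_simps)
    hence "4 * (k' - k) = m * int n" by (simp only: of_int_eq_iff)
    hence "int n dvd 4 * (k' - k)" by simp
    hence "int n dvd k' - k"
      using coprime_4[of n] coprime_dvd_mult_right_iff[of "int n" 4 "k' - k"] by (simp add: coprime_commute)
    hence "[k' = k] (mod int n)" by (simp add: cong_iff_dvd_diff)
    thus False using cong_less_imp_eq_int[of k' "int n" k] assms by auto
  qed
  thus ?thesis by simp
qed

text \<open>
Compare every frequency with one of maximal weight.
\<close>
lemma W_le: "W \<le> t + 16 * kernel_sum n"
proof -
  \<comment> \<open>a frequency of maximal weight\<close>
  obtain k0 where k0: "k0 \<in> residues_below n" "\<And>k. k \<in> residues_below n \<Longrightarrow> w k \<le> w k0"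
  proof -
    have "finite (w ` residues_below n)" "w ` residues_below n \<noteq> {}" using n_pos by auto
    from Max_in[OF this] Max_ge[OF this(1)] show ?thesis using that by (metis (no_types, lifting) imageE imageI)
  qed
  have each: "w k \<le> (if k = k0 then w k0 else 0) + 16 * (1 / norm (1 - ee (of_int (4 * (k - k0)) / of_nat n)))"
    if k: "k \<in> residues_below n" for k
  proof (cases "k = k0 \<or> w k0 = 0")
    case True
    hence "w k \<le> (if k = k0 then w k0 else 0)" using k0(2)[OF k] by auto
    moreover have "0 \<le> 16 * (1 / norm (1 - ee (of_int (4 * (k - k0)) / of_nat n)))" by simp
    ultimately show ?thesis by linarith
  next
    case False
    hence pos: "w k0 > 0" using w_nonneg[of k0] by simp
    let ?d = "norm (1 - ee (of_int (4 * (k - k0)) / of_nat n))"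
    have d: "?d > 0" using distance_pos[OF k0(1) k] False by auto
    have "w k0 * (w k * ?d) \<le> 8 * (w k0 + w k)" using w_repel[of k0 k] by (simp add: mult_ac)
    also have "\<dots> \<le> w k0 * 16" using k0(2)[OF k] by simp
    finally have "w k * ?d \<le> 16" using pos by simp
    thus ?thesis using False d by (simp add: field_simps)
  qed
  have "W \<le> (\<Sum>k\<in>residues_below n. (if k = k0 then w k0 else 0) + 16 * (1 / norm (1 - ee (of_int (4 * (k - k0)) / of_nat n))))"
    unfolding W_def by (intro sum_mono each)
  also have "\<dots> = w k0 + 16 * (\<Sum>k\<in>residues_below n. 1 / norm (1 - ee (of_int (4 * (k + (- k0))) / of_nat n)))"
    using k0(1) by (simp add: sum.distrib sum_distrib_left)
  also have "(\<Sum>k\<in>residues_below n. 1 / norm (1 - ee (of_int (4 * (k + (- k0))) / of_nat n)))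
     = (\<Sum>k\<in>residues_below n. 1 / norm (1 - ee (of_int (4 * k) / of_nat n)))"
  proof (rule sum_residues_shift[OF n_pos])
    show "periodic_mod n (\<lambda>k. 1 / norm (1 - ee (of_int (4 * k) / of_nat n)))"
      unfolding periodic_mod_def using periodic_modD[OF periodic_ee[OF n_pos, of 4]] by metis
  qed
  also have "\<dots> = kernel_sum n" by (rule kernel_sum_dilate[OF n_pos coprime_4]) simp
  finally show ?thesis using w_le[of k0] by linarith
qed

lemma sum_multiples:
  assumes "D dvd n"
  shows "(\<Sum>h\<in>residues_below n. of_bool (int D dvd h) * g h) = (\<Sum>h\<in>residues_below (n div D). (g (int D * h) :: real))"
proof -
  obtain N where n: "n = D * N" using assms by blast
  have D: "D > 0" using n n_pos by (cases D) auto
  have "(\<Sum>h\<in>residues_below n. of_bool (int D dvd h) * g h) = (\<Sum>h\<in>{h \<in> residues_below n. int D dvd h}. g h)"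
    by (simp add: sum.inter_filter[symmetric] of_bool_def if_distrib[of "\<lambda>x. x * _"] cong: if_cong)
  also have "\<dots> = (\<Sum>h\<in>residues_below N. g (int D * h))"
    using D by (intro sum.reindex_bij_witness[of _ "\<lambda>h. int D * h" "\<lambda>h. h div int D"])
      (auto simp: n zero_le_mult_iff mult_less_cancel_left_pos elim!: dvdE)
  finally show ?thesis using D by (simp add: n)
qed

text \<open>
The product of two weights is at most their sum divided by the distance of the frequencies. Since the frequencies differ by a
multiple of \<open>D\<close>, the inverse distances form the kernel sum for \<open>n / D\<close>, which is smaller than that for \<open>n\<close> by a factor
of about \<open>D\<close>.
\<close>
lemma close_pairs:
  assumes D: "D dvd n"
  shows "(\<Sum>k\<in>residues_below n. \<Sum>k'\<in>residues_below n. of_bool ([k = k'] (mod int D) \<and> k \<noteq> k') * (w k * w k'))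
    \<le> 16 * W * kernel_sum (n div D)"
proof -
  let ?R = "residues_below n"
  define \<sigma> where "\<sigma> h = 1 / norm (1 - ee (of_int (4 * h) / of_nat n))" for h
  have per\<sigma>: "periodic_mod n \<sigma>"
    unfolding periodic_mod_def \<sigma>_def using periodic_modD[OF periodic_ee[OF n_pos, of 4]] by metis
  have \<sigma>0: "\<sigma> h \<ge> 0" for h by (simp add: \<sigma>_def)
  have \<sigma>_uminus: "\<sigma> (- h) = \<sigma> h" for h
    using norm_one_minus_ee_uminus[of "of_int (4 * h) / of_nat n"] by (simp add: \<sigma>_def)
  obtain N where n: "n = D * N" using D by blast
  have D0: "D > 0" and N0: "N > 0" using n n_pos by (auto intro: Nat.gr0I)
  have row: "(\<Sum>k'\<in>?R. of_bool ([k = k'] (mod int D)) * \<sigma> (k' - k)) = kernel_sum (n div D)" for k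
  proof -
    have per: "periodic_mod n (\<lambda>h. of_bool (int D dvd h) * \<sigma> h)"
      unfolding periodic_mod_def
    proof (intro allI impI)
      fix i j assume ij: "[i = j] (mod int n)"
      hence "[i = j] (mod int D)" using D cong_dvd_modulus int_dvd_int_iff by blast
      thus "of_bool (int D dvd i) * \<sigma> i = of_bool (int D dvd j) * \<sigma> j"
        using periodic_modD[OF per\<sigma> ij] cong_dvd_iff[of i j "int D"] by simp
    qed
    have "(\<Sum>k'\<in>?R. of_bool ([k = k'] (mod int D)) * \<sigma> (k' - k)) = (\<Sum>k'\<in>?R. of_bool (int D dvd k' + (- k)) * \<sigma> (k' + (- k)))"
      by (intro sum.cong refl) (simp add: cong_iff_dvd_diff dvd_diff_commute)
    also have "\<dots> = (\<Sum>h\<in>?R. of_bool (int D dvd h) * \<sigma> h)" by (rule sum_residues_shift[OF n_pos per])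
    also have "\<dots> = (\<Sum>h\<in>residues_below (n div D). \<sigma> (int D * h))" by (rule sum_multiples[OF D])
    also have "\<dots> = (\<Sum>h\<in>residues_below N. 1 / norm (1 - ee (of_int (4 * h) / of_nat N)))"
      using D0 N0 by (simp add: n \<sigma>_def)
    also have "\<dots> = kernel_sum N" by (rule kernel_sum_dilate[OF N0 coprime_4]) (simp add: n)
    finally show ?thesis using D0 by (simp add: n)
  qed
  have "(\<Sum>k\<in>?R. \<Sum>k'\<in>?R. of_bool ([k = k'] (mod int D) \<and> k \<noteq> k') * (w k * w k'))
     \<le> (\<Sum>k\<in>?R. \<Sum>k'\<in>?R. 8 * w k * (of_bool ([k = k'] (mod int D)) * \<sigma> (k' - k))
         + 8 * w k' * (of_bool ([k' = k] (mod int D)) * \<sigma> (k - k')))"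
  proof (intro sum_mono)
    fix k k' assume k: "k \<in> ?R" "k' \<in> ?R"
    show "of_bool ([k = k'] (mod int D) \<and> k \<noteq> k') * (w k * w k') \<le>
       8 * w k * (of_bool ([k = k'] (mod int D)) * \<sigma> (k' - k)) + 8 * w k' * (of_bool ([k' = k] (mod int D)) * \<sigma> (k - k'))"
    proof (cases "[k = k'] (mod int D) \<and> k \<noteq> k'")
      case True
      have "\<sigma> (k - k') = \<sigma> (k' - k)" using \<sigma>_uminus[of "k' - k"] by simp
      moreover have "w k * w k' \<le> 8 * (w k + w k') * \<sigma> (k' - k)"
        using w_repel[of k k'] distance_pos[of k k'] k True by (simp add: \<sigma>_def field_simps)
      ultimately show ?thesis using True by (simp add: cong_sym_eq algebra_simps)
    next
      case False
      hence "of_bool ([k = k'] (mod int D) \<and> k \<noteq> k') * (w k * w k') = 0" by simp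
      also have "0 \<le> 8 * w k * (of_bool ([k = k'] (mod int D)) * \<sigma> (k' - k)) + 8 * w k' * (of_bool ([k' = k] (mod int D)) * \<sigma> (k - k'))"
        using w_nonneg \<sigma>0 by (intro add_nonneg_nonneg mult_nonneg_nonneg) auto
      finally show ?thesis .
    qed
  qed
  also have "\<dots> = (\<Sum>k\<in>?R. 8 * w k * (\<Sum>k'\<in>?R. of_bool ([k = k'] (mod int D)) * \<sigma> (k' - k)))
      + (\<Sum>k'\<in>?R. 8 * w k' * (\<Sum>k\<in>?R. of_bool ([k' = k] (mod int D)) * \<sigma> (k - k')))"
    unfolding sum.distrib sum_distrib_left
    by (intro arg_cong2[of _ _ _ _ "(+)"] refl) (rule sum.swap)
  also have "\<dots> = 16 * W * kernel_sum (n div D)"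
    unfolding row W_def sum_distrib_left[symmetric] sum_distrib_right[symmetric] by simp
  finally show ?thesis .
qed

end

section \<open>Additive quadruples in a window\<close>

abbreviation window :: "nat \<Rightarrow> int set" where "window s \<equiv> {- int s..int s}"

lemma card_multiples_window:
  assumes "n > 0"
  shows "(\<Sum>v\<in>window m. of_bool (int n dvd v)) \<le> 2 * real m / real n + 1"
proof -
  let ?A = "{v \<in> window m. int n dvd v}"
  have "card ?A \<le> card {- int (m div n)..int (m div n)}"
  proof (rule card_inj_on_le)
    show "inj_on (\<lambda>v. v div int n) ?A" by (rule inj_onI) (use assms in \<open>auto elim!: dvdE\<close>)
    show "(\<lambda>v. v div int n) ` ?A \<subseteq> {- int (m div n)..int (m div n)}"
    proof safe
      fix v assume v: "v \<in> window m" "int n dvd v"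
      obtain q where q: "v = int n * q" using v by blast
      have "\<bar>int n * q\<bar> \<le> int m" using q v by auto
      hence "\<bar>q\<bar> * int n \<le> int m" by (simp add: abs_mult mult.commute)
      hence "\<bar>q\<bar> * int n div int n \<le> int m div int n" using assms by (intro zdiv_mono1) auto
      hence "\<bar>q\<bar> \<le> int (m div n)" using assms by (simp add: zdiv_int)
      thus "v div int n \<in> {- int (m div n)..int (m div n)}" using assms by (auto simp: q)
    qed
  qed simp
  hence "real (card ?A) \<le> 2 * real (m div n) + 1" by simp
  also have "\<dots> \<le> 2 * (real m / real n) + 1" using of_nat_div_le_of_nat[of m n, where ?'a = real] by simp
  finally show ?thesis by (simp add: sum_of_bool_eq Int_def)
qed

text \<open>
These are the terms that survive in the mean of a product of two trigonometric polynomials on the window and the conjugates of two more.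
\<close>
definition quads :: "nat \<Rightarrow> (int \<Rightarrow> int \<Rightarrow> int \<Rightarrow> int \<Rightarrow> 'b) \<Rightarrow> 'b::comm_semiring_1" where
  "quads s F = sum4 (window s) (\<lambda>i j k l. of_bool (i + j = k + l) * F i j k l)"

definition diff_corr :: "nat \<Rightarrow> (int \<Rightarrow> real) \<Rightarrow> int \<Rightarrow> real" where
  "diff_corr s f v = (\<Sum>i\<in>window s. \<Sum>j\<in>window s. of_bool (i - j = v) * (f i * f j))"

definition sum_corr :: "nat \<Rightarrow> (int \<Rightarrow> real) \<Rightarrow> int \<Rightarrow> real" where
  "sum_corr s f v = (\<Sum>i\<in>window s. \<Sum>j\<in>window s. of_bool (i + j = v) * (f i * f j))"

lemma sum_square_gather:
  fixes g h :: "'a \<Rightarrow> 'a \<Rightarrow> real"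
  shows "(\<Sum>i\<in>A. \<Sum>j\<in>A. g i j) * (\<Sum>i\<in>A. \<Sum>j\<in>A. h i j) = (\<Sum>i\<in>A. \<Sum>j\<in>A. \<Sum>k\<in>A. \<Sum>l\<in>A. g i j * h k l)"
proof -
  have A: "(\<Sum>i\<in>A. \<Sum>j\<in>A. g i j) * x = (\<Sum>i\<in>A. \<Sum>j\<in>A. g i j * x)" for x
    by (simp only: sum_distrib_right)
  show ?thesis by (subst A) (simp only: sum_distrib_left)
qed

text \<open>
Group the quadruples by \<open>v = i - k = l - j\<close>.
\<close>
lemma quads_diff_corr:
  "quads s (\<lambda>i j k l. \<phi> (i - k) * (f i * f j * f k * f l)) = (\<Sum>v\<in>window (2 * s). \<phi> v * (diff_corr s f v)\<^sup>2)"
proof -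
  let ?J = "window s"
  have "(\<Sum>v\<in>window (2 * s). \<phi> v * (diff_corr s f v)\<^sup>2)
    = (\<Sum>v\<in>window (2 * s). \<Sum>i\<in>?J. \<Sum>k\<in>?J. \<Sum>l\<in>?J. \<Sum>j\<in>?J.
        \<phi> v * ((of_bool (i - k = v) * (f i * f k)) * (of_bool (l - j = v) * (f l * f j))))"
    unfolding power2_eq_square diff_corr_def sum_square_gather by (simp only: sum_distrib_left)
  also have "\<dots> = (\<Sum>v\<in>window (2 * s). sum4 ?J (\<lambda>i k l j.
        \<phi> v * ((of_bool (i - k = v) * (f i * f k)) * (of_bool (l - j = v) * (f l * f j)))))"
    by (simp only: sum4_def)
  also have "\<dots> = sum4 ?J (\<lambda>i k l j. \<Sum>v\<in>window (2 * s). \<phi> v * ((of_bool (i - k = v) * (f i * f k)) * (of_bool (l - j = v) * (f l * f j))))"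
    by (rule sum4_sum_swap[symmetric])
  also have "\<dots> = sum4 ?J (\<lambda>i k l j. of_bool (i + j = k + l) * (\<phi> (i - k) * (f i * f j * f k * f l)))"
  proof (rule sum4_cong)
    fix i k l j assume "i \<in> ?J" "k \<in> ?J" "l \<in> ?J" "j \<in> ?J"
    hence mem: "i - k \<in> window (2 * s)" by auto
    have "(\<Sum>v\<in>window (2 * s). \<phi> v * ((of_bool (i - k = v) * (f i * f k)) * (of_bool (l - j = v) * (f l * f j))))
       = (\<Sum>v\<in>window (2 * s). of_bool (i - k = v) * (\<phi> v * (f i * f k) * (of_bool (l - j = v) * (f l * f j))))"
      by (intro sum.cong refl) (simp only: mult_ac)
    also have "\<dots> = \<phi> (i - k) * (f i * f k) * (of_bool (l - j = i - k) * (f l * f j))"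
      by (rule sum_delta_of_bool) (use mem in auto)
    also have "of_bool (l - j = i - k) = (of_bool (i + j = k + l) :: real)" by (intro arg_cong[of _ _ of_bool]) auto
    finally show "(\<Sum>v\<in>window (2 * s). \<phi> v * ((of_bool (i - k = v) * (f i * f k)) * (of_bool (l - j = v) * (f l * f j))))
       = of_bool (i + j = k + l) * (\<phi> (i - k) * (f i * f j * f k * f l))" by (simp only: mult_ac)
  qed
  also have "\<dots> = sum4 ?J (\<lambda>i j k l. of_bool (i + j = k + l) * (\<phi> (i - k) * (f i * f j * f k * f l)))"
  proof -
    have "(\<Sum>k\<in>?J. \<Sum>l\<in>?J. \<Sum>j\<in>?J. G k l j) = (\<Sum>j\<in>?J. \<Sum>k\<in>?J. \<Sum>l\<in>?J. G k l j)" for G :: "int \<Rightarrow> int \<Rightarrow> int \<Rightarrow> real"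
    proof -
      have "(\<Sum>l\<in>?J. \<Sum>j\<in>?J. G k l j) = (\<Sum>j\<in>?J. \<Sum>l\<in>?J. G k l j)" for k by (rule sum.swap)
      thus ?thesis by (simp only:) (rule sum.swap)
    qed
    thus ?thesis unfolding sum4_def by (rule sum.cong[OF refl])
  qed
  finally show ?thesis by (simp only: quads_def)
qed

text \<open>
Group the quadruples by \<open>v = i + j = k + l\<close>.
\<close>
lemma quads_sum_corr:
  "quads s (\<lambda>i j k l. \<phi> (i + j) * (f i * f j * f k * f l)) = (\<Sum>v\<in>window (2 * s). \<phi> v * (sum_corr s f v)\<^sup>2)"
proof -
  let ?J = "window s"
  have "(\<Sum>v\<in>window (2 * s). \<phi> v * (sum_corr s f v)\<^sup>2)
    = (\<Sum>v\<in>window (2 * s). \<Sum>i\<in>?J. \<Sum>j\<in>?J. \<Sum>k\<in>?J. \<Sum>l\<in>?J.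
        \<phi> v * ((of_bool (i + j = v) * (f i * f j)) * (of_bool (k + l = v) * (f k * f l))))"
    unfolding power2_eq_square sum_corr_def sum_square_gather by (simp only: sum_distrib_left)
  also have "\<dots> = (\<Sum>v\<in>window (2 * s). sum4 ?J (\<lambda>i j k l.
        \<phi> v * ((of_bool (i + j = v) * (f i * f j)) * (of_bool (k + l = v) * (f k * f l)))))"
    by (simp only: sum4_def)
  also have "\<dots> = sum4 ?J (\<lambda>i j k l. \<Sum>v\<in>window (2 * s). \<phi> v * ((of_bool (i + j = v) * (f i * f j)) * (of_bool (k + l = v) * (f k * f l))))"
    by (rule sum4_sum_swap[symmetric])
  also have "\<dots> = sum4 ?J (\<lambda>i j k l. of_bool (i + j = k + l) * (\<phi> (i + j) * (f i * f j * f k * f l)))"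
  proof (rule sum4_cong)
    fix i j k l assume "i \<in> ?J" "j \<in> ?J" "k \<in> ?J" "l \<in> ?J"
    hence mem: "i + j \<in> window (2 * s)" by auto
    have "(\<Sum>v\<in>window (2 * s). \<phi> v * ((of_bool (i + j = v) * (f i * f j)) * (of_bool (k + l = v) * (f k * f l))))
       = (\<Sum>v\<in>window (2 * s). of_bool (i + j = v) * (\<phi> v * (f i * f j) * (of_bool (k + l = v) * (f k * f l))))"
      by (intro sum.cong refl) (simp only: mult_ac)
    also have "\<dots> = \<phi> (i + j) * (f i * f j) * (of_bool (k + l = i + j) * (f k * f l))"
      by (rule sum_delta_of_bool) (use mem in auto)
    also have "of_bool (k + l = i + j) = (of_bool (i + j = k + l) :: real)" by (intro arg_cong[of _ _ of_bool]) auto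
    finally show "(\<Sum>v\<in>window (2 * s). \<phi> v * ((of_bool (i + j = v) * (f i * f j)) * (of_bool (k + l = v) * (f k * f l))))
       = of_bool (i + j = k + l) * (\<phi> (i + j) * (f i * f j * f k * f l))" by (simp only: mult_ac)
  qed
  finally show ?thesis by (simp only: quads_def)
qed

definition trig :: "nat \<Rightarrow> (int \<Rightarrow> complex) \<Rightarrow> real \<Rightarrow> complex" where
  "trig s f \<theta> = (\<Sum>j\<in>window s. f j * ee (of_int j * \<theta>))"

text \<open>
The mean over the \<open>M\<close>-th roots of unity detects \<open>i + j = k + l\<close>, because \<open>|i + j - k - l| \<le> 4 * s < M\<close>.
\<close>
lemma quads_mean:
  assumes M: "M > 4 * s"
  shows "of_nat M * quads s (\<lambda>i j k l. f1 i * f2 j * cnj (f3 k) * cnj (f4 l))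
    = (\<Sum>m\<in>residues_below M. trig s f1 (of_int m / of_nat M) * trig s f2 (of_int m / of_nat M)
        * cnj (trig s f3 (of_int m / of_nat M)) * cnj (trig s f4 (of_int m / of_nat M)))"
proof -
  let ?J = "window s"
  have "trig s f1 (of_int m / of_nat M) * trig s f2 (of_int m / of_nat M)
        * cnj (trig s f3 (of_int m / of_nat M)) * cnj (trig s f4 (of_int m / of_nat M))
     = sum4 ?J (\<lambda>i j k l. f1 i * f2 j * cnj (f3 k) * cnj (f4 l) * ee (of_int ((i + j - k - l) * m) / of_nat M))" for m
  proof -
    have "cnj (trig s g \<theta>) = (\<Sum>j\<in>?J. cnj (g j) * ee (- (of_int j * \<theta>)))" for g \<theta>
      by (simp add: trig_def cnj_ee)
    hence "trig s f1 (of_int m / of_nat M) * trig s f2 (of_int m / of_nat M)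
        * cnj (trig s f3 (of_int m / of_nat M)) * cnj (trig s f4 (of_int m / of_nat M))
      = sum4 ?J (\<lambda>i j k l. (f1 i * ee (of_int i * (of_int m / of_nat M))) * (f2 j * ee (of_int j * (of_int m / of_nat M)))
         * (cnj (f3 k) * ee (- (of_int k * (of_int m / of_nat M)))) * (cnj (f4 l) * ee (- (of_int l * (of_int m / of_nat M)))))"
      by (simp only: trig_def sum4_prod)
    also have "\<dots> = sum4 ?J (\<lambda>i j k l. f1 i * f2 j * cnj (f3 k) * cnj (f4 l) * ee (of_int ((i + j - k - l) * m) / of_nat M))"
    proof (rule sum4_cong)
      fix i j k l
      have "ee (of_int ((i + j - k - l) * m) / of_nat M) = ee (of_int i * (of_int m / of_nat M)) * ee (of_int j * (of_int m / of_nat M))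
        * ee (- (of_int k * (of_int m / of_nat M))) * ee (- (of_int l * (of_int m / of_nat M)))"
        unfolding ee_add[symmetric] by (rule arg_cong[of _ _ ee]) (simp add: field_simps add_divide_distrib diff_divide_distrib)
      thus "(f1 i * ee (of_int i * (of_int m / of_nat M))) * (f2 j * ee (of_int j * (of_int m / of_nat M)))
         * (cnj (f3 k) * ee (- (of_int k * (of_int m / of_nat M)))) * (cnj (f4 l) * ee (- (of_int l * (of_int m / of_nat M))))
        = f1 i * f2 j * cnj (f3 k) * cnj (f4 l) * ee (of_int ((i + j - k - l) * m) / of_nat M)"
        by (simp only: mult_ac)
    qed
    finally show ?thesis .
  qed
  hence "(\<Sum>m\<in>residues_below M. trig s f1 (of_int m / of_nat M) * trig s f2 (of_int m / of_nat M)
        * cnj (trig s f3 (of_int m / of_nat M)) * cnj (trig s f4 (of_int m / of_nat M)))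
     = (\<Sum>m\<in>residues_below M. sum4 ?J (\<lambda>i j k l. f1 i * f2 j * cnj (f3 k) * cnj (f4 l) * ee (of_int ((i + j - k - l) * m) / of_nat M)))"
    by (simp only:)
  also have "\<dots> = sum4 ?J (\<lambda>i j k l. \<Sum>m\<in>residues_below M. f1 i * f2 j * cnj (f3 k) * cnj (f4 l) * ee (of_int ((i + j - k - l) * m) / of_nat M))"
    by (rule sum4_sum_swap[symmetric])
  also have "\<dots> = sum4 ?J (\<lambda>i j k l. of_nat M * (of_bool (i + j = k + l) * (f1 i * f2 j * cnj (f3 k) * cnj (f4 l))))"
  proof (rule sum4_cong)
    fix i j k l assume mem: "i \<in> ?J" "j \<in> ?J" "k \<in> ?J" "l \<in> ?J"
    have "int M dvd i + j - k - l \<longleftrightarrow> i + j = k + l"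
    proof
      assume dvd: "int M dvd i + j - k - l"
      have "\<bar>i + j - k - l\<bar> < int M" using mem M by auto
      hence "i + j - k - l = 0" using dvd dvd_imp_le_int[of "i + j - k - l" "int M"] by fastforce
      thus "i + j = k + l" by simp
    qed simp
    thus "(\<Sum>m\<in>residues_below M. f1 i * f2 j * cnj (f3 k) * cnj (f4 l) * ee (of_int ((i + j - k - l) * m) / of_nat M))
       = of_nat M * (of_bool (i + j = k + l) * (f1 i * f2 j * cnj (f3 k) * cnj (f4 l)))"
      using M by (simp add: sum_distrib_left[symmetric] sum_ee del: of_int_mult)
  qed
  finally show ?thesis by (simp only: sum4_scale quads_def)
qed

section \<open>Expansion of the fourth moment in frequencies\<close>

lemma quads_cong:
  "(\<And>i j k l. i + j = k + l \<Longrightarrow> F i j k l = G i j k l) \<Longrightarrow> quads s F = quads s G"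
  unfolding quads_def by (intro sum4_cong) auto

lemma quads_scale: "quads s (\<lambda>i j k l. x * F i j k l) = x * quads s F"
  unfolding quads_def sum4_scale[symmetric] by (intro sum4_cong) (simp add: mult_ac)

lemma quads_sum: "quads s (\<lambda>i j k l. \<Sum>m\<in>M. F m i j k l) = (\<Sum>m\<in>M. quads s (F m))"
  unfolding quads_def sum4_sum_swap[symmetric] by (simp only: sum_distrib_left)

lemma quads_of_real: "of_real (quads s F) = quads s (\<lambda>i j k l. of_real (F i j k l))"
  unfolding quads_def sum4_of_real by (intro sum4_cong) simp

lemma sum4_delta13:
  assumes "finite R"
  shows "sum4 R (\<lambda>a b c d. of_bool (a = c \<and> b = d) * F a b c d) = (\<Sum>a\<in>R. \<Sum>b\<in>R. F a b a b :: 'b::comm_semiring_1)"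
proof -
  have "(\<Sum>d\<in>R. of_bool (a = c \<and> b = d) * F a b c d) = of_bool (a = c) * F a b c b" if "b \<in> R" for a b c
    using sum_delta_of_bool[OF assms that, of "\<lambda>d. of_bool (a = c) * F a b c d"] by (simp add: of_bool_conj mult_ac)
  thus ?thesis unfolding sum4_def using sum_delta_of_bool[OF assms] by (intro sum.cong refl) simp
qed

lemma sum4_delta14:
  assumes "finite R"
  shows "sum4 R (\<lambda>a b c d. of_bool (a = d \<and> b = c) * F a b c d) = (\<Sum>a\<in>R. \<Sum>b\<in>R. F a b b a :: 'b::comm_semiring_1)"
proof -
  have "(\<Sum>d\<in>R. of_bool (a = d \<and> b = c) * F a b c d) = of_bool (b = c) * F a b c a" if "a \<in> R" for a b c
    using sum_delta_of_bool[OF assms that, of "\<lambda>d. of_bool (b = c) * F a b c d"] by (simp add: of_bool_conj mult_ac)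
  thus ?thesis unfolding sum4_def using sum_delta_of_bool[OF assms] by (intro sum.cong refl) simp
qed

lemma sum4_delta12:
  assumes "finite R"
  shows "sum4 R (\<lambda>a b c d. of_bool (a = b \<and> c = d) * F a b c d) = (\<Sum>a\<in>R. \<Sum>c\<in>R. F a a c c :: 'b::comm_semiring_1)"
proof -
  have 1: "(\<Sum>d\<in>R. of_bool (a = b \<and> c = d) * F a b c d) = of_bool (a = b) * F a b c c" if "c \<in> R" for a b c
    using sum_delta_of_bool[OF assms that, of "\<lambda>d. of_bool (a = b) * F a b c d"] by (simp add: of_bool_conj mult_ac)
  have "(\<Sum>b\<in>R. \<Sum>c\<in>R. \<Sum>d\<in>R. of_bool (a = b \<and> c = d) * F a b c d) = (\<Sum>c\<in>R. F a a c c)" if "a \<in> R" for a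
  proof -
    have "(\<Sum>b\<in>R. \<Sum>c\<in>R. \<Sum>d\<in>R. of_bool (a = b \<and> c = d) * F a b c d) = (\<Sum>b\<in>R. of_bool (a = b) * (\<Sum>c\<in>R. F a b c c))"
      unfolding sum_distrib_left by (intro sum.cong refl 1)
    also have "\<dots> = (\<Sum>c\<in>R. F a a c c)" by (rule sum_delta_of_bool[OF assms that])
    finally show ?thesis .
  qed
  thus ?thesis unfolding sum4_def by (rule sum.cong[OF refl])
qed

lemma sum4_delta_all:
  assumes "finite R"
  shows "sum4 R (\<lambda>a b c d. of_bool (a = b \<and> b = c \<and> c = d) * F a b c d) = (\<Sum>a\<in>R. F a a a a :: 'b::comm_semiring_1)"
proof -
  have "sum4 R (\<lambda>a b c d. of_bool (a = b \<and> b = c \<and> c = d) * F a b c d)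
     = sum4 R (\<lambda>a b c d. of_bool (a = b \<and> c = d) * (of_bool (b = c) * F a b c d))"
    by (intro sum4_cong) auto
  also have "\<dots> = (\<Sum>a\<in>R. \<Sum>c\<in>R. of_bool (a = c) * F a a c c)" by (rule sum4_delta12[OF assms])
  also have "\<dots> = (\<Sum>a\<in>R. F a a a a)" by (intro sum.cong refl sum_delta_of_bool assms)
  finally show ?thesis .
qed

lemma norm_trig_le:
  assumes "\<And>j. norm (f j) \<le> 1"
  shows "norm (trig s f \<theta>) \<le> 2 * real s + 1"
proof -
  have "norm (trig s f \<theta>) \<le> (\<Sum>j\<in>window s. 1)"
    unfolding trig_def by (intro order.trans[OF norm_sum] sum_mono) (simp add: norm_mult assms)
  thus ?thesis by simp
qed

text \<open>
Multiplication by \<open>ee (4 * \<phi>)\<close> shifts the window by the period of the coefficients, so that all but 4 terms at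
either end cancel.
\<close>
lemma norm_trig_period_4:
  assumes per: "\<And>j. f (j + 4) = f j" and f1: "\<And>j. norm (f j) \<le> 1"
  shows "norm (trig s f \<phi>) * norm (1 - ee (4 * \<phi>)) \<le> 8"
proof -
  let ?J = "window s" and ?J' = "{- int s + 4..int s + 4}"
  let ?g = "\<lambda>j. f j * ee (of_int j * \<phi>)"
  have "ee (4 * \<phi>) * trig s f \<phi> = (\<Sum>j\<in>?J. ?g (j + 4))"
    unfolding trig_def sum_distrib_left
    by (intro sum.cong refl) (simp add: per ee_add[symmetric] algebra_simps)
  also have "\<dots> = sum ?g ?J'"
    by (rule sum.reindex_bij_witness[of _ "\<lambda>j. j - 4" "\<lambda>j. j + 4"]) auto
  finally have "trig s f \<phi> * (1 - ee (4 * \<phi>)) = sum ?g ?J - sum ?g ?J'"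
    by (simp add: trig_def algebra_simps)
  also have "\<dots> = sum ?g (?J - ?J') - sum ?g (?J' - ?J)"
    using sum.Int_Diff[of ?J ?g ?J'] sum.Int_Diff[of ?J' ?g ?J] by (simp add: Int_commute)
  finally have eq: "trig s f \<phi> * (1 - ee (4 * \<phi>)) = sum ?g (?J - ?J') - sum ?g (?J' - ?J)" .
  have le: "norm (sum ?g B) \<le> real (card B)" for B
    using sum_norm_bound[of B ?g 1] f1 by (simp add: norm_mult)
  have "card (?J - ?J') \<le> card {- int s..<- int s + 4}" by (intro card_mono) auto
  moreover have "card (?J' - ?J) \<le> card {int s<..int s + 4}" by (intro card_mono) auto
  ultimately have c: "card (?J - ?J') \<le> 4" "card (?J' - ?J) \<le> 4" by simp_all
  have "norm (trig s f \<phi> * (1 - ee (4 * \<phi>))) \<le> real (card (?J - ?J')) + real (card (?J' - ?J))"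
    unfolding eq by (intro order.trans[OF norm_triangle_ineq4] add_mono le)
  thus ?thesis using c by (simp add: norm_mult)
qed

text \<open>
The contribution of the quadruples of frequencies that agree in pairs, with average 1 for the coefficients. The first
sum arises from two of the three pairings. The quadruples of four equal frequencies belong to
all three, so that they have to be subtracted twice.
\<close>
definition main_term :: "nat \<Rightarrow> nat \<Rightarrow> (int \<Rightarrow> real) \<Rightarrow> real" where
  "main_term n s \<mu> = 2 * (\<Sum>v\<in>window (2 * s). of_bool (int n dvd v) * (diff_corr s \<mu> v)\<^sup>2)
    + (\<Sum>v\<in>window (2 * s). of_bool (int n dvd v) * (sum_corr s \<mu> v)\<^sup>2)
    - 2 / real n * (\<Sum>v\<in>window (2 * s). (diff_corr s \<mu> v)\<^sup>2)"

text \<open>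
The sequence under study is \<open>\<mu> j * x j\<close> on the window, where \<open>x\<close> has period \<open>n\<close> and \<open>y\<close> are its Fourier coefficients,
divided by \<open>sqrt n\<close>.
\<close>
locale fourth_moment =
  fixes n s :: nat and \<mu> x y :: "int \<Rightarrow> real"
  assumes odd_n: "odd n"
    and \<mu>_le: "\<And>j. \<bar>\<mu> j\<bar> \<le> 1" and \<mu>_period: "\<And>j. \<mu> (j + 4) = \<mu> j"
    and periodic_y: "periodic_mod n y"
    and inversion: "\<And>j. of_real (x j) = of_real (1 / sqrt (real n)) *
      (\<Sum>k\<in>residues_below n. of_real (y k) * ee (of_int (j * k) / of_nat n))"
begin

lemma n_pos: "n > 0" using odd_n by (cases n) auto

abbreviation "R \<equiv> residues_below n"

definition t :: real where "t = 2 * real s + 1"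

definition wave :: "int \<Rightarrow> int \<Rightarrow> complex" where
  "wave a j = of_real (\<mu> j) * ee (of_int (j * a) / of_nat n)"

definition I :: "int \<Rightarrow> int \<Rightarrow> int \<Rightarrow> int \<Rightarrow> complex" where
  "I a b c d = quads s (\<lambda>i j k l. wave a i * wave b j * cnj (wave c k) * cnj (wave d l))"

definition S :: "int \<Rightarrow> int \<Rightarrow> int \<Rightarrow> int \<Rightarrow> real" where
  "S a b c d = (\<Sum>h\<in>R. y (h + a) * y (h + b) * y (h + c) * y (h + d)) / real n"

definition Q :: real where
  "Q = quads s (\<lambda>i j k l. (\<mu> i * x i) * (\<mu> j * x j) * (\<mu> k * x k) * (\<mu> l * x l))"

lemma wave_cong: "[a = a'] (mod int n) \<Longrightarrow> wave a j = wave a' j"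
  unfolding wave_def using periodic_modD[OF periodic_ee[OF n_pos], of a a' j] by simp

lemma I_cong:
  assumes "[a = a'] (mod int n)" "[b = b'] (mod int n)" "[c = c'] (mod int n)" "[d = d'] (mod int n)"
  shows "I a b c d = I a' b' c' d'"
  unfolding I_def using wave_cong[OF assms(1)] wave_cong[OF assms(2)] wave_cong[OF assms(3)] wave_cong[OF assms(4)]
  by simp

lemma wave_shift: "wave (a + h) j = wave a j * ee (of_int j * (of_int h / of_nat n))"
  by (simp add: wave_def ee_add[symmetric] add_divide_distrib algebra_simps)

lemma cnj_wave: "cnj (wave a j) = of_real (\<mu> j) * ee (- (of_int (j * a) / of_nat n))"
  by (simp add: wave_def cnj_ee)

text \<open>
The phases cancel because of \<open>i + j = k + l\<close>.
\<close>
lemma I_shift: "I (a + h) (b + h) (c + h) (d + h) = I a b c d"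
  unfolding I_def
proof (rule quads_cong)
  fix i j k l :: int assume e: "i + j = k + l"
  define u :: real where "u = of_int h / of_nat n"
  have "ee (of_int i * u) * ee (of_int j * u) * ee (- (of_int k * u)) * ee (- (of_int l * u)) = ee (of_int (i + j - k - l) * u)"
    unfolding ee_add[symmetric] by (rule arg_cong[of _ _ ee]) (simp add: algebra_simps)
  also have "\<dots> = 1" using e by simp
  finally have ph: "ee (of_int i * u) * ee (of_int j * u) * ee (- (of_int k * u)) * ee (- (of_int l * u)) = 1" .
  have "wave (a + h) i * wave (b + h) j * cnj (wave (c + h) k) * cnj (wave (d + h) l)
     = wave a i * wave b j * cnj (wave c k) * cnj (wave d l)
       * (ee (of_int i * u) * ee (of_int j * u) * ee (- (of_int k * u)) * ee (- (of_int l * u)))"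
    by (simp only: wave_shift u_def complex_cnj_mult cnj_ee mult_ac)
  thus "wave (a + h) i * wave (b + h) j * cnj (wave (c + h) k) * cnj (wave (d + h) l)
     = wave a i * wave b j * cnj (wave c k) * cnj (wave d l)" by (simp only: ph mult_1_right)
qed

definition M :: nat where "M = 4 * s + 1"

definition D :: "int \<Rightarrow> int \<Rightarrow> complex" where
  "D m a = trig s (wave a) (of_int m / of_nat M)"

lemma I_mean: "of_nat M * I a b c d = (\<Sum>m\<in>residues_below M. D m a * D m b * cnj (D m c) * cnj (D m d))"
  unfolding I_def D_def by (rule quads_mean) (simp add: M_def)

lemma M_pos: "M > 0" by (simp add: M_def)

lemma I_swap: "I a b d c = I a b c d"
proof -
  have "of_nat M * I a b d c = of_nat M * I a b c d" unfolding I_mean by (simp only: mult_ac)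
  thus ?thesis using M_pos by simp
qed

lemma Q_expand: "of_nat n ^ 2 * of_real Q = sum4 R (\<lambda>a b c d. of_real (y a * y b * y c * y d) * I a b c d)"
proof -
  define r where "r = complex_of_real (1 / sqrt (real n)) ^ 4"
  have four: "(u * a) * (u * b) * (u * c) * (u * d) = u ^ 4 * (a * b * c * d)" for u a b c d :: complex
    by (simp add: power4_eq_xxxx mult_ac)
  have B: "of_real (\<mu> j * x j) = of_real (1 / sqrt (real n)) * (\<Sum>k\<in>R. of_real (y k) * wave k j)" for j
    by (simp add: inversion wave_def sum_distrib_left mult_ac)
  have Bc: "of_real (\<mu> j * x j) = of_real (1 / sqrt (real n)) * (\<Sum>k\<in>R. of_real (y k) * cnj (wave k j))" for j
    using arg_cong[OF B[of j], of cnj] by simp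
  have "of_real Q = quads s (\<lambda>i j k l. of_real (\<mu> i * x i) * of_real (\<mu> j * x j) * of_real (\<mu> k * x k) * (of_real (\<mu> l * x l) :: complex))"
    by (simp only: Q_def quads_of_real of_real_mult)
  also have "\<dots> = quads s (\<lambda>i j k l. r * ((\<Sum>a\<in>R. of_real (y a) * wave a i) * (\<Sum>b\<in>R. of_real (y b) * wave b j)
      * (\<Sum>c\<in>R. of_real (y c) * cnj (wave c k)) * (\<Sum>d\<in>R. of_real (y d) * cnj (wave d l))))"
  proof (rule quads_cong)
    fix i j k l
    show "of_real (\<mu> i * x i) * of_real (\<mu> j * x j) * of_real (\<mu> k * x k) * (of_real (\<mu> l * x l) :: complex)
      = r * ((\<Sum>a\<in>R. of_real (y a) * wave a i) * (\<Sum>b\<in>R. of_real (y b) * wave b j)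
      * (\<Sum>c\<in>R. of_real (y c) * cnj (wave c k)) * (\<Sum>d\<in>R. of_real (y d) * cnj (wave d l)))"
      unfolding B[of i] B[of j] Bc[of k] Bc[of l] r_def by (rule four)
  qed
  also have "\<dots> = r * quads s (\<lambda>i j k l. sum4 R (\<lambda>a b c d. (of_real (y a) * wave a i) * (of_real (y b) * wave b j)
      * (of_real (y c) * cnj (wave c k)) * (of_real (y d) * cnj (wave d l))))"
    by (simp only: quads_scale sum4_prod)
  also have "quads s (\<lambda>i j k l. sum4 R (\<lambda>a b c d. (of_real (y a) * wave a i) * (of_real (y b) * wave b j)
      * (of_real (y c) * cnj (wave c k)) * (of_real (y d) * cnj (wave d l))))
    = sum4 R (\<lambda>a b c d. quads s (\<lambda>i j k l. of_real (y a * y b * y c * y d) * (wave a i * wave b j * cnj (wave c k) * cnj (wave d l))))"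
    unfolding quads_def sum4_scale[symmetric]
    by (subst sum4_swap) (intro sum4_cong, simp add: mult_ac)
  also have "\<dots> = sum4 R (\<lambda>a b c d. of_real (y a * y b * y c * y d) * I a b c d)"
    by (simp only: quads_scale I_def)
  finally have "of_nat n ^ 2 * of_real Q = (of_nat n ^ 2 * r) * sum4 R (\<lambda>a b c d. of_real (y a * y b * y c * y d) * I a b c d)"
    by simp
  moreover have "of_nat n ^ 2 * r = 1"
  proof -
    have "(1 / sqrt (real n)) ^ 4 = 1 / real n ^ 2" by (simp add: power4_eq_xxxx power2_eq_square)
    hence "r = of_real (1 / real n ^ 2)" by (simp only: r_def of_real_power[symmetric])
    thus ?thesis using n_pos by simp
  qed
  ultimately show ?thesis by simp
qed

text \<open>
Since \<open>I\<close> is invariant under a common translation of the frequencies, the product of the four coefficients may be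
replaced by its average over all translations.
\<close>
lemma Q_eq: "of_nat n ^ 2 * of_real Q = sum4 R (\<lambda>a b c d. of_real (S a b c d) * I a b c d)"
proof -
  define Y where "Y a b c d = complex_of_real (y a * y b * y c * y d)" for a b c d
  have Y_cong: "Y a b c d = Y a' b' c' d'"
    if "[a = a'] (mod int n)" "[b = b'] (mod int n)" "[c = c'] (mod int n)" "[d = d'] (mod int n)" for a b c d a' b' c' d'
    using that periodic_modD[OF periodic_y] unfolding Y_def by metis
  have "of_nat n * sum4 R (\<lambda>a b c d. Y a b c d * I a b c d) = (\<Sum>h\<in>R. sum4 R (\<lambda>a b c d. Y a b c d * I a b c d))"
    by simp
  also have "\<dots> = (\<Sum>h\<in>R. sum4 R (\<lambda>a b c d. Y (a + h) (b + h) (c + h) (d + h) * I (a + h) (b + h) (c + h) (d + h)))"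
    by (intro sum.cong refl sum4_shift[symmetric] n_pos arg_cong2[of _ _ _ _ "(*)"] Y_cong I_cong)
  also have "\<dots> = (\<Sum>h\<in>R. sum4 R (\<lambda>a b c d. Y (a + h) (b + h) (c + h) (d + h) * I a b c d))"
    by (simp only: I_shift)
  also have "\<dots> = sum4 R (\<lambda>a b c d. \<Sum>h\<in>R. Y (a + h) (b + h) (c + h) (d + h) * I a b c d)"
    by (rule sum4_sum_swap[symmetric])
  also have "\<dots> = sum4 R (\<lambda>a b c d. of_nat n * (of_real (S a b c d) * I a b c d))"
  proof (rule sum4_cong)
    fix a b c d
    have "(\<Sum>h\<in>R. Y (a + h) (b + h) (c + h) (d + h)) = of_real (\<Sum>h\<in>R. y (h + a) * y (h + b) * y (h + c) * y (h + d))"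
      unfolding Y_def of_real_sum by (simp only: add.commute)
    also have "(\<Sum>h\<in>R. y (h + a) * y (h + b) * y (h + c) * y (h + d)) = real n * S a b c d"
      using n_pos by (simp add: S_def)
    finally show "(\<Sum>h\<in>R. Y (a + h) (b + h) (c + h) (d + h) * I a b c d) = of_nat n * (of_real (S a b c d) * I a b c d)"
      by (simp add: sum_distrib_right[symmetric])
  qed
  finally have "sum4 R (\<lambda>a b c d. Y a b c d * I a b c d) = sum4 R (\<lambda>a b c d. of_real (S a b c d) * I a b c d)"
    using n_pos by (simp add: sum4_scale)
  thus ?thesis unfolding Q_expand Y_def .
qed

lemma sum_wave_diff: "(\<Sum>a\<in>R. wave a i * cnj (wave a k)) = of_real (\<mu> i * \<mu> k * real n * of_bool (int n dvd i - k))"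
proof -
  have e: "ee (of_int ((i - k) * a) / of_nat n) = ee (of_int (i * a) / of_nat n) * ee (- (of_int (k * a) / of_nat n))" for a
    unfolding ee_add[symmetric] by (rule arg_cong[of _ _ ee]) (simp add: left_diff_distrib diff_divide_distrib)
  have "(\<Sum>a\<in>R. wave a i * cnj (wave a k)) = of_real (\<mu> i * \<mu> k) * (\<Sum>a\<in>R. ee (of_int ((i - k) * a) / of_nat n))"
    unfolding sum_distrib_left cnj_wave e by (intro sum.cong refl) (simp only: wave_def of_real_mult mult_ac)
  thus ?thesis unfolding sum_ee[OF n_pos] by simp
qed

lemma sum_wave_sum: "(\<Sum>a\<in>R. wave a i * wave a k) = of_real (\<mu> i * \<mu> k * real n * of_bool (int n dvd i + k))"
proof -
  have e: "ee (of_int ((i + k) * a) / of_nat n) = ee (of_int (i * a) / of_nat n) * ee (of_int (k * a) / of_nat n)" for a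
    unfolding ee_add[symmetric] by (rule arg_cong[of _ _ ee]) (simp add: distrib_right add_divide_distrib)
  have "(\<Sum>a\<in>R. wave a i * wave a k) = of_real (\<mu> i * \<mu> k) * (\<Sum>a\<in>R. ee (of_int ((i + k) * a) / of_nat n))"
    unfolding sum_distrib_left e by (intro sum.cong refl) (simp only: wave_def of_real_mult mult_ac)
  thus ?thesis unfolding sum_ee[OF n_pos] by simp
qed

lemma sum_cnj_wave_sum: "(\<Sum>a\<in>R. cnj (wave a i) * cnj (wave a k)) = of_real (\<mu> i * \<mu> k * real n * of_bool (int n dvd i + k))"
  using arg_cong[OF sum_wave_sum[of i k], of cnj] by simp

text \<open>
Summation over \<open>a\<close> leaves the quadruples in which \<open>n\<close> divides \<open>i - k\<close>. Then \<open>n\<close> divides \<open>j - l\<close> as well, and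
summation over \<open>b\<close> gives another factor \<open>n\<close>.
\<close>
lemma sum_I_diff:
  "(\<Sum>a\<in>R. \<Sum>b\<in>R. I a b a b) = of_real (real n ^ 2 * (\<Sum>v\<in>window (2 * s). of_bool (int n dvd v) * (diff_corr s \<mu> v)\<^sup>2))"
proof -
  have "(\<Sum>a\<in>R. \<Sum>b\<in>R. I a b a b) = quads s (\<lambda>i j k l. \<Sum>a\<in>R. \<Sum>b\<in>R. wave a i * wave b j * cnj (wave a k) * cnj (wave b l))"
    unfolding I_def quads_sum ..
  also have "\<dots> = quads s (\<lambda>i j k l. of_real (real n ^ 2 * (of_bool (int n dvd (i - k)) * (\<mu> i * \<mu> j * \<mu> k * \<mu> l))))"
  proof (rule quads_cong)
    fix i j k l :: int assume e: "i + j = k + l"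
    have "(\<Sum>a\<in>R. \<Sum>b\<in>R. wave a i * wave b j * cnj (wave a k) * cnj (wave b l))
       = (\<Sum>a\<in>R. wave a i * cnj (wave a k)) * (\<Sum>b\<in>R. wave b j * cnj (wave b l))"
      unfolding sum_product by (intro sum.cong refl) (simp only: mult_ac)
    moreover have "int n dvd j - l \<longleftrightarrow> int n dvd i - k"
      using e by (metis add_diff_cancel_left' diff_add_eq diff_diff_eq2 dvd_diff_commute eq_diff_eq)
    ultimately show "(\<Sum>a\<in>R. \<Sum>b\<in>R. wave a i * wave b j * cnj (wave a k) * cnj (wave b l))
       = of_real (real n ^ 2 * (of_bool (int n dvd (i - k)) * (\<mu> i * \<mu> j * \<mu> k * \<mu> l)))"
      by (simp add: sum_wave_diff power2_eq_square)
  qed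
  also have "\<dots> = of_real (real n ^ 2 * quads s (\<lambda>i j k l. of_bool (int n dvd (i - k)) * (\<mu> i * \<mu> j * \<mu> k * \<mu> l)))"
    by (simp only: quads_of_real[symmetric] quads_scale)
  also have "quads s (\<lambda>i j k l. of_bool (int n dvd (i - k)) * (\<mu> i * \<mu> j * \<mu> k * \<mu> l))
     = (\<Sum>v\<in>window (2 * s). of_bool (int n dvd v) * (diff_corr s \<mu> v)\<^sup>2)" by (rule quads_diff_corr)
  finally show ?thesis .
qed

lemma sum_I_sum:
  "(\<Sum>a\<in>R. \<Sum>b\<in>R. I a a b b) = of_real (real n ^ 2 * (\<Sum>v\<in>window (2 * s). of_bool (int n dvd v) * (sum_corr s \<mu> v)\<^sup>2))"
proof -
  have "(\<Sum>a\<in>R. \<Sum>b\<in>R. I a a b b) = quads s (\<lambda>i j k l. \<Sum>a\<in>R. \<Sum>b\<in>R. wave a i * wave a j * cnj (wave b k) * cnj (wave b l))"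
    unfolding I_def quads_sum ..
  also have "\<dots> = quads s (\<lambda>i j k l. of_real (real n ^ 2 * (of_bool (int n dvd (i + j)) * (\<mu> i * \<mu> j * \<mu> k * \<mu> l))))"
  proof (rule quads_cong)
    fix i j k l :: int assume e: "i + j = k + l"
    have "(\<Sum>a\<in>R. \<Sum>b\<in>R. wave a i * wave a j * cnj (wave b k) * cnj (wave b l))
       = (\<Sum>a\<in>R. wave a i * wave a j) * (\<Sum>b\<in>R. cnj (wave b k) * cnj (wave b l))"
      unfolding sum_product by (intro sum.cong refl) (simp only: mult_ac)
    thus "(\<Sum>a\<in>R. \<Sum>b\<in>R. wave a i * wave a j * cnj (wave b k) * cnj (wave b l))
       = of_real (real n ^ 2 * (of_bool (int n dvd (i + j)) * (\<mu> i * \<mu> j * \<mu> k * \<mu> l)))"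
      by (simp add: sum_wave_sum sum_cnj_wave_sum power2_eq_square e)
  qed
  also have "\<dots> = of_real (real n ^ 2 * quads s (\<lambda>i j k l. of_bool (int n dvd (i + j)) * (\<mu> i * \<mu> j * \<mu> k * \<mu> l)))"
    by (simp only: quads_of_real[symmetric] quads_scale)
  also have "quads s (\<lambda>i j k l. of_bool (int n dvd (i + j)) * (\<mu> i * \<mu> j * \<mu> k * \<mu> l))
     = (\<Sum>v\<in>window (2 * s). of_bool (int n dvd v) * (sum_corr s \<mu> v)\<^sup>2)" by (rule quads_sum_corr)
  finally show ?thesis .
qed

lemma sum_I_all: "(\<Sum>a\<in>R. I a a a a) = of_real (real n * (\<Sum>v\<in>window (2 * s). (diff_corr s \<mu> v)\<^sup>2))"
proof -
  have "I a a a a = I 0 0 0 0" for a using I_shift[of 0 a 0 0 0] by simp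
  hence "(\<Sum>a\<in>R. I a a a a) = (\<Sum>a\<in>R. I 0 0 0 0)" by (intro sum.cong refl)
  hence "(\<Sum>a\<in>R. I a a a a) = of_nat n * I 0 0 0 0" by simp
  also have "I 0 0 0 0 = of_real (quads s (\<lambda>i j k l. 1 * (\<mu> i * \<mu> j * \<mu> k * \<mu> l)))"
    unfolding I_def quads_of_real by (rule quads_cong) (simp add: wave_def)
  also have "quads s (\<lambda>i j k l. 1 * (\<mu> i * \<mu> j * \<mu> k * \<mu> l)) = (\<Sum>v\<in>window (2 * s). 1 * (diff_corr s \<mu> v)\<^sup>2)"
    by (rule quads_diff_corr[where \<phi> = "\<lambda>_. 1"])
  finally show ?thesis by simp
qed

definition matched :: "int \<Rightarrow> int \<Rightarrow> int \<Rightarrow> int \<Rightarrow> bool" where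
  "matched a b c d \<longleftrightarrow> (a = c \<and> b = d) \<or> (a = d \<and> b = c) \<or> (a = b \<and> c = d)"

text \<open>
Two of the three pairings hold at the same time only if all four frequencies are equal.
\<close>
lemma of_bool_matched:
  "(of_bool (matched a b c d) :: complex) = of_bool (a = c \<and> b = d) + of_bool (a = d \<and> b = c) + of_bool (a = b \<and> c = d)
     - 2 * of_bool (a = b \<and> b = c \<and> c = d)"
  unfolding matched_def
  by (cases "a = c"; cases "b = d"; cases "a = d"; cases "b = c"; cases "a = b"; cases "c = d"; simp)

lemma matched_sum: "sum4 R (\<lambda>a b c d. of_bool (matched a b c d) * I a b c d) = of_nat n ^ 2 * of_real (main_term n s \<mu>)"
proof -
  have "sum4 R (\<lambda>a b c d. of_bool (matched a b c d) * I a b c d)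
     = sum4 R (\<lambda>a b c d. of_bool (a = c \<and> b = d) * I a b c d) + sum4 R (\<lambda>a b c d. of_bool (a = d \<and> b = c) * I a b c d)
       + sum4 R (\<lambda>a b c d. of_bool (a = b \<and> c = d) * I a b c d)
       - 2 * sum4 R (\<lambda>a b c d. of_bool (a = b \<and> b = c \<and> c = d) * I a b c d)"
    unfolding sum4_scale[symmetric] sum4_add[symmetric] sum4_diff[symmetric] of_bool_matched
    by (intro sum4_cong) (simp only: ring_distribs mult.assoc)
  also have "\<dots> = (\<Sum>a\<in>R. \<Sum>b\<in>R. I a b a b) + (\<Sum>a\<in>R. \<Sum>b\<in>R. I a b b a) + (\<Sum>a\<in>R. \<Sum>c\<in>R. I a a c c) - 2 * (\<Sum>a\<in>R. I a a a a)"
    by (simp only: sum4_delta13[OF finite_atLeastLessThan_int] sum4_delta14[OF finite_atLeastLessThan_int]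
        sum4_delta12[OF finite_atLeastLessThan_int] sum4_delta_all[OF finite_atLeastLessThan_int])
  also have "(\<Sum>a\<in>R. \<Sum>b\<in>R. I a b b a) = (\<Sum>a\<in>R. \<Sum>b\<in>R. I a b a b)" by (simp only: I_swap)
  finally have eq: "sum4 R (\<lambda>a b c d. of_bool (matched a b c d) * I a b c d)
     = (\<Sum>a\<in>R. \<Sum>b\<in>R. I a b a b) + (\<Sum>a\<in>R. \<Sum>b\<in>R. I a b a b) + (\<Sum>a\<in>R. \<Sum>c\<in>R. I a a c c) - 2 * (\<Sum>a\<in>R. I a a a a)" .
  have key: "of_real (n2 * X) + of_real (n2 * X) + of_real (n2 * Y) - 2 * of_real (m * Z)
     = (of_real (n2 * (2 * X + Y - 2 / m * Z)) :: complex)" if "n2 = m ^ 2" "m > 0" for n2 m X Y Z :: real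
  proof -
    have "n2 * (2 * X + Y - 2 / m * Z) = n2 * X + n2 * X + n2 * Y - 2 * (m * Z)"
      using that by (simp add: power2_eq_square field_simps)
    thus ?thesis by (simp only: of_real_add of_real_diff of_real_mult of_real_numeral)
  qed
  have n2: "of_nat n ^ 2 = (of_real (real n ^ 2) :: complex)" by simp
  show ?thesis
    unfolding eq sum_I_diff sum_I_sum sum_I_all main_term_def n2 of_real_mult[symmetric]
    by (rule key[OF refl]) (use n_pos in simp)
qed

end

section \<open>Unmatched frequencies\<close>

lemma sum4_swap12: "sum4 A F = sum4 A (\<lambda>a b c d. F b a c d)"
  unfolding sum4_def by (rule sum.swap)

lemma sum4_swap23: "sum4 A F = sum4 A (\<lambda>a b c d. F a c b d)"
  unfolding sum4_def by (rule sum.cong[OF refl]) (rule sum.swap)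

lemma sum4_swap34: "sum4 A F = sum4 A (\<lambda>a b c d. F a b d c)"
  unfolding sum4_def by (rule sum.cong[OF refl], rule sum.cong[OF refl]) (rule sum.swap)

lemma of_bool_disj3_le: "of_bool (A \<or> B \<or> C) \<le> of_bool A + of_bool B + (of_bool C :: real)"
  by (cases A; cases B; cases C; simp)

text \<open>
A weight on two of the four positions leaves a free sum in the other two, whatever the positions are.
\<close>
lemma sum4_pair:
  fixes w :: "'a \<Rightarrow> real" and g :: "'a \<Rightarrow> 'a \<Rightarrow> real"
  assumes X: "X = (\<Sum>a\<in>A. \<Sum>b\<in>A. g a b * (w a * w b)) * (sum w A)\<^sup>2"
  shows "sum4 A (\<lambda>a b c d. g a b * (w a * w b * w c * w d)) = X"
    and "sum4 A (\<lambda>a b c d. g a c * (w a * w b * w c * w d)) = X"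
    and "sum4 A (\<lambda>a b c d. g a d * (w a * w b * w c * w d)) = X"
    and "sum4 A (\<lambda>a b c d. g b c * (w a * w b * w c * w d)) = X"
    and "sum4 A (\<lambda>a b c d. g b d * (w a * w b * w c * w d)) = X"
    and "sum4 A (\<lambda>a b c d. g c d * (w a * w b * w c * w d)) = X"
proof -
  have "X = (\<Sum>a\<in>A. \<Sum>b\<in>A. g a b * (w a * w b)) * (\<Sum>c\<in>A. \<Sum>d\<in>A. w c * w d)"
    unfolding X power2_eq_square by (simp only: sum_product)
  also have "\<dots> = (\<Sum>a\<in>A. \<Sum>b\<in>A. \<Sum>c\<in>A. \<Sum>d\<in>A. (g a b * (w a * w b)) * (w c * w d))"
    by (rule sum_square_gather)
  also have "\<dots> = sum4 A (\<lambda>a b c d. g a b * (w a * w b * w c * w d))"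
    unfolding sum4_def by (simp only: mult.assoc)
  finally show 12: "sum4 A (\<lambda>a b c d. g a b * (w a * w b * w c * w d)) = X" ..
  show 13: "sum4 A (\<lambda>a b c d. g a c * (w a * w b * w c * w d)) = X"
    unfolding 12[symmetric] by (subst sum4_swap23) (simp only: mult_ac)
  show 14: "sum4 A (\<lambda>a b c d. g a d * (w a * w b * w c * w d)) = X"
    unfolding 13[symmetric] by (subst sum4_swap34) (simp only: mult_ac)
  show 23: "sum4 A (\<lambda>a b c d. g b c * (w a * w b * w c * w d)) = X"
    unfolding 13[symmetric] by (subst sum4_swap12) (simp only: mult_ac)
  show 24: "sum4 A (\<lambda>a b c d. g b d * (w a * w b * w c * w d)) = X"
    unfolding 14[symmetric] by (subst sum4_swap12) (simp only: mult_ac)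
  show "sum4 A (\<lambda>a b c d. g c d * (w a * w b * w c * w d)) = X"
    unfolding 24[symmetric] by (subst sum4_swap23) (simp only: mult_ac)
qed

context kernel
begin

text \<open>
If the frequencies are paired modulo \<open>D\<close> without being equal in pairs, then one of the pairs consists of
two distinct numbers. There are 6 possible positions for this pair; the other two frequencies are summed freely.
\<close>
lemma sum4_close_unmatched:
  assumes D: "D dvd n"
  shows "sum4 (residues_below n) (\<lambda>a b c d.
      of_bool ((paired D a c b d \<or> paired D a d b c \<or> paired D a b c d) \<and>
        \<not> ((a = c \<and> b = d) \<or> (a = d \<and> b = c) \<or> (a = b \<and> c = d))) * (w a * w b * w c * w d))
    \<le> 96 * kernel_sum (n div D) * W ^ 3"
proof -
  let ?R = "residues_below n"
  define g :: "int \<Rightarrow> int \<Rightarrow> real" where "g a b = of_bool ([a = b] (mod int D) \<and> a \<noteq> b)" for a b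
  define X where "X = (\<Sum>a\<in>?R. \<Sum>b\<in>?R. g a b * (w a * w b)) * (sum w ?R)\<^sup>2"
  note X = sum4_pair[OF X_def]
  have "sum4 ?R (\<lambda>a b c d.
      of_bool ((paired D a c b d \<or> paired D a d b c \<or> paired D a b c d) \<and>
        \<not> ((a = c \<and> b = d) \<or> (a = d \<and> b = c) \<or> (a = b \<and> c = d))) * (w a * w b * w c * w d))
    \<le> sum4 ?R (\<lambda>a b c d. g a c * (w a * w b * w c * w d) + g b d * (w a * w b * w c * w d)
      + g a d * (w a * w b * w c * w d) + g b c * (w a * w b * w c * w d)
      + g a b * (w a * w b * w c * w d) + g c d * (w a * w b * w c * w d))"
    unfolding distrib_right[symmetric]
    by (intro sum4_mono mult_right_mono mult_nonneg_nonneg w_nonneg) (auto simp: paired_def g_def)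
  also have "\<dots> = 6 * X" by (simp only: sum4_add X)
  also have "X \<le> (16 * W * kernel_sum (n div D)) * W\<^sup>2"
    unfolding X_def g_def W_def[symmetric]
    by (intro mult_right_mono close_pairs[OF D]) simp
  finally show ?thesis by (simp add: power2_eq_square power3_eq_cube mult_ac)
qed

end

context fourth_moment
begin

lemma norm_wave: "norm (wave a j) \<le> 1"
  using \<mu>_le[of j] by (simp add: wave_def norm_mult)

lemma D_as_translate: "D m a = trig s (\<lambda>j. of_real (\<mu> j)) (of_int m / of_nat M + of_int a / of_nat n)"
  unfolding D_def trig_def
  by (intro sum.cong refl) (simp add: wave_def ee_add[symmetric] distrib_left mult_ac add.commute)

text \<open>
The distance of two frequencies is at most the sum of their distances from the pole, and the product of a weight and its distance
from the pole is at most 8.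
\<close>
lemma kernel_D: "kernel n t (\<lambda>a. norm (D m a))"
proof
  show "odd n" by (rule odd_n)
  show "norm (D m a) \<le> t" for a
    unfolding D_def t_def by (rule norm_trig_le) (rule norm_wave)
  fix a b
  define \<phi> :: "int \<Rightarrow> real" where "\<phi> k = of_int m / of_nat M + of_int k / of_nat n" for k
  define u where "u k = norm (1 - ee (4 * \<phi> k))" for k
  have u: "norm (D m k) * u k \<le> 8" for k
    unfolding D_as_translate u_def \<phi>_def by (rule norm_trig_period_4) (use \<mu>_le \<mu>_period in auto)
  have "ee (4 * \<phi> a) * ee (of_int (4 * (b - a)) / of_nat n) = ee (4 * \<phi> b)"
    unfolding ee_add[symmetric] by (rule arg_cong[of _ _ ee]) (simp add: \<phi>_def distrib_left right_diff_distrib diff_divide_distrib)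
  hence "ee (4 * \<phi> a) * (1 - ee (of_int (4 * (b - a)) / of_nat n)) = (1 - ee (4 * \<phi> b)) - (1 - ee (4 * \<phi> a))"
    by (simp add: right_diff_distrib)
  hence "norm (1 - ee (of_int (4 * (b - a)) / of_nat n)) \<le> u b + u a"
    using norm_triangle_ineq4[of "1 - ee (4 * \<phi> b)" "1 - ee (4 * \<phi> a)"] norm_mult[of "ee (4 * \<phi> a)"]
    unfolding u_def by (metis mult_1 norm_ee)
  hence "norm (D m a) * norm (D m b) * norm (1 - ee (of_int (4 * (b - a)) / of_nat n)) \<le> norm (D m a) * norm (D m b) * (u b + u a)"
    by (intro mult_left_mono) auto
  also have "\<dots> = norm (D m a) * (norm (D m b) * u b) + norm (D m b) * (norm (D m a) * u a)"
    by (simp add: algebra_simps)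
  also have "\<dots> \<le> norm (D m a) * 8 + norm (D m b) * 8"
    by (intro add_mono mult_left_mono u) auto
  finally show "norm (D m a) * norm (D m b) * norm (1 - ee (of_int (4 * (b - a)) / of_nat n)) \<le> 8 * (norm (D m a) + norm (D m b))"
    by simp
qed simp

lemma card_congruent_window:
  "real n * (\<Sum>j\<in>window s. of_bool (int n dvd i - j)) \<le> 2 * t + real n" if i: "i \<in> window s"
proof -
  have "(\<Sum>j\<in>window s. of_bool (int n dvd i - j)) = (\<Sum>v\<in>(\<lambda>j. i - j) ` window s. of_bool (int n dvd v) :: real)"
    by (subst sum.reindex) (auto simp: inj_on_def)
  also have "\<dots> \<le> (\<Sum>v\<in>window (2 * s). of_bool (int n dvd v))"
    by (rule sum_mono2) (use i in auto)
  also have "\<dots> \<le> 2 * real (2 * s) / real n + 1"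
    by (rule card_multiples_window[OF n_pos])
  finally have "real n * (\<Sum>j\<in>window s. of_bool (int n dvd i - j)) \<le> real n * (2 * real (2 * s) / real n + 1)"
    by (rule mult_left_mono) simp
  also have "\<dots> \<le> 2 * t + real n" using n_pos by (simp add: t_def field_simps)
  finally show ?thesis .
qed

text \<open>
By orthogonality only the pairs of indices of the window that are congruent modulo \<open>n\<close> contribute.
\<close>
lemma sum_norm_D_square: "(\<Sum>a\<in>R. (norm (D m a))\<^sup>2) \<le> t * (2 * t + real n)"
proof -
  let ?J = "window s" and ?\<theta> = "of_int m / of_nat M :: real"
  have sq: "of_real ((norm (D m a))\<^sup>2) = (\<Sum>i\<in>?J. \<Sum>j\<in>?J. (ee (of_int i * ?\<theta>) * ee (- (of_int j * ?\<theta>))) * (wave a i * cnj (wave a j)))" for a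
    unfolding complex_norm_square D_def trig_def cnj_sum sum_product
    by (intro sum.cong refl) (simp add: cnj_ee mult_ac)
  have "of_real (\<Sum>a\<in>R. (norm (D m a))\<^sup>2) = (\<Sum>i\<in>?J. \<Sum>j\<in>?J. \<Sum>a\<in>R. (ee (of_int i * ?\<theta>) * ee (- (of_int j * ?\<theta>))) * (wave a i * cnj (wave a j)))"
    unfolding of_real_sum sq by (subst sum.swap, rule sum.cong[OF refl]) (rule sum.swap)
  also have "\<dots> = (\<Sum>i\<in>?J. \<Sum>j\<in>?J. (ee (of_int i * ?\<theta>) * ee (- (of_int j * ?\<theta>))) * of_real (\<mu> i * \<mu> j * real n * of_bool (int n dvd i - j)))"
    by (simp only: sum_distrib_left[symmetric] sum_wave_diff)
  also have "norm \<dots> \<le> (\<Sum>i\<in>?J. \<Sum>j\<in>?J. real n * of_bool (int n dvd i - j))"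
  proof (intro order.trans[OF norm_sum] sum_mono)
    fix i j
    have "\<bar>\<mu> i * \<mu> j\<bar> \<le> 1" unfolding abs_mult by (intro mult_le_one \<mu>_le) auto
    hence "\<bar>\<mu> i * \<mu> j\<bar> * (real n * of_bool (int n dvd i - j)) \<le> 1 * (real n * of_bool (int n dvd i - j))"
      by (intro mult_right_mono) auto
    thus "norm ((ee (of_int i * ?\<theta>) * ee (- (of_int j * ?\<theta>))) * of_real (\<mu> i * \<mu> j * real n * of_bool (int n dvd i - j)))
       \<le> real n * of_bool (int n dvd i - j)"
      by (simp add: norm_mult abs_mult mult_ac)
  qed
  also have "\<dots> \<le> (\<Sum>i\<in>?J. 2 * t + real n)"
    using card_congruent_window by (intro sum_mono) (simp only: sum_distrib_left)
  also have "\<dots> = t * (2 * t + real n)" by (simp add: t_def)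
  finally show ?thesis by (simp add: sum_nonneg del: of_real_sum)
qed

text \<open>
Matched quadruples enter with \<open>S - 1\<close> and unmatched ones with \<open>S\<close>, which either is bounded by \<open>\<eta>\<close>, or is bounded
only by \<open>A\<close> while the frequencies are paired modulo some \<open>D\<close> in \<open>\<D>\<close>.
\<close>
theorem fourth_moment_estimate:
  fixes \<delta> \<eta> A \<kappa> U :: real and \<D> :: "nat set"
  assumes matchedS: "\<And>a b c d. matched a b c d \<Longrightarrow> \<bar>S a b c d - 1\<bar> \<le> \<delta>"
    and unmatchedS: "\<And>a b c d. \<bar>S a b c d\<bar> \<le> \<eta> \<or>
      \<bar>S a b c d\<bar> \<le> A \<and> (\<exists>D\<in>\<D>. paired D a c b d \<or> paired D a d b c \<or> paired D a b c d)"
    and \<D>: "finite \<D>" "\<And>D. D \<in> \<D> \<Longrightarrow> D dvd n" "\<And>D. D \<in> \<D> \<Longrightarrow> kernel_sum (n div D) \<le> \<kappa>"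
    and nonneg: "0 \<le> \<delta>" "0 \<le> \<eta>" "0 \<le> A" "0 \<le> \<kappa>"
    and U: "t + 16 * kernel_sum n \<le> U"
  shows "real n ^ 2 * \<bar>Q - main_term n s \<mu>\<bar> \<le>
    3 * \<delta> * (t * (2 * t + real n))\<^sup>2 + \<eta> * U ^ 4 + real (card \<D>) * A * (96 * \<kappa> * U ^ 3)"
proof -
  define close where "close D a b c d \<longleftrightarrow> (paired D a c b d \<or> paired D a d b c \<or> paired D a b c d) \<and>
        \<not> ((a = c \<and> b = d) \<or> (a = d \<and> b = c) \<or> (a = b \<and> c = d))" for D a b c d
  define G where "G a b c d = \<delta> * of_bool (matched a b c d) + \<eta> + A * (\<Sum>D\<in>\<D>. of_bool (close D a b c d))" for a b c d
  let ?B = "3 * \<delta> * (t * (2 * t + real n))\<^sup>2 + \<eta> * U ^ 4 + real (card \<D>) * A * (96 * \<kappa> * U ^ 3)"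
  have coeff: "\<bar>S a b c d - of_bool (matched a b c d)\<bar> \<le> G a b c d" for a b c d
  proof (cases "matched a b c d")
    case True
    have "0 \<le> A * (\<Sum>D\<in>\<D>. of_bool (close D a b c d))" using nonneg by (intro mult_nonneg_nonneg sum_nonneg) auto
    thus ?thesis using matchedS[OF True] True nonneg unfolding G_def by simp
  next
    case False
    from unmatchedS[of a b c d] show ?thesis
    proof
      assume "\<bar>S a b c d\<bar> \<le> \<eta>"
      moreover have "0 \<le> A * (\<Sum>D\<in>\<D>. of_bool (close D a b c d))" using nonneg by (intro mult_nonneg_nonneg sum_nonneg) auto
      ultimately show ?thesis using False unfolding G_def by simp
    next
      assume "\<bar>S a b c d\<bar> \<le> A \<and> (\<exists>D\<in>\<D>. paired D a c b d \<or> paired D a d b c \<or> paired D a b c d)"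
      then obtain D where le: "\<bar>S a b c d\<bar> \<le> A" and D: "D \<in> \<D>" "close D a b c d"
        using False by (auto simp: close_def matched_def)
      have "of_bool (close D a b c d) \<le> (\<Sum>D\<in>\<D>. of_bool (close D a b c d) :: real)"
        by (rule member_le_sum) (use D \<D> in auto)
      hence "A * 1 \<le> A * (\<Sum>D\<in>\<D>. of_bool (close D a b c d))" using D nonneg by (intro mult_left_mono) auto
      thus ?thesis using False le nonneg unfolding G_def by simp
    qed
  qed
  have G0: "0 \<le> G a b c d" for a b c d using coeff[of a b c d] by linarith
  have each: "sum4 R (\<lambda>a b c d. G a b c d * (norm (D m a) * norm (D m b) * norm (D m c) * norm (D m d))) \<le> ?B" for m
  proof -
    interpret K: kernel n t "\<lambda>a. norm (D m a)" by (rule kernel_D)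
    define w where "w a = norm (D m a)" for a
    have w0: "0 \<le> w a" for a by (simp add: w_def)
    have W: "K.W = sum w R" by (simp add: K.W_def w_def)
    have WU: "sum w R \<le> U" using K.W_le U unfolding W by linarith
    have W0: "0 \<le> sum w R" by (intro sum_nonneg w0)
    have sq: "(\<Sum>a\<in>R. w a * w a) \<le> t * (2 * t + real n)"
      using sum_norm_D_square[of m] by (simp add: w_def power2_eq_square)
    have sq0: "0 \<le> (\<Sum>a\<in>R. w a * w a)" by (intro sum_nonneg) (simp add: w0)
    have m1: "sum4 R (\<lambda>a b c d. of_bool (matched a b c d) * (w a * w b * w c * w d)) \<le> 3 * (t * (2 * t + real n))\<^sup>2"
    proof -
      let ?Y = "(\<Sum>a\<in>R. w a * w a) * (\<Sum>a\<in>R. w a * w a)"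
      have "sum4 R (\<lambda>a b c d. of_bool (matched a b c d) * (w a * w b * w c * w d))
        \<le> sum4 R (\<lambda>a b c d. of_bool (a = c \<and> b = d) * (w a * w b * w c * w d)
           + of_bool (a = d \<and> b = c) * (w a * w b * w c * w d) + of_bool (a = b \<and> c = d) * (w a * w b * w c * w d))"
        unfolding distrib_right[symmetric] matched_def
        by (intro sum4_mono mult_right_mono mult_nonneg_nonneg w0 of_bool_disj3_le)
      also have "\<dots> = (\<Sum>a\<in>R. \<Sum>b\<in>R. w a * w b * w a * w b) + (\<Sum>a\<in>R. \<Sum>b\<in>R. w a * w b * w b * w a)
          + (\<Sum>a\<in>R. \<Sum>c\<in>R. w a * w a * w c * w c)"
        by (simp only: sum4_add sum4_delta13[OF finite_atLeastLessThan_int] sum4_delta14[OF finite_atLeastLessThan_int]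
            sum4_delta12[OF finite_atLeastLessThan_int])
      also have "\<dots> = 3 * ?Y" unfolding sum_product by (simp add: mult_ac)
      also have "?Y \<le> (t * (2 * t + real n))\<^sup>2" unfolding power2_eq_square by (intro mult_mono sq sq0 order.trans[OF sq0 sq])
      finally show ?thesis by simp
    qed
    have m2: "sum4 R (\<lambda>a b c d. w a * w b * w c * w d) \<le> U ^ 4"
      unfolding sum4_prod using power_mono[OF WU W0, of 4] by (simp add: power4_eq_xxxx mult.assoc)
    have m3: "sum4 R (\<lambda>a b c d. of_bool (close E a b c d) * (w a * w b * w c * w d)) \<le> 96 * \<kappa> * U ^ 3" if "E \<in> \<D>" for E
    proof -
      have "sum4 R (\<lambda>a b c d. of_bool (close E a b c d) * (w a * w b * w c * w d)) \<le> 96 * kernel_sum (n div E) * (sum w R) ^ 3"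
        using K.sum4_close_unmatched[OF \<D>(2)[OF that]] unfolding W close_def w_def by simp
      also have "\<dots> \<le> 96 * \<kappa> * U ^ 3"
        using nonneg W0 by (intro mult_mono mult_left_mono \<D>(3)[OF that] power_mono WU) auto
      finally show ?thesis .
    qed
    have "sum4 R (\<lambda>a b c d. G a b c d * (w a * w b * w c * w d))
      = sum4 R (\<lambda>a b c d. \<delta> * (of_bool (matched a b c d) * (w a * w b * w c * w d)) + \<eta> * (w a * w b * w c * w d)
        + A * (\<Sum>E\<in>\<D>. of_bool (close E a b c d) * (w a * w b * w c * w d)))"
      unfolding G_def by (intro sum4_cong) (simp only: distrib_right mult.assoc sum_distrib_right)
    also have "\<dots> = \<delta> * sum4 R (\<lambda>a b c d. of_bool (matched a b c d) * (w a * w b * w c * w d))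
       + \<eta> * sum4 R (\<lambda>a b c d. w a * w b * w c * w d)
       + A * (\<Sum>E\<in>\<D>. sum4 R (\<lambda>a b c d. of_bool (close E a b c d) * (w a * w b * w c * w d)))"
      by (simp only: sum4_add sum4_scale sum4_sum_swap)
    also have "\<dots> \<le> \<delta> * (3 * (t * (2 * t + real n))\<^sup>2) + \<eta> * U ^ 4 + A * (\<Sum>E\<in>\<D>. 96 * \<kappa> * U ^ 3)"
      using nonneg by (intro add_mono mult_left_mono m1 m2 m3 sum_mono) auto
    also have "\<dots> = ?B" by (simp add: algebra_simps)
    finally show ?thesis by (simp only: w_def)
  qed
  have "real n ^ 2 * \<bar>Q - main_term n s \<mu>\<bar> = norm (of_nat n ^ 2 * of_real Q - of_nat n ^ 2 * of_real (main_term n s \<mu>) :: complex)"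
    by (simp add: right_diff_distrib[symmetric] norm_mult norm_power flip: of_real_diff)
  also have "\<dots> = norm (sum4 R (\<lambda>a b c d. of_real (S a b c d - of_bool (matched a b c d)) * I a b c d))"
    unfolding Q_eq matched_sum[symmetric] sum4_diff[symmetric]
    by (rule arg_cong[of _ _ norm], rule sum4_cong) (simp add: left_diff_distrib)
  also have "\<dots> \<le> sum4 R (\<lambda>a b c d. norm (of_real (S a b c d - of_bool (matched a b c d)) * I a b c d))"
    by (rule norm_sum4_le)
  also have "\<dots> \<le> sum4 R (\<lambda>a b c d. G a b c d * norm (I a b c d))"
    by (intro sum4_mono) (simp only: norm_mult norm_of_real mult_right_mono[OF coeff norm_ge_zero])
  finally have le: "real n ^ 2 * \<bar>Q - main_term n s \<mu>\<bar> \<le> sum4 R (\<lambda>a b c d. G a b c d * norm (I a b c d))" .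
  have "real M * (real n ^ 2 * \<bar>Q - main_term n s \<mu>\<bar>) \<le> real M * sum4 R (\<lambda>a b c d. G a b c d * norm (I a b c d))"
    using le by (intro mult_left_mono) auto
  also have "\<dots> = sum4 R (\<lambda>a b c d. G a b c d * norm (of_nat M * I a b c d))"
    unfolding sum4_scale[symmetric] by (intro sum4_cong) (simp add: norm_mult mult_ac)
  also have "\<dots> \<le> sum4 R (\<lambda>a b c d. \<Sum>m\<in>residues_below M. G a b c d * (norm (D m a) * norm (D m b) * norm (D m c) * norm (D m d)))"
  proof (intro sum4_mono)
    fix a b c d
    have "norm (of_nat M * I a b c d) \<le> (\<Sum>m\<in>residues_below M. norm (D m a) * norm (D m b) * norm (D m c) * norm (D m d))"
      unfolding I_mean by (rule order.trans[OF norm_sum]) (simp add: norm_mult)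
    thus "G a b c d * norm (of_nat M * I a b c d)
      \<le> (\<Sum>m\<in>residues_below M. G a b c d * (norm (D m a) * norm (D m b) * norm (D m c) * norm (D m d)))"
      unfolding sum_distrib_left[symmetric] by (intro mult_left_mono G0)
  qed
  also have "\<dots> = (\<Sum>m\<in>residues_below M. sum4 R (\<lambda>a b c d. G a b c d * (norm (D m a) * norm (D m b) * norm (D m c) * norm (D m d))))"
    by (rule sum4_sum_swap)
  also have "\<dots> \<le> (\<Sum>m\<in>residues_below M. ?B)" by (intro sum_mono each)
  also have "\<dots> = real M * ?B" by simp
  finally show ?thesis using M_pos by (simp only: mult_le_cancel_left_pos of_nat_0_less_iff)
qed

end

section \<open>Correlations of sign patterns\<close>

text \<open>
Full periods cancel.
\<close>
lemma period_4_interval_sum: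
  fixes F :: "int \<Rightarrow> real"
  assumes per: "\<And>j. F (j + 4) = F j" and zero: "F 0 + F 1 + F 2 + F 3 = 0" and bnd: "\<And>j. \<bar>F j\<bar> \<le> B"
  shows "\<bar>\<Sum>i<L. F (a + int i)\<bar> \<le> 3 * B"
proof (induction L arbitrary: a rule: less_induct)
  case (less L)
  have B0: "B \<ge> 0" using bnd[of 0] by linarith
  have blk: "F b + F (b + 1) + F (b + 2) + F (b + 3) = 0" for b
  proof (induction b rule: int_induct[where k = 0])
    case base thus ?case using zero by simp
  next
    case (step1 i) thus ?case using per[of i] by (simp add: add.assoc)
  next
    case (step2 i) thus ?case using per[of "i - 1"] by (simp add: algebra_simps)
  qed
  show ?case
  proof (cases "L < 4")
    case True
    hence "\<bar>\<Sum>i<L. F (a + int i)\<bar> \<le> (\<Sum>i<L. B)" by (intro order.trans[OF sum_abs] sum_mono bnd)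
    also have "\<dots> = real L * B" by simp
    also have "\<dots> \<le> 3 * B" using True B0 by (intro mult_right_mono) auto
    finally show ?thesis .
  next
    case False
    then obtain L' where L': "L = L' + 4" by (metis add.commute le_Suc_ex not_less)
    have "(\<Sum>i<L. F (a + int i)) = (\<Sum>i<4. F (a + int i)) + (\<Sum>i<L'. F ((a + 4) + int i))"
      unfolding L' by (induction L') (simp_all add: eval_nat_numeral add_ac)
    also have "(\<Sum>i<4. F (a + int i)) = 0" using blk[of a] by (simp add: eval_nat_numeral)
    finally show ?thesis using less.IH[of L' "a + 4"] L' by simp
  qed
qed

lemma period_4_mean:
  fixes f :: "int \<Rightarrow> real"
  assumes per: "\<And>j. f (j + 4) = f j" and bnd: "\<And>j. \<bar>f j\<bar> \<le> 1" and avg: "f 0 + f 1 + f 2 + f 3 = 4 * \<alpha>"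
  shows "\<bar>(\<Sum>i\<in>{a..<a + int L}. f i) - \<alpha> * real L\<bar> \<le> 6"
proof -
  have "\<bar>\<alpha>\<bar> \<le> 1" using avg bnd[of 0] bnd[of 1] bnd[of 2] bnd[of 3] by linarith
  hence "\<bar>f j - \<alpha>\<bar> \<le> 2" for j using bnd[of j] by linarith
  hence "\<bar>\<Sum>i<L. f (a + int i) - \<alpha>\<bar> \<le> 3 * 2"
    using period_4_interval_sum[of "\<lambda>j. f j - \<alpha>" 2 a L] per avg by simp
  moreover have "(\<Sum>i\<in>{a..<a + int L}. f i) = (\<Sum>i<L. f (a + int i))"
    by (rule sum.reindex_bij_witness[of _ "\<lambda>i. a + int i" "\<lambda>i. nat (i - a)"]) auto
  ultimately show ?thesis by (simp add: sum_subtractf mult.commute)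
qed

lemma window_overlap:
  assumes v: "v \<in> window (2 * s)"
  obtains a where "{i \<in> window s. i - v \<in> window s} = {a..<a + int (2 * s + 1 - nat \<bar>v\<bar>)}"
proof
  show "{i \<in> window s. i - v \<in> window s} = {max (- int s) (v - int s)..<max (- int s) (v - int s) + int (2 * s + 1 - nat \<bar>v\<bar>)}"
    using v by (auto simp: max_def of_nat_diff)
qed

lemma diff_corr_overlap: "diff_corr s f v = (\<Sum>i\<in>{i \<in> window s. i - v \<in> window s}. f i * f (i - v))"
proof -
  have "(\<Sum>j\<in>window s. of_bool (i - j = v) * (f i * f j)) = (if i - v \<in> window s then f i * f (i - v) else 0)" for i
  proof -
    have "(\<Sum>j\<in>window s. of_bool (i - j = v) * (f i * f j)) = (\<Sum>j\<in>window s. if i - v = j then f i * f j else 0)"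
      by (intro sum.cong refl) auto
    thus ?thesis by simp
  qed
  thus ?thesis unfolding diff_corr_def by (simp only: sum.inter_filter[OF finite_atLeastAtMost_int])
qed

lemma sum_corr_overlap: "sum_corr s f v = (\<Sum>i\<in>{i \<in> window s. i - v \<in> window s}. f i * f (v - i))"
proof -
  have "(\<Sum>j\<in>window s. of_bool (i + j = v) * (f i * f j)) = (if i - v \<in> window s then f i * f (v - i) else 0)" for i
  proof -
    have "(\<Sum>j\<in>window s. of_bool (i + j = v) * (f i * f j)) = (\<Sum>j\<in>window s. if v - i = j then f i * f j else 0)"
      by (intro sum.cong refl) auto
    thus ?thesis by auto
  qed
  thus ?thesis unfolding sum_corr_def by (simp only: sum.inter_filter[OF finite_atLeastAtMost_int])
qed

text \<open>
Two kinds of correlations of \<open>\<mu>\<close> matter. The first, of \<open>\<mu> j\<close> with \<open>\<mu> (j - v)\<close>, has mean \<open>\<plusminus> 1\<close> over a period if \<open>v\<close>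
is a multiple of \<open>2 * h\<close>, and mean 0 otherwise; the second, of \<open>\<mu> j\<close> with \<open>\<mu> (v - j)\<close>, has mean \<open>\<plusminus> 1\<close> if \<open>v\<close> is an odd
multiple of \<open>h\<close>, and mean 0 otherwise. By periodicity it is enough to say this for four values of \<open>v\<close>.
\<close>
locale sign_pattern =
  fixes \<mu> :: "int \<Rightarrow> real" and h :: nat
  assumes h: "h = 1 \<or> h = 2"
    and period_4: "\<And>j. \<mu> (j + 4) = \<mu> j" and sign: "\<And>j. \<bar>\<mu> j\<bar> = 1"
    and diff_mean: "\<And>v. v \<in> {0, 1, 2, 3} \<Longrightarrow>
      ((\<mu> 0 * \<mu> (- v) + \<mu> 1 * \<mu> (1 - v) + \<mu> 2 * \<mu> (2 - v) + \<mu> 3 * \<mu> (3 - v)) / 4)\<^sup>2 = of_bool (2 * int h dvd v)"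
    and sum_mean: "\<And>v. v \<in> {0, 1, 2, 3} \<Longrightarrow>
      ((\<mu> 0 * \<mu> v + \<mu> 1 * \<mu> (v - 1) + \<mu> 2 * \<mu> (v - 2) + \<mu> 3 * \<mu> (v - 3)) / 4)\<^sup>2 = of_bool (v mod (2 * int h) = int h)"
begin

lemma sign_mod_4: "[i = j] (mod 4) \<Longrightarrow> \<mu> i = \<mu> j"
proof -
  have m: "\<mu> (j + 4 * int k) = \<mu> j" for j k
  proof (induction k)
    case (Suc k) thus ?case using period_4[of "j + 4 * int k"] by (simp add: algebra_simps)
  qed simp
  assume "[i = j] (mod 4)"
  hence "[j = i] (mod 4)" by (rule cong_sym)
  then obtain q where q: "i = j + 4 * q" by (auto simp: cong_iff_lin)
  show "\<mu> i = \<mu> j"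
  proof (cases "q \<ge> 0")
    case True thus ?thesis using m[of j "nat q"] q by simp
  next
    case False thus ?thesis using m[of i "nat (- q)"] q by simp
  qed
qed

lemma diff_mean_all:
  "((\<mu> 0 * \<mu> (- v) + \<mu> 1 * \<mu> (1 - v) + \<mu> 2 * \<mu> (2 - v) + \<mu> 3 * \<mu> (3 - v)) / 4)\<^sup>2 = of_bool (2 * int h dvd v)"
proof -
  define r where "r = v mod 4"
  have r: "r \<in> {0, 1, 2, 3}" by (simp add: r_def) presburger
  have "\<mu> (k - v) = \<mu> (k - r)" for k by (rule sign_mod_4) (simp add: r_def cong_def mod_simps)
  from this[of 0] this[of 1] this[of 2] this[of 3] diff_mean[OF r]
  have "((\<mu> 0 * \<mu> (- v) + \<mu> 1 * \<mu> (1 - v) + \<mu> 2 * \<mu> (2 - v) + \<mu> 3 * \<mu> (3 - v)) / 4)\<^sup>2 = of_bool (2 * int h dvd r)" by simp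
  also have "2 * int h dvd r \<longleftrightarrow> 2 * int h dvd v" using h unfolding r_def by (elim disjE; simp; presburger)
  finally show ?thesis .
qed

lemma sum_mean_all:
  "((\<mu> 0 * \<mu> v + \<mu> 1 * \<mu> (v - 1) + \<mu> 2 * \<mu> (v - 2) + \<mu> 3 * \<mu> (v - 3)) / 4)\<^sup>2 = of_bool (v mod (2 * int h) = int h)"
proof -
  define r where "r = v mod 4"
  have r: "r \<in> {0, 1, 2, 3}" by (simp add: r_def) presburger
  have "\<mu> (v - k) = \<mu> (r - k)" for k by (rule sign_mod_4) (simp add: r_def cong_def mod_simps)
  from this[of 0] this[of 1] this[of 2] this[of 3] sum_mean[OF r]
  have "((\<mu> 0 * \<mu> v + \<mu> 1 * \<mu> (v - 1) + \<mu> 2 * \<mu> (v - 2) + \<mu> 3 * \<mu> (v - 3)) / 4)\<^sup>2 = of_bool (r mod (2 * int h) = int h)" by simp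
  also have "r mod (2 * int h) = int h \<longleftrightarrow> v mod (2 * int h) = int h" using h unfolding r_def by (elim disjE; simp; presburger)
  finally show ?thesis .
qed

lemma period_4_minus: "\<mu> (j - 4) = \<mu> j" using period_4[of "j - 4"] by simp

lemma square_approx:
  fixes x \<alpha> L t :: real
  assumes "\<bar>x - \<alpha> * L\<bar> \<le> 6" "\<bar>\<alpha>\<bar> \<le> 1" "0 \<le> L" "L \<le> t" "1 \<le> t"
  shows "\<bar>x\<^sup>2 - \<alpha>\<^sup>2 * L\<^sup>2\<bar> \<le> 48 * t"
proof -
  have aL: "\<bar>\<alpha> * L\<bar> \<le> t" using assms mult_mono[of "\<bar>\<alpha>\<bar>" 1 L t] by (simp add: abs_mult)
  have "\<bar>x + \<alpha> * L\<bar> \<le> 8 * t" using aL assms by linarith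
  hence "\<bar>x - \<alpha> * L\<bar> * \<bar>x + \<alpha> * L\<bar> \<le> 6 * (8 * t)" using assms by (intro mult_mono) auto
  thus ?thesis by (simp add: abs_mult[symmetric] power2_eq_square algebra_simps)
qed

lemma overlap_square_approx:
  assumes v: "v \<in> window (2 * s)" and per: "\<And>j. f (j + 4) = f j" and bnd: "\<And>j. \<bar>f j\<bar> \<le> 1"
    and avg: "f 0 + f 1 + f 2 + f 3 = 4 * \<alpha>"
  shows "\<bar>(\<Sum>i\<in>{i \<in> window s. i - v \<in> window s}. f i)\<^sup>2 - \<alpha>\<^sup>2 * (2 * real s + 1 - of_int \<bar>v\<bar>)\<^sup>2\<bar> \<le> 48 * (2 * real s + 1)"
proof -
  obtain a where a: "{i \<in> window s. i - v \<in> window s} = {a..<a + int (2 * s + 1 - nat \<bar>v\<bar>)}"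
    using window_overlap[OF v] .
  have L: "real (2 * s + 1 - nat \<bar>v\<bar>) = 2 * real s + 1 - of_int \<bar>v\<bar>"
  proof -
    have "nat \<bar>v\<bar> \<le> 2 * s + 1" using v by auto
    thus ?thesis by (simp add: of_nat_diff del: of_nat_Suc)
  qed
  have "\<bar>\<alpha>\<bar> \<le> 1" using avg bnd[of 0] bnd[of 1] bnd[of 2] bnd[of 3] by linarith
  moreover have "\<bar>(\<Sum>i\<in>{i \<in> window s. i - v \<in> window s}. f i) - \<alpha> * (2 * real s + 1 - of_int \<bar>v\<bar>)\<bar> \<le> 6"
    unfolding a L[symmetric] by (rule period_4_mean[OF per bnd avg])
  moreover have "\<bar>v\<bar> \<le> 2 * int s" using v by auto
  hence "real_of_int \<bar>v\<bar> \<le> real_of_int (2 * int s)" by (simp only: of_int_le_iff)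
  ultimately show ?thesis by (intro square_approx) auto
qed

lemma diff_corr_square:
  assumes v: "v \<in> window (2 * s)"
  shows "\<bar>(diff_corr s \<mu> v)\<^sup>2 - of_bool (2 * int h dvd v) * (2 * real s + 1 - of_int \<bar>v\<bar>)\<^sup>2\<bar> \<le> 48 * (2 * real s + 1)"
proof -
  define \<alpha> where "\<alpha> = (\<mu> 0 * \<mu> (- v) + \<mu> 1 * \<mu> (1 - v) + \<mu> 2 * \<mu> (2 - v) + \<mu> 3 * \<mu> (3 - v)) / 4"
  have per: "\<mu> (j + 4) * \<mu> (j + 4 - v) = \<mu> j * \<mu> (j - v)" for j
    using period_4[of j] period_4[of "j - v"] by (simp add: algebra_simps)
  have bnd: "\<bar>\<mu> j * \<mu> (j - v)\<bar> \<le> 1" for j by (simp add: abs_mult sign)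
  have avg: "\<mu> 0 * \<mu> (0 - v) + \<mu> 1 * \<mu> (1 - v) + \<mu> 2 * \<mu> (2 - v) + \<mu> 3 * \<mu> (3 - v) = 4 * \<alpha>"
    by (simp add: \<alpha>_def)
  have "\<alpha>\<^sup>2 = of_bool (2 * int h dvd v)" unfolding \<alpha>_def by (rule diff_mean_all)
  with overlap_square_approx[of v s "\<lambda>i. \<mu> i * \<mu> (i - v)", OF v per bnd avg] show ?thesis
    unfolding diff_corr_overlap by simp
qed

lemma sum_corr_square:
  assumes v: "v \<in> window (2 * s)"
  shows "\<bar>(sum_corr s \<mu> v)\<^sup>2 - of_bool (v mod (2 * int h) = int h) * (2 * real s + 1 - of_int \<bar>v\<bar>)\<^sup>2\<bar> \<le> 48 * (2 * real s + 1)"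
proof -
  define \<alpha> where "\<alpha> = (\<mu> 0 * \<mu> v + \<mu> 1 * \<mu> (v - 1) + \<mu> 2 * \<mu> (v - 2) + \<mu> 3 * \<mu> (v - 3)) / 4"
  have per: "\<mu> (j + 4) * \<mu> (v - (j + 4)) = \<mu> j * \<mu> (v - j)" for j
    using period_4[of j] period_4_minus[of "v - j"] by (simp add: algebra_simps)
  have bnd: "\<bar>\<mu> j * \<mu> (v - j)\<bar> \<le> 1" for j by (simp add: abs_mult sign)
  have avg: "\<mu> 0 * \<mu> (v - 0) + \<mu> 1 * \<mu> (v - 1) + \<mu> 2 * \<mu> (v - 2) + \<mu> 3 * \<mu> (v - 3) = 4 * \<alpha>"
    by (simp add: \<alpha>_def)
  have "\<alpha>\<^sup>2 = of_bool (v mod (2 * int h) = int h)" unfolding \<alpha>_def by (rule sum_mean_all)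
  with overlap_square_approx[of v s "\<lambda>i. \<mu> i * \<mu> (v - i)", OF v per bnd avg] show ?thesis
    unfolding sum_corr_overlap by simp
qed

end

text \<open>
The signs of the operation \<open>N\<close>, seen from the index \<open>n\<close>: as \<open>n\<close> is 1 modulo 4, the index \<open>n + j\<close> carries the sign
with number \<open>1 + j\<close>.
\<close>
definition N_sign :: "int \<Rightarrow> real" where
  "N_sign j = (if j mod 4 = 0 \<or> j mod 4 = 3 then 1 else -1)"

text \<open>
The signs of the operation \<open>P\<close>, seen from the index \<open>n\<close>.
\<close>
definition P_sign :: "int \<Rightarrow> real" where
  "P_sign j = (if j mod 4 = 1 then -1 else 1)"

lemma sign_pattern_N: "sign_pattern N_sign 1"
proof
  have vals: "N_sign 0 = 1" "N_sign 1 = -1" "N_sign 2 = -1" "N_sign 3 = 1"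
    "N_sign (-1) = 1" "N_sign (-2) = -1" "N_sign (-3) = -1" by (simp_all add: N_sign_def)
  fix v :: int assume v: "v \<in> {0, 1, 2, 3}"
  show "((N_sign 0 * N_sign (- v) + N_sign 1 * N_sign (1 - v) + N_sign 2 * N_sign (2 - v) + N_sign 3 * N_sign (3 - v)) / 4)\<^sup>2
     = of_bool (2 * int 1 dvd v)"
    using v by (elim insertE emptyE; simp add: vals)
  show "((N_sign 0 * N_sign v + N_sign 1 * N_sign (v - 1) + N_sign 2 * N_sign (v - 2) + N_sign 3 * N_sign (v - 3)) / 4)\<^sup>2
     = of_bool (v mod (2 * int 1) = int 1)"
    using v by (elim insertE emptyE; simp add: vals)
qed (simp_all add: N_sign_def)

lemma sign_pattern_P: "sign_pattern P_sign 2"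
proof
  have vals: "P_sign 0 = 1" "P_sign 1 = -1" "P_sign 2 = 1" "P_sign 3 = 1"
    "P_sign (-1) = 1" "P_sign (-2) = 1" "P_sign (-3) = -1" by (simp_all add: P_sign_def)
  fix v :: int assume v: "v \<in> {0, 1, 2, 3}"
  show "((P_sign 0 * P_sign (- v) + P_sign 1 * P_sign (1 - v) + P_sign 2 * P_sign (2 - v) + P_sign 3 * P_sign (3 - v)) / 4)\<^sup>2
     = of_bool (2 * int 2 dvd v)"
    using v by (elim insertE emptyE; simp add: vals)
  show "((P_sign 0 * P_sign v + P_sign 1 * P_sign (v - 1) + P_sign 2 * P_sign (v - 2) + P_sign 3 * P_sign (v - 3)) / 4)\<^sup>2
     = of_bool (v mod (2 * int 2) = int 2)"
    using v by (elim insertE emptyE; simp add: vals)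
qed (simp_all add: P_sign_def)

section \<open>The limit of the main term\<close>

definition tent :: "real \<Rightarrow> real \<Rightarrow> real" where
  "tent \<tau> x = (max 0 (1 - \<bar>x\<bar> / \<tau>))\<^sup>2"

text \<open>
The progression \<open>g\<close> lists the shifts in question, and its absolute values are those of \<open>x\<close> scaled by \<open>N\<close>. Outside the window
the tent vanishes, so that the range of \<open>l\<close> may be any set that is large enough.
\<close>
lemma sum_progression_tent:
  fixes g :: "int \<Rightarrow> int" and x :: "int \<Rightarrow> real" and N s K :: nat
  defines "t \<equiv> 2 * real s + 1"
  assumes P: "\<And>v. P v \<longleftrightarrow> (\<exists>l. v = g l)" and inj: "inj g" and N: "N > 0"
    and gx: "\<And>l. real_of_int \<bar>g l\<bar> = \<bar>x l\<bar> * real N"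
    and K: "\<And>l. \<bar>x l\<bar> < t / real N \<Longrightarrow> l \<in> {- int K..int K}"
  shows "(\<Sum>v\<in>window (2 * s). of_bool (P v) * (t - of_int \<bar>v\<bar>)\<^sup>2) = t\<^sup>2 * (\<Sum>l\<in>{- int K..int K}. tent (t / real N) (x l))"
proof -
  have t: "t > 0" by (simp add: t_def)
  define L where "L = {l \<in> {- int K..int K}. g l \<in> window (2 * s)}"
  have in_window: "g l \<in> window (2 * s) \<longleftrightarrow> \<bar>x l\<bar> < t / real N" for l
  proof -
    have "g l \<in> window (2 * s) \<longleftrightarrow> \<bar>g l\<bar> < int (2 * s + 1)" by auto
    also have "\<dots> \<longleftrightarrow> real_of_int \<bar>g l\<bar> < real_of_int (int (2 * s + 1))" by (simp only: of_int_less_iff)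
    also have "real_of_int (int (2 * s + 1)) = t" by (simp add: t_def)
    also have "real_of_int \<bar>g l\<bar> < t \<longleftrightarrow> \<bar>x l\<bar> < t / real N" unfolding gx using N by (simp add: pos_less_divide_eq)
    finally show ?thesis .
  qed
  have term_in: "t\<^sup>2 * tent (t / real N) (x l) = (t - of_int \<bar>g l\<bar>)\<^sup>2" if "g l \<in> window (2 * s)" for l
  proof -
    have "\<bar>x l\<bar> * real N < t" using that[unfolded in_window] N by (simp add: pos_less_divide_eq)
    hence "max 0 (1 - \<bar>x l\<bar> / (t / real N)) = (t - of_int \<bar>g l\<bar>) / t"
      unfolding gx using t N by (simp add: max_def field_simps)
    thus ?thesis using t unfolding tent_def by (simp add: power_divide)
  qed
  have term_out: "tent (t / real N) (x l) = 0" if "g l \<notin> window (2 * s)" for l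
  proof -
    have "t / real N \<le> \<bar>x l\<bar>" using that unfolding in_window by simp
    hence "1 - \<bar>x l\<bar> / (t / real N) \<le> 0" using t N by (simp add: field_simps)
    thus ?thesis unfolding tent_def by (simp add: max_def)
  qed
  have img: "{v \<in> window (2 * s). P v} = g ` L"
    using K in_window P by (auto simp: L_def)
  have "(\<Sum>v\<in>window (2 * s). of_bool (P v) * (t - of_int \<bar>v\<bar>)\<^sup>2) = (\<Sum>v\<in>window (2 * s). if P v then (t - of_int \<bar>v\<bar>)\<^sup>2 else 0)"
    by (intro sum.cong refl) auto
  also have "\<dots> = (\<Sum>v\<in>{v \<in> window (2 * s). P v}. (t - of_int \<bar>v\<bar>)\<^sup>2)"
    by (rule sum.inter_filter[symmetric]) simp
  also have "\<dots> = (\<Sum>l\<in>L. (t - of_int \<bar>g l\<bar>)\<^sup>2)"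
    unfolding img by (rule sum.reindex[unfolded o_def]) (use inj in \<open>auto intro: inj_on_subset\<close>)
  also have "\<dots> = (\<Sum>l\<in>L. t\<^sup>2 * tent (t / real N) (x l))"
    by (intro sum.cong refl term_in[symmetric]) (simp add: L_def)
  also have "\<dots> = (\<Sum>l\<in>{- int K..int K}. t\<^sup>2 * tent (t / real N) (x l))"
    by (intro sum.mono_neutral_left) (auto simp: L_def term_out)
  finally show ?thesis by (simp only: sum_distrib_left)
qed

lemma coprime_odd_h:
  assumes "odd n" "h = 1 \<or> h = 2"
  shows "coprime (int n) (2 * int h)"
proof -
  have c: "coprime (int n) 2" using assms by simp
  from assms(2) show ?thesis
  proof
    assume "h = 2"
    hence "2 * int h = 2 ^ 2" by simp
    moreover have "coprime (int n) (2 ^ 2)" using c by (subst coprime_power_right_iff) simp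
    ultimately show ?thesis by (simp only:)
  qed (use c in simp)
qed

lemma multiples_of_both:
  assumes "odd n" "h = 1 \<or> h = 2"
  shows "int n dvd v \<and> 2 * int h dvd v \<longleftrightarrow> (\<exists>l. v = 2 * int h * int n * l)"
proof
  assume "int n dvd v \<and> 2 * int h dvd v"
  hence "int n * (2 * int h) dvd v" by (blast intro: divides_mult coprime_odd_h[OF assms])
  thus "\<exists>l. v = 2 * int h * int n * l" by (auto simp: mult_ac elim!: dvdE)
qed auto

lemma odd_multiples:
  assumes n: "odd n" and h: "h = 1 \<or> h = 2"
  shows "int n dvd v \<and> v mod (2 * int h) = int h \<longleftrightarrow> (\<exists>l. v = int h * int n * (2 * l + 1))"
proof
  assume v: "int n dvd v \<and> v mod (2 * int h) = int h"
  have "v = 2 * int h * (v div (2 * int h)) + int h" using v by (metis mult_div_mod_eq)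
  then obtain k where k: "v = int h * (2 * k + 1)" by (metis distrib_left mult.assoc mult.commute mult.right_neutral)
  have "coprime (int n) (int h)" using coprime_odd_h[OF assms] by simp
  hence "int n dvd 2 * k + 1" using v k by (simp add: coprime_dvd_mult_right_iff)
  then obtain z where z: "2 * k + 1 = int n * z" by blast
  have "odd (int n * z)" unfolding z[symmetric] by simp
  hence "odd z" by simp
  then obtain l where "z = 2 * l + 1" by (elim oddE)
  thus "\<exists>l. v = int h * int n * (2 * l + 1)" using k z by auto
next
  assume "\<exists>l. v = int h * int n * (2 * l + 1)"
  then obtain l where "v = int h * int n * (2 * l + 1)" by blast
  hence v: "v = int h * (int n * (2 * l + 1))" by (simp only: mult.assoc)
  have "int n * (2 * l + 1) mod 2 = 1" using n by (simp add: odd_iff_mod_2_eq_one[symmetric])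
  hence "v mod (2 * int h) = int h" using mult_mod_right[of "int h" "int n * (2 * l + 1)" 2] v by (simp add: mult.commute)
  thus "int n dvd v \<and> v mod (2 * int h) = int h" using v by simp
qed

lemma sum_window_symmetric:
  "(\<Sum>v\<in>window m. F v) = F 0 + (\<Sum>u=1..m. F (int u) + (F (- int u) :: real))"
proof (induction m)
  case (Suc m)
  have "window (Suc m) = insert (int (Suc m)) (insert (- int (Suc m)) (window m))" by auto
  hence "(\<Sum>v\<in>window (Suc m). F v) = F (int (Suc m)) + (F (- int (Suc m)) + (\<Sum>v\<in>window m. F v))" by simp
  thus ?case using Suc.IH by simp
qed simp

lemma sum_squares_progression:
  "(\<Sum>l=1..K. (t - q * real l)\<^sup>2) = real K * t\<^sup>2 - q * t * real K * (real K + 1) + q\<^sup>2 * real K * (real K + 1) * (2 * real K + 1) / 6"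
proof (induction K)
  case (Suc K)
  have "(t - q * (1 + real K))\<^sup>2 + (real K * t\<^sup>2 - q * t * real K * (real K + 1) + q\<^sup>2 * real K * (real K + 1) * (2 * real K + 1) / 6)
    = (1 + real K) * t\<^sup>2 - q * t * (1 + real K) * (1 + real K + 1) + q\<^sup>2 * (1 + real K) * (1 + real K + 1) * (2 * (1 + real K) + 1) / 6"
    by (simp add: power2_eq_square field_simps)
  thus ?case using Suc.IH by (simp add: add.commute)
qed simp

lemma sum_window_multiples:
  assumes q: "q > 0"
  shows "(\<Sum>v\<in>window m. of_bool (int q dvd v) * (t - of_int \<bar>v\<bar>)\<^sup>2) = t\<^sup>2 + 2 * (\<Sum>l=1..m div q. (t - real q * real l)\<^sup>2)"
proof -
  have "(\<Sum>u=1..m. of_bool (int q dvd int u) * (t - real u)\<^sup>2) = (\<Sum>u=1..m. if q dvd u then (t - real u)\<^sup>2 else 0)"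
    by (intro sum.cong refl) auto
  also have "\<dots> = (\<Sum>u\<in>{u \<in> {1..m}. q dvd u}. (t - real u)\<^sup>2)"
    by (rule sum.inter_filter[symmetric]) simp
  also have "\<dots> = (\<Sum>l=1..m div q. (t - real q * real l)\<^sup>2)"
    by (rule sum.reindex_bij_witness[of _ "\<lambda>l. q * l" "\<lambda>u. u div q"])
       (use q in \<open>auto simp: less_eq_div_iff_mult_less_eq mult.commute elim!: dvdE\<close>)
  finally show ?thesis by (subst sum_window_symmetric) (simp add: sum.distrib sum_distrib_left[symmetric])
qed

lemma tendsto_tent:
  assumes "(\<tau> \<longlongrightarrow> T) F" "T > 0"
  shows "((\<lambda>n. tent (\<tau> n) x) \<longlongrightarrow> tent T x) F"
  unfolding tent_def using assms by (intro tendsto_intros) auto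

lemma tendsto_by_error:
  fixes f g e :: "'a \<Rightarrow> real"
  assumes "(g \<longlongrightarrow> L) F" "(e \<longlongrightarrow> 0) F" "eventually (\<lambda>n. \<bar>f n - g n\<bar> \<le> e n) F"
  shows "(f \<longlongrightarrow> L) F"
proof -
  have "((\<lambda>n. f n - g n) \<longlongrightarrow> 0) F"
    by (rule Lim_null_comparison[OF _ assms(2)]) (use assms(3) in simp)
  from tendsto_add[OF this assms(1)] show ?thesis by simp
qed

lemma sum_of_bool_approx:
  fixes x y :: "int \<Rightarrow> real"
  assumes "\<And>v. v \<in> A \<Longrightarrow> \<bar>x v - y v\<bar> \<le> B"
  shows "\<bar>(\<Sum>v\<in>A. of_bool (P v) * x v) - (\<Sum>v\<in>A. of_bool (P v) * y v)\<bar> \<le> B * (\<Sum>v\<in>A. of_bool (P v))"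
proof -
  have "\<bar>(\<Sum>v\<in>A. of_bool (P v) * x v) - (\<Sum>v\<in>A. of_bool (P v) * y v)\<bar> = \<bar>\<Sum>v\<in>A. of_bool (P v) * (x v - y v)\<bar>"
    by (simp add: sum_subtractf right_diff_distrib)
  also have "\<dots> \<le> (\<Sum>v\<in>A. of_bool (P v) * B)"
    using assms by (intro order.trans[OF sum_abs] sum_mono) (auto simp: abs_mult)
  finally show ?thesis by (simp add: sum_distrib_left mult.commute)
qed

text \<open>
Replacing a squared correlation by its mean value costs at most \<open>48 * t\<close> at each of the at most \<open>2 * t / n + 1\<close> multiples of
\<open>n\<close> in the window.
\<close>
lemma corr_multiples:
  fixes c :: "int \<Rightarrow> real" and g :: "int \<Rightarrow> int" and x :: "int \<Rightarrow> real" and n s N K :: nat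
  defines "t \<equiv> 2 * real s + 1"
  assumes square: "\<And>v. v \<in> window (2 * s) \<Longrightarrow> \<bar>(c v)\<^sup>2 - of_bool (R v) * (t - of_int \<bar>v\<bar>)\<^sup>2\<bar> \<le> 48 * t"
    and R: "\<And>v. int n dvd v \<and> R v \<longleftrightarrow> (\<exists>l. v = g l)" and inj: "inj g" and n: "n > 0" and N: "N > 0"
    and gx: "\<And>l. real_of_int \<bar>g l\<bar> = \<bar>x l\<bar> * real N"
    and K: "\<And>l. \<bar>x l\<bar> < t / real N \<Longrightarrow> l \<in> {- int K..int K}"
  shows "\<bar>(\<Sum>v\<in>window (2 * s). of_bool (int n dvd v) * (c v)\<^sup>2) / t\<^sup>2
    - (\<Sum>l\<in>{- int K..int K}. tent (t / real N) (x l))\<bar> \<le> 96 / real n + 48 / t"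
proof -
  have t: "t \<ge> 1" by (simp add: t_def)
  let ?A = "\<Sum>v\<in>window (2 * s). of_bool (int n dvd v) * (c v)\<^sup>2"
  let ?B = "\<Sum>v\<in>window (2 * s). of_bool (int n dvd v) * (of_bool (R v) * (t - of_int \<bar>v\<bar>)\<^sup>2)"
  have "?B = (\<Sum>v\<in>window (2 * s). of_bool (int n dvd v \<and> R v) * (t - of_int \<bar>v\<bar>)\<^sup>2)"
    by (simp only: of_bool_conj mult.assoc)
  also have "\<dots> = t\<^sup>2 * (\<Sum>l\<in>{- int K..int K}. tent (t / real N) (x l))"
    unfolding t_def by (rule sum_progression_tent[OF R inj N gx K[unfolded t_def]])
  finally have B: "?B / t\<^sup>2 = (\<Sum>l\<in>{- int K..int K}. tent (t / real N) (x l))" using t by simp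
  have "\<bar>?A - ?B\<bar> \<le> 48 * t * (\<Sum>v\<in>window (2 * s). of_bool (int n dvd v))"
    by (rule sum_of_bool_approx) (rule square)
  also have "\<dots> \<le> 48 * t * (2 * t / real n + 1)"
  proof (intro mult_left_mono)
    have "(\<Sum>v\<in>window (2 * s). of_bool (int n dvd v)) \<le> 2 * real (2 * s) / real n + 1"
      by (rule card_multiples_window[OF n])
    also have "\<dots> \<le> 2 * t / real n + 1" using n by (simp add: t_def divide_right_mono)
    finally show "(\<Sum>v\<in>window (2 * s). of_bool (int n dvd v)) \<le> 2 * t / real n + 1" .
  qed (use t in simp)
  finally have "\<bar>?A - ?B\<bar> / t\<^sup>2 \<le> 48 * t * (2 * t / real n + 1) / t\<^sup>2" by (intro divide_right_mono) auto
  also have "\<dots> = 96 / real n + 48 / t" using t n by (simp add: power2_eq_square field_simps)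
  also have "\<bar>?A - ?B\<bar> / t\<^sup>2 = \<bar>?A / t\<^sup>2 - ?B / t\<^sup>2\<bar>" by (simp add: diff_divide_distrib[symmetric] abs_divide)
  finally show ?thesis unfolding B .
qed

context sign_pattern
begin

lemma diff_corr_multiples:
  fixes n s K :: nat
  defines "t \<equiv> 2 * real s + 1"
  assumes n: "odd n" and K: "t / (2 * real h * real n) < real K"
  shows "\<bar>(\<Sum>v\<in>window (2 * s). of_bool (int n dvd v) * (diff_corr s \<mu> v)\<^sup>2) / t\<^sup>2
    - (\<Sum>l\<in>{- int K..int K}. tent (t / real (2 * h * n)) (of_int l))\<bar> \<le> 96 / real n + 48 / t"
  unfolding t_def
proof (rule corr_multiples[where g = "\<lambda>l. 2 * int h * int n * l"])
  have n0: "n > 0" using n by (cases n) auto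
  have h0: "h > 0" using h by auto
  show "n > 0" by (rule n0)
  show "inj (\<lambda>l. 2 * int h * int n * l)" using n0 h0 by (intro injI) simp
  show "2 * h * n > 0" using n0 h0 by simp
  fix l
  show "real_of_int \<bar>2 * int h * int n * l\<bar> = \<bar>real_of_int l\<bar> * real (2 * h * n)" by (simp add: abs_mult)
  assume "\<bar>real_of_int l\<bar> < (2 * real s + 1) / real (2 * h * n)"
  hence "\<bar>real_of_int l\<bar> < real K" using K by (simp add: t_def)
  thus "l \<in> {- int K..int K}" by auto
qed (rule diff_corr_square, assumption, rule multiples_of_both[OF n h])

lemma sum_corr_multiples:
  fixes n s K :: nat
  defines "t \<equiv> 2 * real s + 1"
  assumes n: "odd n" and K: "t / (2 * real h * real n) < real K"
  shows "\<bar>(\<Sum>v\<in>window (2 * s). of_bool (int n dvd v) * (sum_corr s \<mu> v)\<^sup>2) / t\<^sup>2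
    - (\<Sum>l\<in>{- int K..int K}. tent (t / real (2 * h * n)) (of_int l + 1 / 2))\<bar> \<le> 96 / real n + 48 / t"
  unfolding t_def
proof (rule corr_multiples[where g = "\<lambda>l. int h * int n * (2 * l + 1)"])
  have n0: "n > 0" using n by (cases n) auto
  have h0: "h > 0" using h by auto
  show "n > 0" by (rule n0)
  show "inj (\<lambda>l. int h * int n * (2 * l + 1))" using n0 h0 by (intro injI) simp
  show "2 * h * n > 0" using n0 h0 by simp
  fix l
  have "real_of_int (2 * l + 1) = 2 * (real_of_int l + 1 / 2)" by simp
  hence "\<bar>real_of_int (2 * l + 1)\<bar> = 2 * \<bar>real_of_int l + 1 / 2\<bar>" by (simp only: abs_mult abs_numeral)
  thus "real_of_int \<bar>int h * int n * (2 * l + 1)\<bar> = \<bar>real_of_int l + 1 / 2\<bar> * real (2 * h * n)"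
    by (simp add: abs_mult)
  assume "\<bar>real_of_int l + 1 / 2\<bar> < (2 * real s + 1) / real (2 * h * n)"
  hence "\<bar>real_of_int l + 1 / 2\<bar> < real K" using K by (simp add: t_def)
  thus "l \<in> {- int K..int K}" by auto
qed (rule sum_corr_square, assumption, rule odd_multiples[OF n h])

text \<open>
Here the shift is not restricted to multiples of \<open>n\<close>. The mean values sit on the multiples of \<open>2 * h\<close> and are summed in
closed form; \<open>k\<close> is the number of positive multiples in the window.
\<close>
lemma diff_corr_all:
  fixes n s :: nat
  defines "t \<equiv> 2 * real s + 1" and "k \<equiv> real (2 * s div (2 * h))" and "q \<equiv> 2 * real h"
  assumes n: "n > 0"
  shows "\<bar>2 / real n * (\<Sum>v\<in>window (2 * s). (diff_corr s \<mu> v)\<^sup>2) / t\<^sup>2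
    - (2 / real n + 4 * (k / real n) - 4 * q * (k / real n) * (k / real n + 1 / real n) / (t / real n)
        + 4 * q\<^sup>2 / 6 * (k / real n) * (k / real n + 1 / real n) * (2 * (k / real n) + 1 / real n) / (t / real n)\<^sup>2)\<bar> \<le> 192 / real n"
proof -
  have h0: "h > 0" using h by auto
  have t: "t \<ge> 1" by (simp add: t_def)
  let ?A = "\<Sum>v\<in>window (2 * s). of_bool True * (diff_corr s \<mu> v)\<^sup>2"
  let ?B = "\<Sum>v\<in>window (2 * s). of_bool True * (of_bool (2 * int h dvd v) * (t - of_int \<bar>v\<bar>)\<^sup>2)"
  have "?B = (\<Sum>v\<in>window (2 * s). of_bool (int (2 * h) dvd v) * (t - of_int \<bar>v\<bar>)\<^sup>2)" by simp
  also have "\<dots> = t\<^sup>2 + 2 * (\<Sum>l=1..2 * s div (2 * h). (t - real (2 * h) * real l)\<^sup>2)"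
    by (rule sum_window_multiples) (use h0 in simp)
  also have "\<dots> = t\<^sup>2 + 2 * (k * t\<^sup>2 - q * t * k * (k + 1) + q\<^sup>2 * k * (k + 1) * (2 * k + 1) / 6)"
    unfolding sum_squares_progression k_def q_def by simp
  finally have B: "?B = t\<^sup>2 + 2 * (k * t\<^sup>2 - q * t * k * (k + 1) + q\<^sup>2 * k * (k + 1) * (2 * k + 1) / 6)" .
  have "t \<noteq> 0" "real n \<noteq> 0" using t n by auto
  hence scaled: "2 / real n * ?B / t\<^sup>2 = 2 / real n + 4 * (k / real n) - 4 * q * (k / real n) * (k / real n + 1 / real n) / (t / real n)
        + 4 * q\<^sup>2 / 6 * (k / real n) * (k / real n + 1 / real n) * (2 * (k / real n) + 1 / real n) / (t / real n)\<^sup>2"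
    unfolding B by (simp add: power2_eq_square field_simps)
  have "\<bar>?A - ?B\<bar> \<le> 48 * t * (\<Sum>v\<in>window (2 * s). of_bool True)"
    by (rule sum_of_bool_approx) (use diff_corr_square in \<open>simp add: t_def\<close>)
  also have "48 * t * (\<Sum>v\<in>window (2 * s). of_bool True) \<le> 48 * t * (2 * t)"
    by (rule mult_left_mono) (use t in \<open>simp_all add: t_def\<close>)
  finally have "2 / real n * \<bar>?A - ?B\<bar> / t\<^sup>2 \<le> 2 / real n * (48 * t * (2 * t)) / t\<^sup>2"
    by (intro divide_right_mono mult_left_mono) auto
  moreover have "2 / real n * (48 * t * (2 * t)) / t\<^sup>2 = 192 / real n" using t by (simp add: power2_eq_square field_simps)
  moreover have "\<bar>x * a / y - x * b / y\<bar> = x * \<bar>a - b\<bar> / y" if "x \<ge> 0" "y \<ge> 0" for a b x y :: real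
  proof -
    have "x * a / y - x * b / y = x * (a - b) / y" by (simp only: diff_divide_distrib right_diff_distrib)
    thus ?thesis using that by (simp add: abs_mult)
  qed
  from this[of "2 / real n" "t\<^sup>2" ?A ?B]
  have "\<bar>2 / real n * ?A / t\<^sup>2 - 2 / real n * ?B / t\<^sup>2\<bar> = 2 / real n * \<bar>?A - ?B\<bar> / t\<^sup>2" by simp
  ultimately have "\<bar>2 / real n * ?A / t\<^sup>2 - 2 / real n * ?B / t\<^sup>2\<bar> \<le> 192 / real n" by linarith
  thus ?thesis unfolding scaled by simp
qed

text \<open>
The sums over the multiples of \<open>n\<close> tend to sums of tents, with \<open>K\<close> so large that no nonzero term
is lost. In the sum over all shifts the closed form tends to \<open>4 * T - 4 * T + 4 * T / 3\<close>.
\<close>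
theorem main_term_limit:
  fixes F :: "nat filter" and s :: "nat \<Rightarrow> nat" and T :: real
  defines "K \<equiv> nat \<lceil>T\<rceil> + 1"
  assumes T: "T > 0" and n_top: "filterlim (\<lambda>n. n) at_top F" and odd_F: "eventually odd F"
    and lim: "((\<lambda>n. (2 * real (s n) + 1) / (2 * real h * real n)) \<longlongrightarrow> T) F"
  shows "((\<lambda>n. main_term n (s n) \<mu> / (2 * real (s n) + 1)\<^sup>2) \<longlongrightarrow>
    2 * (\<Sum>l\<in>{- int K..int K}. tent T (of_int l)) + (\<Sum>l\<in>{- int K..int K}. tent T (of_int l + 1 / 2)) - 4 * T / 3) F"
proof -
  define t where "t n = 2 * real (s n) + 1" for n
  define q where "q = 2 * real h"
  define k where "k n = real (2 * s n div (2 * h))" for n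
  have h0: "h > 0" using h by auto
  have q0: "q > 0" using h0 by (simp add: q_def)
  have t1: "t n \<ge> 1" for n by (simp add: t_def)
  have n_pos: "eventually (\<lambda>n. n > 0) F" using n_top unfolding filterlim_at_top
    by (auto elim: eventually_mono dest!: spec[of _ 1])
  have inv_n: "((\<lambda>n. 1 / real n) \<longlongrightarrow> 0) F"
    using filterlim_compose[OF lim_1_over_n n_top] by simp
  have tn: "((\<lambda>n. t n / real n) \<longlongrightarrow> q * T) F"
  proof -
    have "((\<lambda>n. q * ((2 * real (s n) + 1) / (2 * real h * real n))) \<longlongrightarrow> q * T) F" by (intro tendsto_intros lim)
    moreover have "q * ((2 * real (s n) + 1) / (2 * real h * real n)) = t n / real n" for n
      using h0 by (simp add: t_def q_def)
    ultimately show ?thesis by (simp only:)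
  qed
  have inv_t: "((\<lambda>n. 1 / t n) \<longlongrightarrow> 0) F"
  proof -
    have "((\<lambda>n. (1 / real n) / (t n / real n)) \<longlongrightarrow> 0 / (q * T)) F"
      using q0 T by (intro tendsto_divide inv_n tn) auto
    moreover have "eventually (\<lambda>n. (1 / real n) / (t n / real n) = 1 / t n) F"
      using n_pos by eventually_elim simp
    ultimately have "((\<lambda>n. 1 / t n) \<longlongrightarrow> 0 / (q * T)) F" by (rule Lim_transform_eventually)
    thus ?thesis by simp
  qed
  have kn: "((\<lambda>n. k n / real n) \<longlongrightarrow> T) F"
  proof (rule tendsto_by_error[where g = "\<lambda>n. (t n / real n) / q" and e = "\<lambda>n. 2 * (1 / real n)"])
    show "((\<lambda>n. (t n / real n) / q) \<longlongrightarrow> T) F"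
      using tendsto_divide[OF tn tendsto_const, of q] q0 by simp
    show "((\<lambda>n. 2 * (1 / real n)) \<longlongrightarrow> 0) F" using tendsto_mult_right_zero[OF inv_n, of 2] by simp
    show "eventually (\<lambda>n. \<bar>k n / real n - (t n / real n) / q\<bar> \<le> 2 * (1 / real n)) F"
      using n_pos
    proof eventually_elim
      case (elim n)
      have "real (2 * s n) = real ((2 * s n div (2 * h)) * (2 * h) + 2 * s n mod (2 * h))"
        by (simp only: div_mult_mod_eq)
      also have "\<dots> = k n * q + real (2 * s n mod (2 * h))"
        by (simp only: of_nat_add of_nat_mult of_nat_numeral k_def q_def)
      finally have "real (2 * s n) = k n * q + real (2 * s n mod (2 * h))" .
      moreover have "2 * s n mod (2 * h) < 2 * h" using h0 by (intro mod_less_divisor) simp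
      hence "real (2 * s n mod (2 * h)) < real (2 * h)" by (simp only: of_nat_less_iff)
      hence "real (2 * s n mod (2 * h)) < q" by (simp only: q_def of_nat_mult of_nat_numeral)
      moreover have "0 \<le> real (2 * s n mod (2 * h))" by (rule of_nat_0_le_iff)
      moreover have "q \<ge> 2" using h by (auto simp: q_def)
      moreover have "t n = real (2 * s n) + 1" by (simp add: t_def)
      ultimately have num: "\<bar>k n * q - t n\<bar> \<le> 2 * q" by linarith
      have qn: "q * real n > 0" using q0 elim by simp
      have "k n / real n - (t n / real n) / q = (k n * q - t n) / (q * real n)"
        using q0 elim by (simp add: field_simps)
      also have "\<bar>\<dots>\<bar> = \<bar>k n * q - t n\<bar> / (q * real n)"
        using qn by (simp only: abs_divide abs_of_pos)
      also have "\<dots> \<le> 2 * q / (q * real n)" using num qn by (intro divide_right_mono) auto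
      finally show ?case using q0 by simp
    qed
  qed
  have K_ev: "eventually (\<lambda>n. t n / (2 * real h * real n) < real K) F"
  proof -
    have "eventually (\<lambda>n. (2 * real (s n) + 1) / (2 * real h * real n) < T + 1) F"
      using order_tendstoD(2)[OF lim, of "T + 1"] by simp
    moreover have "T + 1 \<le> real K" unfolding K_def using T by simp
    ultimately show ?thesis unfolding t_def by (auto elim: eventually_mono)
  qed
  have err: "((\<lambda>n. 96 / real n + 48 / t n) \<longlongrightarrow> 0) F"
    using tendsto_add[OF tendsto_mult_right_zero[OF inv_n, of 96] tendsto_mult_right_zero[OF inv_t, of 48]] by simp
  have 1: "((\<lambda>n. (\<Sum>v\<in>window (2 * s n). of_bool (int n dvd v) * (diff_corr (s n) \<mu> v)\<^sup>2) / (t n)\<^sup>2)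
     \<longlongrightarrow> (\<Sum>l\<in>{- int K..int K}. tent T (of_int l))) F"
  proof (rule tendsto_by_error[OF _ err])
    show "((\<lambda>n. \<Sum>l\<in>{- int K..int K}. tent ((2 * real (s n) + 1) / (2 * real h * real n)) (of_int l))
      \<longlongrightarrow> (\<Sum>l\<in>{- int K..int K}. tent T (of_int l))) F"
      by (intro tendsto_sum tendsto_tent lim T)
    show "\<forall>\<^sub>F n in F. \<bar>(\<Sum>v\<in>window (2 * s n). of_bool (int n dvd v) * (diff_corr (s n) \<mu> v)\<^sup>2) / (t n)\<^sup>2 -
       (\<Sum>l\<in>{- int K..int K}. tent ((2 * real (s n) + 1) / (2 * real h * real n)) (of_int l))\<bar> \<le> 96 / real n + 48 / t n"
      using odd_F K_ev by eventually_elim (use diff_corr_multiples in \<open>simp add: t_def\<close>)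
  qed
  have 2: "((\<lambda>n. (\<Sum>v\<in>window (2 * s n). of_bool (int n dvd v) * (sum_corr (s n) \<mu> v)\<^sup>2) / (t n)\<^sup>2)
     \<longlongrightarrow> (\<Sum>l\<in>{- int K..int K}. tent T (of_int l + 1 / 2))) F"
  proof (rule tendsto_by_error[OF _ err])
    show "((\<lambda>n. \<Sum>l\<in>{- int K..int K}. tent ((2 * real (s n) + 1) / (2 * real h * real n)) (of_int l + 1 / 2))
      \<longlongrightarrow> (\<Sum>l\<in>{- int K..int K}. tent T (of_int l + 1 / 2))) F"
      by (intro tendsto_sum tendsto_tent lim T)
    show "\<forall>\<^sub>F n in F. \<bar>(\<Sum>v\<in>window (2 * s n). of_bool (int n dvd v) * (sum_corr (s n) \<mu> v)\<^sup>2) / (t n)\<^sup>2 -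
       (\<Sum>l\<in>{- int K..int K}. tent ((2 * real (s n) + 1) / (2 * real h * real n)) (of_int l + 1 / 2))\<bar> \<le> 96 / real n + 48 / t n"
      using odd_F K_ev by eventually_elim (use sum_corr_multiples in \<open>simp add: t_def\<close>)
  qed
  have 3: "((\<lambda>n. 2 / real n * (\<Sum>v\<in>window (2 * s n). (diff_corr (s n) \<mu> v)\<^sup>2) / (t n)\<^sup>2) \<longlongrightarrow> 4 * T / 3) F"
  proof (rule tendsto_by_error[where e = "\<lambda>n. 192 * (1 / real n)"])
    show "((\<lambda>n. 192 * (1 / real n)) \<longlongrightarrow> 0) F" using tendsto_mult_right_zero[OF inv_n, of 192] by simp
    have "((\<lambda>n. 2 * (1 / real n) + 4 * (k n / real n) - 4 * q * (k n / real n) * (k n / real n + 1 / real n) / (t n / real n)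
        + 4 * q\<^sup>2 / 6 * (k n / real n) * (k n / real n + 1 / real n) * (2 * (k n / real n) + 1 / real n) / (t n / real n)\<^sup>2)
      \<longlongrightarrow> 2 * 0 + 4 * T - 4 * q * T * (T + 0) / (q * T) + 4 * q\<^sup>2 / 6 * T * (T + 0) * (2 * T + 0) / (q * T)\<^sup>2) F"
      by (intro tendsto_add tendsto_diff tendsto_divide tendsto_mult tendsto_power tendsto_const kn inv_n tn) (use q0 T in auto)
    also have "2 * 0 + 4 * T - 4 * q * T * (T + 0) / (q * T) + 4 * q\<^sup>2 / 6 * T * (T + 0) * (2 * T + 0) / (q * T)\<^sup>2 = 4 * T / 3"
      using q0 T by (simp add: power2_eq_square field_simps)
    finally show "((\<lambda>n. 2 / real n + 4 * (k n / real n) - 4 * q * (k n / real n) * (k n / real n + 1 / real n) / (t n / real n)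
        + 4 * q\<^sup>2 / 6 * (k n / real n) * (k n / real n + 1 / real n) * (2 * (k n / real n) + 1 / real n) / (t n / real n)\<^sup>2)
      \<longlongrightarrow> 4 * T / 3) F" by simp
    show "\<forall>\<^sub>F n in F. \<bar>2 / real n * (\<Sum>v\<in>window (2 * s n). (diff_corr (s n) \<mu> v)\<^sup>2) / (t n)\<^sup>2 -
      (2 / real n + 4 * (k n / real n) - 4 * q * (k n / real n) * (k n / real n + 1 / real n) / (t n / real n)
        + 4 * q\<^sup>2 / 6 * (k n / real n) * (k n / real n + 1 / real n) * (2 * (k n / real n) + 1 / real n) / (t n / real n)\<^sup>2)\<bar>
      \<le> 192 * (1 / real n)"
      using n_pos by eventually_elim (use diff_corr_all in \<open>simp add: t_def k_def q_def\<close>)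
  qed
  have "((\<lambda>n. 2 * ((\<Sum>v\<in>window (2 * s n). of_bool (int n dvd v) * (diff_corr (s n) \<mu> v)\<^sup>2) / (t n)\<^sup>2)
     + (\<Sum>v\<in>window (2 * s n). of_bool (int n dvd v) * (sum_corr (s n) \<mu> v)\<^sup>2) / (t n)\<^sup>2
     - 2 / real n * (\<Sum>v\<in>window (2 * s n). (diff_corr (s n) \<mu> v)\<^sup>2) / (t n)\<^sup>2) \<longlongrightarrow>
    2 * (\<Sum>l\<in>{- int K..int K}. tent T (of_int l)) + (\<Sum>l\<in>{- int K..int K}. tent T (of_int l + 1 / 2)) - 4 * T / 3) F"
    by (intro tendsto_add tendsto_diff tendsto_mult tendsto_const 1 2 3)
  thus ?thesis unfolding main_term_def t_def by (simp only: add_divide_distrib diff_divide_distrib times_divide_eq_right)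
qed

end

section \<open>Modulated Jacobi sequences\<close>

lemma coeffs_sum_monom:
  fixes f :: "nat \<Rightarrow> int"
  assumes "t > 0" "f (t - 1) \<noteq> 0"
  shows "coeffs (\<Sum>j<t. Polynomial.monom (f j) j) = map f [0..<t]"
proof -
  let ?A = "\<Sum>j<t. Polynomial.monom (f j) j"
  have c: "poly.coeff ?A i = (if i < t then f i else 0)" for i
  proof -
    have "poly.coeff ?A i = (\<Sum>j<t. if j = i then f j else 0)" by (simp add: coeff_sum coeff_monom)
    thus ?thesis by simp
  qed
  have "?A \<noteq> 0" using c[of "t - 1"] assms by auto
  moreover have "degree ?A = t - 1"
  proof (rule antisym)
    show "degree ?A \<le> t - 1" by (rule degree_le) (use assms in \<open>auto simp: c\<close>)
    show "t - 1 \<le> degree ?A" by (rule le_degree) (use c assms in simp)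
  qed
  ultimately have "coeffs ?A = map (poly.coeff ?A) [0..<Suc (t - 1)]" by (simp add: coeffs_def)
  also have "\<dots> = map f [0..<t]" using assms by (intro map_cong) (auto simp: c)
  finally show ?thesis .
qed

lemma periodic_coeff_sum_monom:
  fixes f :: "nat \<Rightarrow> int"
  assumes "t > 0" "f (t - 1) \<noteq> 0"
  shows "periodic_coeff (\<Sum>j<t. Polynomial.monom (f j) j) k = f (nat (k mod int t))"
proof -
  have "nat (k mod int t) < t" using assms by (simp add: nat_less_iff)
  thus ?thesis unfolding periodic_coeff_def coeffs_sum_monom[of t f, OF assms] by simp
qed

definition jacobi_int :: "nat \<Rightarrow> int \<Rightarrow> int" where
  "jacobi_int n j = (\<Prod>p\<in>prime_factors n. if int p dvd j then 1 else Legendre j (int p))"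

lemma jacobi_int_sign: "\<bar>jacobi_int n j\<bar> = 1"
  unfolding jacobi_int_def abs_prod by (intro prod.neutral) (auto simp: Legendre_def cong_0_iff)

context jacobi_modulus
begin

lemma jacobi_int_coeff: "real_of_int (jacobi_int n j) = jacobi_coeff n j"
  unfolding jacobi_int_def jacobi_coeff_def of_int_prod
  by (intro prod.cong refl) (auto simp: chi_def Legendre_def cong_0_iff)

lemma jacobi_int_cong:
  assumes "[i = j] (mod int n)"
  shows "jacobi_int n i = jacobi_int n j"
proof -
  have "jacobi_coeff n i = jacobi_coeff n j"
    unfolding jacobi_coeff_def
  proof (rule prod.cong[OF refl])
    fix p assume p: "p \<in> P"
    have ij: "[i = j] (mod int p)" using assms P_dvd[OF p] cong_dvd_modulus int_dvd_int_iff by blast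
    show "chi p i + of_bool (int p dvd i) = chi p j + of_bool (int p dvd j)"
      using odd_prime.chi_cong[OF P_odd_prime[OF p] ij] cong_dvd_iff[OF ij] by simp
  qed
  thus ?thesis by (simp flip: jacobi_int_coeff)
qed

lemma jacobi_coeff_even: "jacobi_coeff n (- j) = jacobi_coeff n j"
  unfolding jacobi_coeff_def
proof (rule prod.cong[OF refl])
  fix p assume p: "p \<in> P"
  interpret odd_prime p by (rule P_odd_prime[OF p])
  have "chi p (- j) = chi p (-1) * chi p j" using chi_mult[of "-1" j] by simp
  also have "chi p (-1) = 1" by (rule chi_minus_1) (rule primes_1_mod_4[OF P_prime[OF p] P_dvd[OF p]])
  finally show "chi p (- j) + of_bool (int p dvd - j) = chi p j + of_bool (int p dvd j)" by simp
qed

lemma n_1_mod_4: "[n = 1] (mod 4)"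
proof -
  have "[\<Prod>P = (\<Prod>p\<in>P. 1)] (mod 4)"
  proof (rule cong_prod)
    fix p assume "p \<in> P"
    thus "[p = 1] (mod 4)" using primes_1_mod_4 P_prime P_dvd by blast
  qed
  thus ?thesis by (simp add: prod_P)
qed

text \<open>
Since \<open>n\<close> is squarefree, \<open>n / gcd j n\<close> is the product of the primes of \<open>n\<close> that do not divide \<open>j\<close>.
\<close>
lemma Jacobi_cofactor: "Jacobi (int j) (n div gcd j n) = jacobi_int n (int j)"
proof -
  define B where "B = {p \<in> P. \<not> p dvd j}"
  define C where "C = {p \<in> P. p dvd j}"
  have fin: "finite B" "finite C" by (auto simp: B_def C_def)
  have PBC: "P = B \<union> C" and disj: "B \<inter> C = {}" by (auto simp: B_def C_def)
  have "\<Prod>P = \<Prod>B * \<Prod>C" unfolding PBC by (rule prod.union_disjoint[OF fin disj])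
  hence n: "n = \<Prod>B * \<Prod>C" by (simp only: prod_P)
  have "\<Prod>C dvd j"
  proof -
    have "int (\<Prod>C) dvd int j"
      by (rule primes_prod_dvd[OF fin(2)]) (auto simp: C_def P_prime)
    thus ?thesis by (simp only: int_dvd_int_iff)
  qed
  hence 1: "\<Prod>C dvd gcd j n" using n by simp
  have "coprime (gcd j n) (\<Prod>B)"
  proof (rule prod_coprime_right)
    fix p assume p: "p \<in> B"
    hence "coprime p j" using P_prime by (intro prime_imp_coprime) (auto simp: B_def)
    thus "coprime (gcd j n) p" by (meson coprime_commute coprime_divisors dvd_refl gcd_dvd1)
  qed
  moreover have "gcd j n dvd \<Prod>B * \<Prod>C" using n by (metis gcd_dvd2)
  ultimately have "gcd j n dvd \<Prod>C" by (simp add: coprime_dvd_mult_right_iff)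
  with 1 have "gcd j n = \<Prod>C" by (rule dvd_antisym[rotated])
  moreover have "\<Prod>C > 0" by (rule prod_primes_pos) (auto simp: C_def P_prime)
  ultimately have div: "n div gcd j n = \<Prod>B" using n by (metis nonzero_mult_div_cancel_right less_irrefl)
  have "prime_factorization (prod_mset (mset_set B)) = mset_set B"
    by (rule prime_factorization_prod_mset_primes) (auto simp: B_def P_prime)
  hence "prime_factorization (n div gcd j n) = mset_set B"
    unfolding div by (simp add: prod_unfold_prod_mset)
  hence "Jacobi (int j) (n div gcd j n) = (\<Prod>p\<in>B. Legendre (int j) (int p))"
    unfolding Jacobi_def by (simp add: prod_unfold_prod_mset)
  also have "\<dots> = (\<Prod>p\<in>P. if int p dvd int j then 1 else Legendre (int j) (int p))"
    by (rule prod.mono_neutral_cong_left) (auto simp: B_def)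
  finally show ?thesis by (simp only: jacobi_int_def)
qed

lemma jacobi_poly_coeffs:
  shows "length (coeffs (jacobi_poly n)) = n" and "periodic_coeff (jacobi_poly n) k = jacobi_int n k"
proof -
  have A: "jacobi_poly n = (\<Sum>j<n. Polynomial.monom (jacobi_int n (int j)) j)"
    unfolding jacobi_poly_def by (simp only: Jacobi_cofactor)
  have nz: "jacobi_int n (int (n - 1)) \<noteq> 0" using jacobi_int_sign[of n "int (n - 1)"] by auto
  show "length (coeffs (jacobi_poly n)) = n" unfolding A coeffs_sum_monom[of n "\<lambda>j. jacobi_int n (int j)", OF n_pos nz] by simp
  have "periodic_coeff (jacobi_poly n) k = jacobi_int n (int (nat (k mod int n)))"
    unfolding A by (rule periodic_coeff_sum_monom[where f = "\<lambda>j. jacobi_int n (int j)", OF n_pos nz])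
  also have "int (nat (k mod int n)) = k mod int n" using n_pos by simp
  also have "jacobi_int n (k mod int n) = jacobi_int n k" by (rule jacobi_int_cong) (simp add: cong_def)
  finally show "periodic_coeff (jacobi_poly n) k = jacobi_int n k" .
qed

text \<open>
Signs and Jacobi sequence are both indexed from the centre of the list.
\<close>
definition modulated :: "(int \<Rightarrow> real) \<Rightarrow> nat \<Rightarrow> int list \<Rightarrow> bool" where
  "modulated \<mu> s a \<longleftrightarrow> length a = 2 * s + 1 \<and>
     (\<forall>i<2 * s + 1. real_of_int (a ! i) = \<mu> (int i - int s) * jacobi_coeff n (int i - int s))"

text \<open>
The centre of the list has index \<open>n\<close> in the sequence of period \<open>4 * n\<close>. Modulo \<open>n\<close>, the index \<open>n + j\<close> is \<open>j\<close>; modulo 4, it is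
\<open>1 + j\<close>.
\<close>
lemma modulated_shift_poly:
  assumes \<mu>: "sign_pattern \<mu> h" and e: "\<And>k. (-1) ^ e k = \<mu> (int k - 1)"
  shows "modulated \<mu> s (coeffs (shift_poly (\<Sum>j<4 * length (coeffs (jacobi_poly n)).
    Polynomial.monom ((-1) ^ e j * periodic_coeff (jacobi_poly n) (int j)) j) (int n - int s) (2 * s + 1)))"
proof -
  interpret sign_pattern \<mu> h by (rule \<mu>)
  define f where "f j = (-1) ^ e j * jacobi_int n (int j)" for j
  define A where "A = (\<Sum>j<4 * n. Polynomial.monom (f j) j)"
  have sgn: "\<bar>f j\<bar> = 1" for j by (simp add: f_def abs_mult jacobi_int_sign)
  have nz: "f j \<noteq> 0" for j using sgn[of j] by auto
  have pc: "real_of_int (periodic_coeff A (int i + (int n - int s))) = \<mu> (int i - int s) * jacobi_coeff n (int i - int s)" for i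
  proof -
    define j where "j = int i + (int n - int s)"
    define k where "k = nat (j mod int (4 * n))"
    have k: "int k = j mod int (4 * n)" unfolding k_def using n_pos by simp
    have "[int k = j] (mod int (4 * n))" by (simp add: k cong_def)
    hence ck: "[int k = j] (mod 4)" "[int k = j] (mod int n)"
      by (auto intro: cong_dvd_modulus)
    have "[int n = 1] (mod 4)" using n_1_mod_4 by (metis cong_int_iff of_nat_1 of_nat_numeral)
    hence "[int i - int s + int n - 1 = int i - int s + 1 - 1] (mod 4)" by (intro cong_diff cong_add cong_refl)
    moreover have "[int k - 1 = j - 1] (mod 4)" by (intro cong_diff ck cong_refl)
    moreover have "j - 1 = int i - int s + int n - 1" by (simp add: j_def)
    ultimately have "[int k - 1 = int i - int s] (mod 4)" by (simp only:) (metis add_diff_cancel_right' cong_trans)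
    hence "\<mu> (int k - 1) = \<mu> (int i - int s)" by (rule sign_mod_4)
    moreover have "[int k = int i - int s] (mod int n)"
      using ck(2) by (rule cong_trans) (simp add: j_def cong_iff_dvd_diff)
    hence "jacobi_int n (int k) = jacobi_int n (int i - int s)" by (rule jacobi_int_cong)
    moreover have "periodic_coeff A j = f k"
      unfolding A_def k_def using n_pos by (intro periodic_coeff_sum_monom nz) simp
    ultimately show ?thesis unfolding j_def[symmetric] by (simp add: f_def e jacobi_int_coeff)
  qed
  have nz': "periodic_coeff A (int i + (int n - int s)) \<noteq> 0" for i
    using pc[of i] sign[of "int i - int s"] jacobi_int_sign[of n "int i - int s"]
    by (auto simp flip: jacobi_int_coeff)
  have "coeffs (shift_poly A (int n - int s) (2 * s + 1)) = map (\<lambda>i. periodic_coeff A (int i + (int n - int s))) [0..<2 * s + 1]"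
    unfolding shift_poly_def by (rule coeffs_sum_monom) (simp, rule nz')
  moreover have "(\<Sum>j<4 * length (coeffs (jacobi_poly n)). Polynomial.monom ((-1) ^ e j * periodic_coeff (jacobi_poly n) (int j)) j) = A"
    by (simp only: jacobi_poly_coeffs A_def f_def)
  ultimately show ?thesis unfolding modulated_def by (simp add: pc del: upt_Suc)
qed

lemma modulated_skew_symmetric:
  assumes a: "modulated \<mu> s a" and sign: "\<And>j. \<bar>\<mu> j\<bar> = 1" and skew: "\<And>j. \<mu> (int j) = (-1) ^ j * \<mu> (- int j)"
  shows "skew_symmetric a"
proof -
  have len: "length a = 2 * s + 1" and entry: "\<And>i. i < 2 * s + 1 \<Longrightarrow> real_of_int (a ! i) = \<mu> (int i - int s) * jacobi_coeff n (int i - int s)"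
    using a by (auto simp: modulated_def)
  have "\<bar>a ! i\<bar> = 1" if "i < 2 * s + 1" for i
  proof -
    have "\<bar>real_of_int (a ! i)\<bar> = 1"
      unfolding entry[OF that] abs_mult sign jacobi_int_coeff[symmetric] of_int_abs[symmetric] jacobi_int_sign by simp
    thus ?thesis by linarith
  qed
  hence "a ! i = -1 \<or> a ! i = 1" if "i < 2 * s + 1" for i using that by fastforce
  hence "set a \<subseteq> {-1, 1}" using len by (auto simp: set_conv_nth)
  moreover have "a ! (s + j) = (-1) ^ j * a ! (s - j)" if j: "j \<in> {1..s}" for j
  proof -
    have "real_of_int (a ! (s + j)) = (-1) ^ j * \<mu> (- int j) * jacobi_coeff n (int j)"
      using entry[of "s + j"] j skew[of j] by simp
    also have "\<dots> = (-1) ^ j * real_of_int (a ! (s - j))"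
      using entry[of "s - j"] j jacobi_coeff_even[of "int j"] by (simp add: of_nat_diff)
    finally have "real_of_int (a ! (s + j)) = real_of_int ((-1) ^ j * a ! (s - j))" by simp
    thus ?thesis by (simp only: of_int_eq_iff)
  qed
  ultimately show ?thesis unfolding skew_symmetric_def using len by blast
qed

text \<open>
The correlations at \<open>v\<close> and \<open>- v\<close> agree, and the one at 0 is \<open>t\<close>. Hence the sum over additive quadruples is \<open>t^2\<close> plus twice the sum of
squares in the definition of the merit factor.
\<close>
lemma modulated_merit_factor:
  assumes a: "modulated \<mu> s a" and sign: "\<And>j. \<bar>\<mu> j\<bar> = 1"
  defines "f \<equiv> \<lambda>j. \<mu> j * jacobi_coeff n j" and "t \<equiv> 2 * real s + 1"
  shows "merit_factor a = 1 / (quads s (\<lambda>i j k l. f i * f j * f k * f l) / t\<^sup>2 - 1)"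
proof -
  have len: "length a = 2 * s + 1" and entry: "\<And>i. i < 2 * s + 1 \<Longrightarrow> real_of_int (a ! i) = f (int i - int s)"
    using a by (auto simp: modulated_def f_def)
  have f1: "f j * f j = 1" for j
  proof -
    have "\<bar>f j\<bar> = 1" unfolding f_def abs_mult sign jacobi_int_coeff[symmetric] of_int_abs[symmetric] jacobi_int_sign by simp
    thus ?thesis by (metis abs_mult_self_eq mult_1)
  qed
  have pos: "diff_corr s f (int u) = of_int (autocorr a u)" if u: "u \<le> 2 * s" for u
  proof -
    have "diff_corr s f (int u) = (\<Sum>i\<in>{i \<in> window s. i - int u \<in> window s}. f i * f (i - int u))" by (rule diff_corr_overlap)
    also have "\<dots> = (\<Sum>j<2 * s + 1 - u. f (int j - int s) * f (int (j + u) - int s))"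
      by (rule sum.reindex_bij_witness[of _ "\<lambda>j. int (j + u) - int s" "\<lambda>i. nat (i - int u + int s)"])
         (use u in \<open>auto simp: mult.commute algebra_simps\<close>)
    also have "\<dots> = (\<Sum>j<2 * s + 1 - u. real_of_int (a ! j * a ! (j + u)))"
      by (intro sum.cong refl) (simp add: entry)
    finally show ?thesis by (simp add: autocorr_def len)
  qed
  have neg: "diff_corr s f (- v) = diff_corr s f v" for v
    unfolding diff_corr_def by (subst sum.swap) (intro sum.cong refl, auto simp: mult.commute)
  have "{i \<in> window s. i - 0 \<in> window s} = window s" by auto
  hence zero: "diff_corr s f 0 = t" unfolding diff_corr_overlap by (simp only:) (simp add: f1 t_def)
  have "quads s (\<lambda>i j k l. f i * f j * f k * f l) = (\<Sum>v\<in>window (2 * s). (diff_corr s f v)\<^sup>2)"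
    using quads_diff_corr[of s "\<lambda>_. 1" f] by simp
  also have "\<dots> = t\<^sup>2 + (\<Sum>u=1..2 * s. (diff_corr s f (int u))\<^sup>2 + (diff_corr s f (int u))\<^sup>2)"
    by (subst sum_window_symmetric) (simp only: zero neg)
  also have "(\<Sum>u=1..2 * s. (diff_corr s f (int u))\<^sup>2 + (diff_corr s f (int u))\<^sup>2) = 2 * (\<Sum>u=1..<length a. (real_of_int (autocorr a u))\<^sup>2)"
    unfolding sum_distrib_left len by (intro sum.cong) (auto simp: pos)
  finally have q: "quads s (\<lambda>i j k l. f i * f j * f k * f l) = t\<^sup>2 + 2 * (\<Sum>u=1..<length a. (real_of_int (autocorr a u))\<^sup>2)" .
  have "t \<noteq> 0" "real (length a) = t" by (simp_all add: t_def len)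
  thus ?thesis unfolding merit_factor_def q by (simp add: add_divide_distrib)
qed

end

lemma N_sign_exponent: "(-1) ^ (k * (k - 1) div 2) = N_sign (int k - 1)"
proof -
  obtain m r where k: "k = 4 * m + r" "r < 4" using div_mult_mod_eq[of k 4] by (metis mod_less_divisor mult.commute zero_less_numeral)
  consider "r = 0" | "r = 1" | "r = 2" | "r = 3" using k(2) by linarith
  thus ?thesis
  proof cases
    case 1
    hence "k * (k - 1) div 2 = 2 * (m * (4 * m - 1))" using k by simp
    moreover have "(int k - 1) mod 4 = 3" using k 1 by presburger
    ultimately show ?thesis by (simp add: N_sign_def)
  next
    case 2
    hence "k * (k - 1) div 2 = 2 * (m * (4 * m + 1))" using k by simp
    moreover have "(int k - 1) mod 4 = 0" using k 2 by presburger
    ultimately show ?thesis by (simp add: N_sign_def)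
  next
    case 3
    hence "k * (k - 1) = 2 * (2 * (4 * (m * m) + 3 * m) + 1)" using k by (simp add: algebra_simps)
    hence "k * (k - 1) div 2 = 2 * (4 * (m * m) + 3 * m) + 1" by simp
    moreover have "(int k - 1) mod 4 = 1" using k 3 by presburger
    ultimately show ?thesis by (simp add: N_sign_def)
  next
    case 4
    hence "k * (k - 1) = 2 * (2 * (4 * (m * m) + 5 * m + 1) + 1)" using k by (simp add: algebra_simps)
    hence "k * (k - 1) div 2 = 2 * (4 * (m * m) + 5 * m + 1) + 1" by simp
    moreover have "(int k - 1) mod 4 = 2" using k 4 by presburger
    ultimately show ?thesis by (simp add: N_sign_def)
  qed
qed

lemma P_sign_exponent: "(-1) ^ (k * (k - 1)\<^sup>2 div 2) = P_sign (int k - 1)"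
proof -
  obtain m r where k: "k = 4 * m + r" "r < 4" using div_mult_mod_eq[of k 4] by (metis mod_less_divisor mult.commute zero_less_numeral)
  consider "r = 0" | "r = 1" | "r = 2" | "r = 3" using k(2) by linarith
  thus ?thesis
  proof cases
    case 1
    hence "k * (k - 1)\<^sup>2 div 2 = 2 * (m * (4 * m - 1)\<^sup>2)" using k by simp
    moreover have "(int k - 1) mod 4 = 3" using k 1 by presburger
    ultimately show ?thesis by (simp add: P_sign_def)
  next
    case 2
    hence "k * (k - 1)\<^sup>2 = 2 * (2 * (4 * (m * m) * (4 * m + 1)))" using k by (simp add: power2_eq_square algebra_simps)
    hence "k * (k - 1)\<^sup>2 div 2 = 2 * (4 * (m * m) * (4 * m + 1))" by simp
    moreover have "(int k - 1) mod 4 = 0" using k 2 by presburger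
    ultimately show ?thesis by (simp add: P_sign_def)
  next
    case 3
    have "k * (k - 1)\<^sup>2 = 2 * ((2 * m + 1) * (4 * m + 1)\<^sup>2)" using k 3 by simp
    hence "k * (k - 1)\<^sup>2 div 2 = (2 * m + 1) * (4 * m + 1)\<^sup>2" by simp
    moreover have "odd ((2 * m + 1) * (4 * m + 1)\<^sup>2)" by simp
    moreover have "(int k - 1) mod 4 = 1" using k 3 by presburger
    ultimately show ?thesis by (simp add: P_sign_def)
  next
    case 4
    hence "k - 1 = 2 * (2 * m + 1)" using k by simp
    hence "k * (k - 1)\<^sup>2 = k * (2 * (2 * m + 1))\<^sup>2" by (simp only:)
    also have "\<dots> = 2 * (2 * (k * (2 * m + 1)\<^sup>2))" unfolding power_mult_distrib by simp
    finally have eq: "k * (k - 1)\<^sup>2 = 2 * (2 * (k * (2 * m + 1)\<^sup>2))" .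
    have "k * (k - 1)\<^sup>2 div 2 = 2 * (k * (2 * m + 1)\<^sup>2)"
      unfolding eq by (rule nonzero_mult_div_cancel_left) simp
    moreover have "(int k - 1) mod 4 = 2" using k 4 by presburger
    ultimately show ?thesis by (simp add: P_sign_def)
  qed
qed

lemma N_sign_skew: "N_sign (int j) = (-1) ^ j * N_sign (- int j)"
proof -
  have "int j mod 4 = 0 \<or> int j mod 4 = 1 \<or> int j mod 4 = 2 \<or> int j mod 4 = 3" by presburger
  thus ?thesis
  proof (elim disjE)
    assume "int j mod 4 = 0" moreover from this have "(- int j) mod 4 = 0" "even j" by presburger+
    ultimately show ?thesis by (simp add: N_sign_def)
  next
    assume "int j mod 4 = 1" moreover from this have "(- int j) mod 4 = 3" "odd j" by presburger+
    ultimately show ?thesis by (simp add: N_sign_def)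
  next
    assume "int j mod 4 = 2" moreover from this have "(- int j) mod 4 = 2" "even j" by presburger+
    ultimately show ?thesis by (simp add: N_sign_def)
  next
    assume "int j mod 4 = 3" moreover from this have "(- int j) mod 4 = 1" "odd j" by presburger+
    ultimately show ?thesis by (simp add: N_sign_def)
  qed
qed

lemma P_sign_skew: "P_sign (int j) = (-1) ^ j * P_sign (- int j)"
proof -
  have "int j mod 4 = 0 \<or> int j mod 4 = 1 \<or> int j mod 4 = 2 \<or> int j mod 4 = 3" by presburger
  thus ?thesis
  proof (elim disjE)
    assume "int j mod 4 = 0" moreover from this have "(- int j) mod 4 = 0" "even j" by presburger+
    ultimately show ?thesis by (simp add: P_sign_def)
  next
    assume "int j mod 4 = 1" moreover from this have "(- int j) mod 4 = 3" "odd j" by presburger+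
    ultimately show ?thesis by (simp add: P_sign_def)
  next
    assume "int j mod 4 = 2" moreover from this have "(- int j) mod 4 = 2" "even j" by presburger+
    ultimately show ?thesis by (simp add: P_sign_def)
  next
    assume "int j mod 4 = 3" moreover from this have "(- int j) mod 4 = 1" "odd j" by presburger+
    ultimately show ?thesis by (simp add: P_sign_def)
  qed
qed

section \<open>The limit function\<close>

text \<open>
For the convex function \<open>(1 - x / T)^2\<close> on \<open>0..T\<close> with integral \<open>T / 3\<close>, this is the trapezoidal rule. The exact error
depends on the fractional part \<open>f\<close> of \<open>T\<close>.
\<close>
lemma sum_tent_ge:
  assumes T: "T > 0"
  shows "T / 3 - 1 / 2 \<le> (\<Sum>m=1..nat \<lceil>T\<rceil> + 1. tent T (real m))"
proof -
  define M where "M = nat \<lfloor>T\<rfloor>"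
  define f where "f = T - real M"
  have fl: "real M \<le> T" "T < real M + 1" using T unfolding M_def by (simp_all add: of_nat_nat)
  have f: "0 \<le> f" "f < 1" using fl by (auto simp: f_def)
  have Tf: "T = real M + f" by (simp add: f_def)
  have "(\<Sum>m=1..M. tent T (real m)) = (\<Sum>m=1..M. (T - 1 * real m)\<^sup>2) / T\<^sup>2"
    unfolding sum_divide_distrib
  proof (rule sum.cong[OF refl])
    fix m assume "m \<in> {1..M}"
    hence "real m \<le> T" using fl by simp
    hence "max 0 (1 - \<bar>real m\<bar> / T) = (T - real m) / T" using T by (simp add: field_simps)
    thus "tent T (real m) = (T - 1 * real m)\<^sup>2 / T\<^sup>2" by (simp add: tent_def power_divide)
  qed
  also have "(\<Sum>m=1..M. (T - 1 * real m)\<^sup>2) = T\<^sup>2 * (T / 3 - 1 / 2) + (real M / 6 + f\<^sup>2 / 2 - f ^ 3 / 3)"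
    unfolding sum_squares_progression Tf by (simp add: power2_eq_square power3_eq_cube field_simps)
  also have "\<dots> / T\<^sup>2 \<ge> T / 3 - 1 / 2"
  proof -
    have "f ^ 3 \<le> f\<^sup>2" using f by (intro power_decreasing) auto
    hence "0 \<le> real M / 6 + f\<^sup>2 / 2 - f ^ 3 / 3" using zero_le_power2[of f] of_nat_0_le_iff[of M, where ?'a = real] by linarith
    hence "0 \<le> (real M / 6 + f\<^sup>2 / 2 - f ^ 3 / 3) / T\<^sup>2" by (rule divide_nonneg_nonneg) simp
    thus ?thesis using T by (simp add: add_divide_distrib)
  qed
  also have "(\<Sum>m=1..M. tent T (real m)) \<le> (\<Sum>m=1..nat \<lceil>T\<rceil> + 1. tent T (real m))"
  proof (rule sum_mono2)
    have "M \<le> nat \<lceil>T\<rceil>" unfolding M_def by (intro nat_mono) linarith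
    thus "{1..M} \<subseteq> {1..nat \<lceil>T\<rceil> + 1}" by auto
  qed (auto simp: tent_def)
  finally show ?thesis .
qed

text \<open>
The merit factor is the inverse of a quantity with this limit, which therefore must not vanish. For \<open>T < 3 / 4\<close> the linear
part is positive. For \<open>T \<le> 2\<close> the first terms of the sums suffice and leave cubic polynomials in \<open>T\<close>, which are expanded at
\<open>T = 1\<close>. For \<open>T \<ge> 2\<close> the trapezoidal bound cancels \<open>4 * T / 3\<close>.
\<close>
lemma merit_limit_denominator_pos:
  assumes T: "T > 0"
  defines "K \<equiv> nat \<lceil>T\<rceil> + 1"
  shows "1 - 4 * T / 3 + 4 * (\<Sum>m=1..K. tent T (real m)) + (\<Sum>l\<in>{- int K..int K}. tent T (of_int l + 1 / 2)) > 0"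
proof -
  define A where "A = (\<Sum>m=1..K. tent T (real m))"
  define B where "B = (\<Sum>l\<in>{- int K..int K}. tent T (of_int l + 1 / 2))"
  have tent0: "tent T x \<ge> 0" for x by (simp add: tent_def)
  have K1: "K \<ge> 1" by (simp add: K_def)
  have A0: "A \<ge> 0" unfolding A_def by (intro sum_nonneg tent0)
  have B0: "B \<ge> 0" unfolding B_def by (intro sum_nonneg tent0)
  have A1: "(1 - 1 / T)\<^sup>2 \<le> A" if "T \<ge> 1"
  proof -
    have "tent T (real 1) \<le> A" unfolding A_def by (rule member_le_sum) (use K1 in \<open>auto simp: tent0\<close>)
    thus ?thesis using that by (simp add: tent_def)
  qed
  have B1: "2 * (1 - 1 / (2 * T))\<^sup>2 \<le> B" if "T \<ge> 1 / 2"
  proof -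
    have "(\<Sum>l\<in>{-1, 0 :: int}. tent T (of_int l + 1 / 2)) \<le> B"
      unfolding B_def by (rule sum_mono2) (use K1 in \<open>auto simp: tent0\<close>)
    moreover have "1 / (2 * T) \<le> 1" using that T by (simp add: field_simps)
    ultimately show ?thesis by (simp add: tent_def)
  qed
  consider "T < 3 / 4" | "3 / 4 \<le> T" "T \<le> 1" | "1 \<le> T" "T \<le> 2" | "2 \<le> T" by linarith
  hence "1 - 4 * T / 3 + 4 * A + B > 0"
  proof cases
    case 1 thus ?thesis using A0 B0 by linarith
  next
    case 2
    \<comment> \<open>the expansion at \<open>T = 1\<close> of the polynomial that arises on multiplication by \<open>T^2\<close>\<close>
    define u where "u = 1 - T"
    have u: "0 \<le> u" "u \<le> 1 / 4" using 2 by (auto simp: u_def)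
    have "u * u \<le> 1 / 4 * (1 / 4)" using u by (intro mult_mono) auto
    hence "u\<^sup>2 \<le> 1 / 16" by (simp add: power2_eq_square)
    moreover have "0 \<le> u ^ 3" using u by simp
    ultimately have "0 < 1 / 6 - u\<^sup>2 + 4 / 3 * u ^ 3" by linarith
    also have "\<dots> = T\<^sup>2 * (1 - 4 * T / 3 + 2 * (1 - 1 / (2 * T))\<^sup>2)"
      using T by (simp add: u_def power2_eq_square power3_eq_cube field_simps)
    finally have "0 < 1 - 4 * T / 3 + 2 * (1 - 1 / (2 * T))\<^sup>2" using T by (simp add: zero_less_mult_iff)
    thus ?thesis using B1 2 A0 by linarith
  next
    case 3
    define u where "u = T - 1"
    have u: "0 \<le> u" "u \<le> 1" using 3 by (auto simp: u_def)
    have "u ^ 3 \<le> u\<^sup>2" using u by (intro power_decreasing) auto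
    hence "0 < 1 / 6 + 3 * u\<^sup>2 - 4 / 3 * u ^ 3" using zero_le_power2[of u] by linarith
    also have "\<dots> = T\<^sup>2 * (1 - 4 * T / 3 + 4 * (1 - 1 / T)\<^sup>2 + 2 * (1 - 1 / (2 * T))\<^sup>2)"
      using T by (simp add: u_def power2_eq_square power3_eq_cube field_simps)
    finally have "0 < 1 - 4 * T / 3 + 4 * (1 - 1 / T)\<^sup>2 + 2 * (1 - 1 / (2 * T))\<^sup>2" using T by (simp add: zero_less_mult_iff)
    moreover have "T \<ge> 1 / 2" using 3 by simp
    ultimately show ?thesis using A1[OF 3(1)] B1 by linarith
  next
    case 4
    have "3 / 4 \<le> 1 - 1 / (2 * T)" using 4 by (simp add: field_simps)
    hence "(3 / 4)\<^sup>2 \<le> (1 - 1 / (2 * T))\<^sup>2" by (intro power_mono) auto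
    hence "9 / 8 \<le> B" using B1 4 by (simp add: power2_eq_square)
    moreover have "T / 3 - 1 / 2 \<le> A" using sum_tent_ge[OF T] by (simp add: A_def K_def)
    ultimately show ?thesis by linarith
  qed
  thus ?thesis by (simp only: A_def B_def)
qed

text \<open>
A tent of half-width \<open>T\<close> vanishes outside \<open>{- T<..<T}\<close>, so that both infinite sums are finite.
\<close>
lemma merit_limit_eq:
  assumes T: "T > 0"
  defines "K \<equiv> nat \<lceil>T\<rceil> + 1"
  shows "merit_limit (1 / 4 - T / 2) T = 1 / (1 - 4 * T / 3 + 4 * (\<Sum>m=1..K. tent T (real m))
    + (\<Sum>l\<in>{- int K..int K}. tent T (of_int l + 1 / 2)))"
proof -
  have TK: "T \<le> real K" unfolding K_def using T le_of_int_ceiling[of T] by (simp; linarith)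
  have tent_zero: "tent T x = 0" if "T \<le> \<bar>x\<bar>" for x
    using that T by (simp add: tent_def max_def field_simps)
  have "(\<Sum>\<^sub>\<infinity>m\<in>{1::nat..}. (max 0 (1 - real m / T))\<^sup>2) = (\<Sum>\<^sub>\<infinity>m\<in>{1..K}. tent T (real m))"
  proof (rule infsum_cong_neutral)
    fix m assume "m \<in> {1..} - {1..K}"
    hence "T \<le> real m" using TK by auto
    thus "(max 0 (1 - real m / T))\<^sup>2 = 0" using tent_zero[of "real m"] by (simp add: tent_def)
  qed (auto simp: tent_def)
  hence 1: "(\<Sum>\<^sub>\<infinity>m\<in>{1::nat..}. (max 0 (1 - real m / T))\<^sup>2) = (\<Sum>m=1..K. tent T (real m))" by simp
  have shift: "(max 0 (1 - \<bar>1 + (2 * (1 / 4 - T / 2) - real_of_int m) / T\<bar>))\<^sup>2 = tent T (of_int (- m) + 1 / 2)" for m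
  proof -
    have "1 + (2 * (1 / 4 - T / 2) - real_of_int m) / T = (of_int (- m) + 1 / 2) / T" using T by (simp add: field_simps)
    thus ?thesis using T by (simp add: tent_def)
  qed
  have "(\<Sum>\<^sub>\<infinity>m\<in>(UNIV :: int set). (max 0 (1 - \<bar>1 + (2 * (1 / 4 - T / 2) - real_of_int m) / T\<bar>))\<^sup>2)
     = (\<Sum>\<^sub>\<infinity>m\<in>{- int K..int K}. tent T (of_int (- m) + 1 / 2))"
    unfolding shift
  proof (rule infsum_cong_neutral)
    fix m assume "m \<in> UNIV - {- int K..int K}"
    hence "m > int K \<or> - m > int K" by auto
    hence "real_of_int m \<ge> real K + 1 \<or> real_of_int (- m) \<ge> real K + 1" by linarith
    hence "T \<le> \<bar>of_int (- m) + 1 / 2\<bar>" using TK by auto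
    thus "tent T (of_int (- m) + 1 / 2) = 0" by (rule tent_zero)
  qed auto
  also have "\<dots> = (\<Sum>m\<in>{- int K..int K}. tent T (of_int (- m) + 1 / 2))" by simp
  also have "\<dots> = (\<Sum>l\<in>{- int K..int K}. tent T (of_int l + 1 / 2))"
    by (rule sum.reindex_bij_witness[of _ uminus uminus]) auto
  finally show ?thesis unfolding merit_limit_def 1 by simp
qed

lemma sum_tent_symmetric:
  "(\<Sum>l\<in>{- int K..int K}. tent T (of_int l)) = 1 + 2 * (\<Sum>m=1..K. tent T (real m))"
  by (subst sum_window_symmetric) (simp add: tent_def sum_distrib_left)

section \<open>The limit of the merit factor\<close>

context jacobi_modulus
begin

text \<open>
The divisors of the dichotomy are products of sets of primes of \<open>n\<close>, so that there are at most \<open>2 ^ \<omega>(n)\<close> of them. As each is at least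
\<open>n powr (1/4)\<close>, its kernel sum is at most \<open>n powr (3/4) * (1 + ln n)\<close>.
\<close>
lemma fourth_moment_bound:
  fixes s :: nat
  assumes \<mu>: "sign_pattern \<mu> h"
  defines "t \<equiv> 2 * real s + 1" and "f \<equiv> \<lambda>j. \<mu> j * jacobi_coeff n j"
    and "U \<equiv> 2 * real s + 1 + 16 * (real n * (1 + ln (real n)))"
  shows "real n ^ 2 * \<bar>quads s (\<lambda>i j k l. f i * f j * f k * f l) - main_term n s \<mu>\<bar> \<le>
    3 * ((\<Prod>p\<in>P. 1 + 17 / sqrt (real p)) - 1) * (t * (2 * t + real n))\<^sup>2
    + 19 ^ card P * real n powr (-1/16) * U ^ 4
    + 38 ^ card P * (96 * (real n powr (3/4) * (1 + ln (real n))) * U ^ 3)"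
proof -
  interpret sign_pattern \<mu> h by (rule \<mu>)
  obtain \<epsilon> where e: "\<And>p. p \<in> P \<Longrightarrow> \<epsilon> p \<in> {-1, 1::real}"
    and inv: "\<And>j. of_real (jacobi_coeff n j) = of_real (1 / sqrt (real n)) *
      (\<Sum>k\<in>residues_below n. of_real (jacobi_dft n \<epsilon> k) * ee (of_int (j * k) / of_nat n))"
    using jacobi_coeff_inversion by blast
  interpret FM: fourth_moment n s \<mu> "jacobi_coeff n" "jacobi_dft n \<epsilon>"
    by unfold_locales (simp_all add: odd_n sign period_4 periodic_jacobi_dft inv)
  have S: "FM.S a b c d = quartic_corr n \<epsilon> a b c d" for a b c d
    by (simp add: FM.S_def quartic_corr_def)
  have Q: "FM.Q = quads s (\<lambda>i j k l. f i * f j * f k * f l)"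
    by (simp add: FM.Q_def f_def)
  have t: "FM.t = t" by (simp add: FM.t_def t_def)
  define \<D> where "\<D> = {D \<in> Prod ` Pow P. real n powr (1/4) \<le> real D}"
  have ln0: "0 \<le> ln (real n)" using n_gt_1 by simp
  have card\<D>: "card \<D> \<le> 2 ^ card P"
  proof -
    have "card \<D> \<le> card (Prod ` Pow P)" unfolding \<D>_def by (intro card_mono) auto
    also have "\<dots> \<le> card (Pow P)" by (rule card_image_le) simp
    finally show ?thesis by (simp add: card_Pow)
  qed
  have D_dvd: "D dvd n" if "D \<in> \<D>" for D
    using that prod_dvd_prod_subset[of P _ "\<lambda>p. p"] by (auto simp: \<D>_def prod_P)
  have kern: "kernel_sum (n div D) \<le> real n powr (3/4) * (1 + ln (real n))" if D: "D \<in> \<D>" for D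
  proof -
    have D0: "D > 0" using D_dvd[OF D] n_pos by (auto intro: Nat.gr0I)
    have N0: "n div D > 0" using D_dvd[OF D] n_pos by (simp add: dvd_imp_le div_greater_zero_iff D0)
    have ND: "real (n div D) = real n / real D" using D_dvd[OF D] by (simp add: real_of_nat_div)
    have r: "real n powr (1/4) \<le> real D" using D by (simp add: \<D>_def)
    have "real n / real D \<le> real n / (real n powr (1/4))" using r n_pos D0 by (intro divide_left_mono) auto
    also have "\<dots> = real n powr (3/4)" using n_pos powr_diff[of "real n" 1 "1/4"] by simp
    finally have le: "real (n div D) \<le> real n powr (3/4)" by (simp only: ND)
    have "kernel_sum (n div D) \<le> real (n div D) * (1 + ln (real (n div D)))" by (rule kernel_sum_le[OF N0])
    also have "\<dots> \<le> real n powr (3/4) * (1 + ln (real n))"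
    proof (intro mult_mono le add_left_mono)
      have "real (n div D) \<le> real n" by simp
      thus "ln (real (n div D)) \<le> ln (real n)" using N0 by (intro ln_mono) auto
      show "0 \<le> 1 + ln (real (n div D))" using N0 by (intro add_nonneg_nonneg ln_ge_zero) auto
    qed simp
    finally show ?thesis .
  qed
  have "real n ^ 2 * \<bar>FM.Q - main_term n s \<mu>\<bar> \<le>
    3 * ((\<Prod>p\<in>P. 1 + 17 / sqrt (real p)) - 1) * (FM.t * (2 * FM.t + real n))\<^sup>2
    + (19 ^ card P * real n powr (-1/16)) * U ^ 4
    + real (card \<D>) * 19 ^ card P * (96 * (real n powr (3/4) * (1 + ln (real n))) * U ^ 3)"
  proof (rule FM.fourth_moment_estimate)
    show "\<bar>FM.S a b c d - 1\<bar> \<le> (\<Prod>p\<in>P. 1 + 17 / sqrt (real p)) - 1" if "FM.matched a b c d" for a b c d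
      unfolding S using that by (intro quartic_corr_paired e) (auto simp: FM.matched_def paired_def)
    show "\<bar>FM.S a b c d\<bar> \<le> 19 ^ card P * real n powr (-1/16) \<or>
      \<bar>FM.S a b c d\<bar> \<le> 19 ^ card P \<and> (\<exists>D\<in>\<D>. paired D a c b d \<or> paired D a d b c \<or> paired D a b c d)" for a b c d
      unfolding S \<D>_def using quartic_corr_dichotomy[of \<epsilon> a b c d, OF e] by blast
    show "finite \<D>" by (simp add: \<D>_def)
    have "1 \<le> (\<Prod>p\<in>P. 1 + 17 / sqrt (real p))" by (intro prod_ge_1) simp
    thus "0 \<le> (\<Prod>p\<in>P. 1 + 17 / sqrt (real p)) - 1" by simp
    show "FM.t + 16 * kernel_sum n \<le> U" unfolding FM.t_def U_def using kernel_sum_le[OF n_pos] by simp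
  qed (use D_dvd kern ln0 in auto)
  also have "real (card \<D>) * 19 ^ card P * (96 * (real n powr (3/4) * (1 + ln (real n))) * U ^ 3)
    \<le> 2 ^ card P * 19 ^ card P * (96 * (real n powr (3/4) * (1 + ln (real n))) * U ^ 3)"
  proof (intro mult_right_mono)
    have "real (card \<D>) \<le> real (2 ^ card P)" using card\<D> by (simp only: of_nat_le_iff)
    thus "real (card \<D>) \<le> 2 ^ card P" by simp
    have "0 \<le> U" unfolding U_def using ln0 by simp
    thus "0 \<le> 96 * (real n powr (3/4) * (1 + ln (real n))) * U ^ 3" using ln0 by simp
  qed simp
  also have "(2::real) ^ card P * 19 ^ card P = 38 ^ card P" by (simp flip: power_mult_distrib)
  finally show ?thesis by (simp add: Q t)
qed

lemma kappa_le: "p \<in> P \<Longrightarrow> kappa n \<le> p"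
  unfolding kappa_def by (rule Min_le) auto

lemma kappa_pos: "kappa n > 0"
  unfolding kappa_def using Min_in[of P] P_nonempty P_prime prime_gt_0_nat by (metis finite_set_mset)

lemma kappa_power_omega: "kappa n ^ omega n \<le> n"
proof -
  have "(\<Prod>p\<in>P. kappa n) \<le> \<Prod>P" by (rule prod_mono) (auto intro: kappa_le)
  thus ?thesis by (simp add: prod_P omega_def)
qed

lemma prod_le_exp: "(\<Prod>p\<in>P. 1 + 17 / sqrt (real p)) \<le> exp (17 * (real (omega n) / sqrt (real (kappa n))))"
proof -
  have "(\<Prod>p\<in>P. 1 + 17 / sqrt (real p)) \<le> (\<Prod>p\<in>P. exp (17 / sqrt (real (kappa n))))"
  proof (intro prod_mono conjI)
    fix p assume p: "p \<in> P"
    have "17 / sqrt (real p) \<le> 17 / sqrt (real (kappa n))"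
      using kappa_le[OF p] kappa_pos prime_gt_0_nat[OF P_prime[OF p]] by (intro divide_left_mono) auto
    thus "1 + 17 / sqrt (real p) \<le> exp (17 / sqrt (real (kappa n)))"
      using exp_ge_add_one_self[of "17 / sqrt (real (kappa n))"] by linarith
  qed simp
  also have "\<dots> = exp (17 * (real (omega n) / sqrt (real (kappa n))))"
    by (simp add: omega_def exp_of_nat_mult[symmetric])
  finally show ?thesis .
qed

text \<open>
Take 32nd powers and use \<open>\<kappa>(n) ^ \<omega>(n) \<le> n\<close>.
\<close>
lemma power_omega_le:
  assumes "38 ^ 32 \<le> kappa n"
  shows "38 ^ omega n \<le> real n powr (1/32)"
proof -
  have "(38 ^ omega n) ^ 32 = (38 ^ 32 :: nat) ^ omega n" by (simp only: power_mult[symmetric] mult.commute)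
  also have "\<dots> \<le> kappa n ^ omega n" by (rule power_mono[OF assms]) simp
  also have "\<dots> \<le> n" by (rule kappa_power_omega)
  finally have "real ((38 ^ omega n) ^ 32) \<le> real n" by (simp only: of_nat_le_iff)
  moreover define x :: real where "x = 38 ^ omega n"
  ultimately have "x ^ 32 \<le> real n" by simp
  hence "(x ^ 32) powr (1/32) \<le> real n powr (1/32)" by (intro powr_mono2) (auto simp: x_def)
  moreover have "(x ^ 32) powr (1/32) = x"
  proof -
    have x0: "x > 0" by (simp add: x_def)
    hence "x ^ 32 = x powr 32" by simp
    hence "(x ^ 32) powr (1/32) = x powr (32 * (1/32))" by (simp only: powr_powr)
    thus ?thesis using x0 by simp
  qed
  ultimately show ?thesis by (simp add: x_def)
qed

end

lemma square_le_power_5: "real m ^ 2 \<le> 5 ^ m"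
proof (induction m)
  case (Suc m)
  show ?case
  proof (cases "m = 0")
    case False
    have "real (Suc m) ^ 2 \<le> (2 * real m) ^ 2" using False by (intro power_mono) auto
    also have "\<dots> \<le> 5 * real m ^ 2" by (simp add: power_mult_distrib)
    also have "\<dots> \<le> 5 * 5 ^ m" using Suc.IH by (intro mult_left_mono) auto
    finally show ?thesis by simp
  qed simp
qed simp

text \<open>
The savings in the error bound are \<open>n powr (-1/16)\<close> and \<open>n powr (-1/4)\<close>. After a loss of at most \<open>n powr (1/32)\<close>, caused by the powers of
\<open>38\<close>, there remain at least four factors \<open>\<rho> n = n powr (-1/128)\<close>, one for each of the at most four logarithms.
\<close>
lemma merit_factor_limit:
  fixes F :: "nat filter" and s :: "nat \<Rightarrow> nat" and T :: real and a :: "nat \<Rightarrow> int list"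
  assumes \<mu>: "sign_pattern \<mu> h" and T: "T > 0" and n_top: "filterlim (\<lambda>n. n) at_top F"
    and modF: "eventually jacobi_modulus F"
    and small: "((\<lambda>n. 5 ^ omega n / real (kappa n)) \<longlongrightarrow> 0) F"
    and lim: "((\<lambda>n. (2 * real (s n) + 1) / (2 * real h * real n)) \<longlongrightarrow> T) F"
    and a: "eventually (\<lambda>n. jacobi_modulus.modulated n \<mu> (s n) (a n)) F"
  shows "((\<lambda>n. merit_factor (a n)) \<longlongrightarrow> merit_limit (1 / 4 - T / 2) T) F"
proof -
  interpret sign_pattern \<mu> h by (rule \<mu>)
  define t where "t n = 2 * real (s n) + 1" for n
  define Q where "Q n = quads (s n) (\<lambda>i j k l. (\<mu> i * jacobi_coeff n i) * (\<mu> j * jacobi_coeff n j) *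
      (\<mu> k * jacobi_coeff n k) * (\<mu> l * jacobi_coeff n l))" for n
  define V where "V n = t n / real n + 16 * (1 + ln (real n))" for n
  \<comment> \<open>\<open>V n\<close> is the bound for the total weight of the frequencies, divided by \<open>n\<close>.\<close>
  define \<rho> where "\<rho> n = real n powr (-1/128)" for n
  define \<delta> where "\<delta> n = exp (17 * (real (omega n) / sqrt (real (kappa n)))) - 1" for n
  define err where "err n = 3 * \<delta> n * (2 * (t n / real n) + 1)\<^sup>2 + (\<rho> n * V n) ^ 4 * (real n / t n)\<^sup>2
     + 96 * ((\<rho> n * (1 + ln (real n))) * (\<rho> n * V n) ^ 3 * (real n / t n)\<^sup>2)" for n
  have h0: "h > 0" using h by auto
  have real_top: "filterlim (\<lambda>n. real n) at_top F"
    using filterlim_compose[OF filterlim_real_sequentially n_top] by simp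
  have tn: "((\<lambda>n. t n / real n) \<longlongrightarrow> 2 * real h * T) F"
  proof -
    have "((\<lambda>n. 2 * real h * ((2 * real (s n) + 1) / (2 * real h * real n))) \<longlongrightarrow> 2 * real h * T) F"
      by (intro tendsto_intros lim)
    moreover have "2 * real h * ((2 * real (s n) + 1) / (2 * real h * real n)) = t n / real n" for n
      using h0 by (simp add: t_def)
    ultimately show ?thesis by (simp only:)
  qed
  have nt: "((\<lambda>n. real n / t n) \<longlongrightarrow> inverse (2 * real h * T)) F"
    using tendsto_inverse[OF tn] h0 T by simp
  have \<rho>0: "(\<rho> \<longlongrightarrow> 0) F"
  proof -
    have "((\<lambda>x::real. x powr (-1/128)) \<longlongrightarrow> 0) at_top" by real_asymp
    from filterlim_compose[OF this real_top] show ?thesis by (simp add: \<rho>_def[abs_def])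
  qed
  have \<rho>ln: "((\<lambda>n. \<rho> n * (1 + ln (real n))) \<longlongrightarrow> 0) F"
  proof -
    have "((\<lambda>x::real. x powr (-1/128) * (1 + ln x)) \<longlongrightarrow> 0) at_top" by real_asymp
    from filterlim_compose[OF this real_top] show ?thesis by (simp add: \<rho>_def[abs_def])
  qed
  have \<rho>V: "((\<lambda>n. \<rho> n * V n) \<longlongrightarrow> 0) F"
  proof -
    have "((\<lambda>n. \<rho> n * (t n / real n) + 16 * (\<rho> n * (1 + ln (real n)))) \<longlongrightarrow> 0 * (2 * real h * T) + 16 * 0) F"
      by (intro tendsto_intros \<rho>0 tn \<rho>ln)
    thus ?thesis by (simp add: V_def algebra_simps)
  qed
  have \<delta>0: "(\<delta> \<longlongrightarrow> 0) F"
  proof -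
    have "((\<lambda>n. real (omega n) ^ 2 / real (kappa n)) \<longlongrightarrow> 0) F"
    proof (rule Lim_null_comparison[OF _ small], rule always_eventually, rule allI)
      fix n
      have "real (omega n) ^ 2 / real (kappa n) \<le> 5 ^ omega n / real (kappa n)"
        by (intro divide_right_mono square_le_power_5) simp
      thus "norm (real (omega n) ^ 2 / real (kappa n)) \<le> 5 ^ omega n / real (kappa n)" by simp
    qed
    hence "((\<lambda>n. sqrt (real (omega n) ^ 2 / real (kappa n))) \<longlongrightarrow> sqrt 0) F" by (rule tendsto_real_sqrt)
    hence "((\<lambda>n. real (omega n) / sqrt (real (kappa n))) \<longlongrightarrow> 0) F" by (simp add: real_sqrt_divide)
    hence "((\<lambda>n. exp (17 * (real (omega n) / sqrt (real (kappa n)))) - 1) \<longlongrightarrow> exp (17 * 0) - 1) F"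
      by (intro tendsto_intros)
    thus ?thesis by (simp add: \<delta>_def[abs_def])
  qed
  have err0: "(err \<longlongrightarrow> 0) F"
  proof -
    have "(err \<longlongrightarrow> 3 * 0 * (2 * (2 * real h * T) + 1)\<^sup>2 + 0 ^ 4 * (inverse (2 * real h * T))\<^sup>2
       + 96 * (0 * 0 ^ 3 * (inverse (2 * real h * T))\<^sup>2)) F"
      unfolding err_def by (intro tendsto_add tendsto_mult tendsto_power tendsto_const \<delta>0 tn \<rho>V \<rho>ln nt)
    thus ?thesis by simp
  qed
  have kappa_large: "eventually (\<lambda>n. 38 ^ 32 \<le> kappa n) F"
  proof -
    have "eventually (\<lambda>n. 5 ^ omega n / real (kappa n) < 1 / 38 ^ 32) F"
      by (rule order_tendstoD(2)[OF small]) simp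
    with modF show ?thesis
    proof eventually_elim
      case (elim n)
      have k0: "real (kappa n) > 0" using jacobi_modulus.kappa_pos[OF elim(1)] by simp
      have "1 / real (kappa n) \<le> 5 ^ omega n / real (kappa n)" by (intro divide_right_mono) auto
      hence "1 / real (kappa n) < 1 / 38 ^ 32" using elim(2) by linarith
      hence "(38 ^ 32 :: real) < real (kappa n)" using k0 by (simp add: divide_less_eq)
      hence "real (38 ^ 32) < real (kappa n)" by simp
      thus ?case by (simp only: of_nat_less_iff)
    qed
  qed
  have main: "((\<lambda>n. main_term n (s n) \<mu> / (t n)\<^sup>2) \<longlongrightarrow>
    2 * (\<Sum>l\<in>{- int (nat \<lceil>T\<rceil> + 1)..int (nat \<lceil>T\<rceil> + 1)}. tent T (of_int l))
     + (\<Sum>l\<in>{- int (nat \<lceil>T\<rceil> + 1)..int (nat \<lceil>T\<rceil> + 1)}. tent T (of_int l + 1 / 2)) - 4 * T / 3) F" (is "(_ \<longlongrightarrow> ?L) F")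
    unfolding t_def
    by (rule main_term_limit[OF T n_top _ lim]) (use modF in eventually_elim, simp add: jacobi_modulus_def)
  have Qlim: "((\<lambda>n. Q n / (t n)\<^sup>2) \<longlongrightarrow> ?L) F"
  proof (rule tendsto_by_error[OF main err0])
    show "eventually (\<lambda>n. \<bar>Q n / (t n)\<^sup>2 - main_term n (s n) \<mu> / (t n)\<^sup>2\<bar> \<le> err n) F"
      using modF kappa_large
    proof eventually_elim
      case (elim n)
      interpret jacobi_modulus n by (rule elim(1))
      define N where "N = real n"
      define tt where "tt = t n"
      define U where "U = 2 * real (s n) + 1 + 16 * (N * (1 + ln N))"
      define D where "D = (\<Prod>p\<in>prime_factors n. 1 + 17 / sqrt (real p)) - 1"
      have N1: "N > 1" using n_gt_1 by (simp add: N_def)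
      have ln0: "0 \<le> ln N" using N1 by simp
      have tt1: "tt \<ge> 1" by (simp add: tt_def t_def)
      have UV: "U = N * V n"
      proof -
        have "N * V n = N * (t n / N) + 16 * (N * (1 + ln N))"
          unfolding V_def N_def[symmetric] by (simp only: distrib_left mult.left_commute)
        also have "N * (t n / N) = t n" using N1 by simp
        finally show ?thesis by (simp add: U_def t_def)
      qed
      have V0: "V n \<ge> 0" using ln0 tt1 N1 by (simp add: V_def tt_def[symmetric] N_def[symmetric])
      have om: "38 ^ omega n \<le> N powr (1/32)" unfolding N_def by (rule power_omega_le[OF elim(2)])
      have "19 ^ omega n \<le> (38 ^ omega n :: real)" by (intro power_mono) auto
      hence om19: "19 ^ omega n \<le> N powr (1/32)" using om by linarith
      have \<rho>: "\<rho> n ^ k = N powr (- real k / 128)" for k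
        using N1 by (simp add: \<rho>_def N_def[symmetric] powr_power)
      have est: "N ^ 2 * \<bar>Q n - main_term n (s n) \<mu>\<bar> \<le> 3 * D * (tt * (2 * tt + N))\<^sup>2
        + 19 ^ omega n * N powr (-1/16) * U ^ 4 + 38 ^ omega n * (96 * (N powr (3/4) * (1 + ln N)) * U ^ 3)"
        unfolding Q_def tt_def t_def N_def U_def D_def omega_def by (rule fourth_moment_bound[OF \<mu>])
      have e1: "3 * D * (tt * (2 * tt + N))\<^sup>2 \<le> 3 * \<delta> n * (tt * (2 * tt + N))\<^sup>2"
        unfolding D_def \<delta>_def using prod_le_exp by (intro mult_right_mono mult_left_mono) auto
      have e2: "19 ^ omega n * N powr (-1/16) * U ^ 4 \<le> (\<rho> n * V n) ^ 4 * N ^ 4"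
      proof -
        have "19 ^ omega n * N powr (-1/16) * U ^ 4 \<le> N powr (1/32) * N powr (-1/16) * U ^ 4"
          using om19 V0 N1 by (intro mult_right_mono) (auto simp: UV)
        also have "N powr (1/32) * N powr (-1/16) = \<rho> n ^ 4" using N1 by (simp add: \<rho> powr_add[symmetric])
        finally show ?thesis by (simp add: UV power_mult_distrib mult_ac)
      qed
      have e3: "38 ^ omega n * (96 * (N powr (3/4) * (1 + ln N)) * U ^ 3)
         \<le> 96 * ((\<rho> n * (1 + ln N)) * (\<rho> n * V n) ^ 3) * N ^ 4"
      proof -
        have "38 ^ omega n * (96 * (N powr (3/4) * (1 + ln N)) * U ^ 3)
          \<le> N powr (1/32) * (96 * (N powr (3/4) * (1 + ln N)) * U ^ 3)"
          using om V0 N1 ln0 by (intro mult_right_mono) (auto simp: UV)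
        also have "\<dots> = (N powr (1/32) * N powr (3/4)) * (96 * (1 + ln N) * U ^ 3)" by (simp only: mult_ac)
        also have "N powr (1/32) * N powr (3/4) = N powr (25/32)" by (simp add: powr_add[symmetric])
        also have "\<dots> * (96 * (1 + ln N) * U ^ 3) \<le> N powr (31/32) * (96 * (1 + ln N) * U ^ 3)"
          using V0 N1 ln0 by (intro mult_right_mono powr_mono) (auto simp: UV)
        also have "N powr (31/32) = \<rho> n ^ 4 * N" using N1 powr_mult_base[of N "-1/32"] by (simp add: \<rho> mult.commute)
        also have "\<rho> n ^ 4 * N * (96 * (1 + ln N) * U ^ 3) = 96 * ((\<rho> n * (1 + ln N)) * (\<rho> n * V n) ^ 3) * N ^ 4"
          by (simp add: UV power_mult_distrib power4_eq_xxxx power3_eq_cube mult_ac)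
        finally show ?thesis .
      qed
      have "N ^ 2 * \<bar>Q n - main_term n (s n) \<mu>\<bar> \<le> 3 * \<delta> n * (tt * (2 * tt + N))\<^sup>2 + (\<rho> n * V n) ^ 4 * N ^ 4
         + 96 * ((\<rho> n * (1 + ln N)) * (\<rho> n * V n) ^ 3) * N ^ 4"
        using est e1 e2 e3 by linarith
      also have "\<dots> = N ^ 2 * (tt\<^sup>2 * err n)"
      proof -
        have "tt \<noteq> 0" "N \<noteq> 0" using tt1 N1 by auto
        hence "tt\<^sup>2 * (N / tt)\<^sup>2 = N\<^sup>2" "N ^ 2 * (tt\<^sup>2 * (2 * (tt / N) + 1)\<^sup>2) = (tt * (2 * tt + N))\<^sup>2"
          by (simp_all add: power2_eq_square field_simps)
        moreover have "N ^ 4 = N\<^sup>2 * N\<^sup>2" by (simp flip: power_add)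
        moreover have "N ^ 2 * (tt\<^sup>2 * err n) = 3 * \<delta> n * (N ^ 2 * (tt\<^sup>2 * (2 * (tt / N) + 1)\<^sup>2))
           + (\<rho> n * V n) ^ 4 * (N\<^sup>2 * (tt\<^sup>2 * (N / tt)\<^sup>2)) + 96 * ((\<rho> n * (1 + ln N)) * (\<rho> n * V n) ^ 3) * (N\<^sup>2 * (tt\<^sup>2 * (N / tt)\<^sup>2))"
          unfolding err_def tt_def[symmetric] N_def[symmetric] by (simp only: distrib_left mult_ac)
        ultimately show ?thesis by simp
      qed
      finally have "\<bar>Q n - main_term n (s n) \<mu>\<bar> \<le> tt\<^sup>2 * err n"
        using N1 by (subst (asm) mult_le_cancel_left_pos) auto
      hence "\<bar>Q n - main_term n (s n) \<mu>\<bar> / tt\<^sup>2 \<le> err n"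
        using tt1 by (simp add: pos_divide_le_eq mult.commute)
      moreover have "\<bar>Q n / (t n)\<^sup>2 - main_term n (s n) \<mu> / (t n)\<^sup>2\<bar> = \<bar>Q n - main_term n (s n) \<mu>\<bar> / tt\<^sup>2"
        by (simp add: tt_def diff_divide_distrib[symmetric] abs_divide)
      ultimately show ?case by simp
    qed
  qed
  let ?d = "1 - 4 * T / 3 + 4 * (\<Sum>m=1..nat \<lceil>T\<rceil> + 1. tent T (real m))
     + (\<Sum>l\<in>{- int (nat \<lceil>T\<rceil> + 1)..int (nat \<lceil>T\<rceil> + 1)}. tent T (of_int l + 1 / 2))"
  have "((\<lambda>n. 1 / (Q n / (t n)\<^sup>2 - 1)) \<longlongrightarrow> 1 / (?L - 1)) F"
  proof (intro tendsto_divide tendsto_diff tendsto_const Qlim)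
    show "?L - 1 \<noteq> 0"
      using merit_limit_denominator_pos[OF T] unfolding sum_tent_symmetric by simp
  qed
  moreover have "1 / (?L - 1) = merit_limit (1 / 4 - T / 2) T"
    unfolding merit_limit_eq[OF T] sum_tent_symmetric by (simp add: algebra_simps)
  moreover have "eventually (\<lambda>n. 1 / (Q n / (t n)\<^sup>2 - 1) = merit_factor (a n)) F"
    using modF a
  proof eventually_elim
    case (elim n)
    interpret jacobi_modulus n by (rule elim(1))
    show ?case unfolding Q_def t_def by (rule modulated_merit_factor[symmetric, OF elim(2) sign])
  qed
  ultimately show ?thesis by (simp only: Lim_transform_eventually)
qed

theorem corollary2p4:
  fixes S :: "nat set"
  assumes "infinite S"
    and "\<And>n. n \<in> S \<Longrightarrow> n > 1 \<and> odd n \<and> squarefree n"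
    and "\<And>n p. n \<in> S \<Longrightarrow> prime p \<Longrightarrow> p dvd n \<Longrightarrow> [p = 1] (mod 4)"
    and "((\<lambda>n. max (4 ^ omega n * (ln (real n)) ^ 6) (5 ^ omega n) / real (kappa n)) \<longlongrightarrow> 0)
           (inf sequentially (principal S))"
  shows "(\<forall>n\<in>S. \<forall>s :: nat.
            skew_symmetric
              (coeffs (shift_poly (N_poly (jacobi_poly n)) (int n - int s) (2 * s + 1))) \<and>
            skew_symmetric
              (coeffs (shift_poly (P_poly (jacobi_poly n)) (int n - int s) (2 * s + 1)))) \<and>
         (\<forall>(T :: real) (s :: nat \<Rightarrow> nat). T > 0 \<longrightarrow>
            (((\<lambda>n. real (s n) / real n) \<longlongrightarrow> T) (inf sequentially (principal S)) \<longrightarrow>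
             ((\<lambda>n. merit_factor
                 (coeffs (shift_poly (N_poly (jacobi_poly n)) (int n - int (s n)) (2 * s n + 1))))
               \<longlongrightarrow> merit_limit (1 / 4 - T / 2) T) (inf sequentially (principal S))) \<and>
            (((\<lambda>n. real (s n) / (2 * real n)) \<longlongrightarrow> T) (inf sequentially (principal S)) \<longrightarrow>
             ((\<lambda>n. merit_factor
                 (coeffs (shift_poly (P_poly (jacobi_poly n)) (int n - int (s n)) (2 * s n + 1))))
               \<longlongrightarrow> merit_limit (1 / 4 - T / 2) T) (inf sequentially (principal S))))"
proof -
  let ?F = "inf sequentially (principal S)"
  have jm: "jacobi_modulus n" if "n \<in> S" for n
    by unfold_locales (use assms(2,3) that in auto)
  have N: "jacobi_modulus.modulated n N_sign s (coeffs (shift_poly (N_poly (jacobi_poly n)) (int n - int s) (2 * s + 1)))"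
    if "n \<in> S" for n s
    unfolding N_poly_def by (rule jacobi_modulus.modulated_shift_poly[OF jm[OF that] sign_pattern_N N_sign_exponent])
  have P: "jacobi_modulus.modulated n P_sign s (coeffs (shift_poly (P_poly (jacobi_poly n)) (int n - int s) (2 * s + 1)))"
    if "n \<in> S" for n s
    unfolding P_poly_def by (rule jacobi_modulus.modulated_shift_poly[OF jm[OF that] sign_pattern_P P_sign_exponent])
  have in_S: "eventually (\<lambda>n. n \<in> S) ?F" by (simp add: eventually_inf_principal)
  have modF: "eventually jacobi_modulus ?F" using in_S by eventually_elim (rule jm)
  have n_top: "filterlim (\<lambda>n. n) at_top ?F" by (rule filterlim_mono[OF filterlim_ident order_refl inf_le1])
  have inv_n: "((\<lambda>n. 1 / real n) \<longlongrightarrow> 0) ?F" using filterlim_compose[OF lim_1_over_n n_top] by simp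
  have n_pos: "eventually (\<lambda>n. n > 0) ?F" using modF by eventually_elim (rule jacobi_modulus.n_pos)
  have small: "((\<lambda>n. 5 ^ omega n / real (kappa n)) \<longlongrightarrow> 0) ?F"
  proof (rule Lim_null_comparison[OF _ assms(4)], rule always_eventually, rule allI)
    fix n
    have "5 ^ omega n / real (kappa n) \<le> max (4 ^ omega n * (ln (real n)) ^ 6) (5 ^ omega n) / real (kappa n)"
      by (intro divide_right_mono) auto
    thus "norm (5 ^ omega n / real (kappa n)) \<le> max (4 ^ omega n * (ln (real n)) ^ 6) (5 ^ omega n) / real (kappa n)" by simp
  qed
  have "((\<lambda>n. merit_factor (coeffs (shift_poly (N_poly (jacobi_poly n)) (int n - int (s n)) (2 * s n + 1))))
      \<longlongrightarrow> merit_limit (1 / 4 - T / 2) T) ?F"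
    if T: "T > 0" and lim: "((\<lambda>n. real (s n) / real n) \<longlongrightarrow> T) ?F" for T s
  proof (rule merit_factor_limit[OF sign_pattern_N T n_top modF small])
    have "((\<lambda>n. real (s n) / real n + 1 / real n / 2) \<longlongrightarrow> T + 0 / 2) ?F" by (intro tendsto_intros lim inv_n) simp
    moreover have "eventually (\<lambda>n. real (s n) / real n + 1 / real n / 2 = (2 * real (s n) + 1) / (2 * real 1 * real n)) ?F"
      using n_pos by eventually_elim (simp add: field_simps)
    ultimately show "((\<lambda>n. (2 * real (s n) + 1) / (2 * real 1 * real n)) \<longlongrightarrow> T) ?F"
      using Lim_transform_eventually by fastforce
    show "eventually (\<lambda>n. jacobi_modulus.modulated n N_sign (s n)
      (coeffs (shift_poly (N_poly (jacobi_poly n)) (int n - int (s n)) (2 * s n + 1)))) ?F"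
      using in_S by eventually_elim (rule N)
  qed
  moreover have "((\<lambda>n. merit_factor (coeffs (shift_poly (P_poly (jacobi_poly n)) (int n - int (s n)) (2 * s n + 1))))
      \<longlongrightarrow> merit_limit (1 / 4 - T / 2) T) ?F"
    if T: "T > 0" and lim: "((\<lambda>n. real (s n) / (2 * real n)) \<longlongrightarrow> T) ?F" for T s
  proof (rule merit_factor_limit[OF sign_pattern_P T n_top modF small])
    have "((\<lambda>n. real (s n) / (2 * real n) + 1 / real n / 4) \<longlongrightarrow> T + 0 / 4) ?F" by (intro tendsto_intros lim inv_n) simp
    moreover have "eventually (\<lambda>n. real (s n) / (2 * real n) + 1 / real n / 4 = (2 * real (s n) + 1) / (2 * real 2 * real n)) ?F"
      using n_pos by eventually_elim (simp add: field_simps)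
    ultimately show "((\<lambda>n. (2 * real (s n) + 1) / (2 * real 2 * real n)) \<longlongrightarrow> T) ?F"
      using Lim_transform_eventually by fastforce
    show "eventually (\<lambda>n. jacobi_modulus.modulated n P_sign (s n)
      (coeffs (shift_poly (P_poly (jacobi_poly n)) (int n - int (s n)) (2 * s n + 1)))) ?F"
      using in_S by eventually_elim (rule P)
  qed
  moreover have "skew_symmetric (coeffs (shift_poly (N_poly (jacobi_poly n)) (int n - int s) (2 * s + 1)))" if "n \<in> S" for n s
    by (rule jacobi_modulus.modulated_skew_symmetric[OF jm[OF that] N[OF that] sign_pattern.sign[OF sign_pattern_N] N_sign_skew])
  moreover have "skew_symmetric (coeffs (shift_poly (P_poly (jacobi_poly n)) (int n - int s) (2 * s + 1)))" if "n \<in> S" for n s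
    by (rule jacobi_modulus.modulated_skew_symmetric[OF jm[OF that] P[OF that] sign_pattern.sign[OF sign_pattern_P] P_sign_skew])
  ultimately show ?thesis by blast
qed

end
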